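(* Let $\mathcal{S}$ be a set of $K$ strings of arbitrary lengths, of total length $N$ bits, stored contiguously on disk in the external-memory model (internal memory of size $M$, disk pages of size $B$). Let $L$ be the piece length used by the randomized string-sorting algorithm described in the context, and let $N' = \Theta\!\left(\frac{N \cdot 2\log_2 K}{L} + K\right)$. Then this algorithm sorts $\mathcal{S}$ lexicographically using $\mathrm{sort}(K, N' + 2KL) + n$ expected I/Os, where $n = N/B$.
   Context: External-memory model: a computer has an internal memory of size $M$ and an arbitrarily large disk; data move between them in blocks (disk pages) of size $B$, and cost is measured by the number of such block transfers (I/Os). Write $n = N/B$, $k = K/B$, $m = M/B$. For $\eta$ strings of total length $\mu$, $\mathrm{sort}(\eta,\mu) = O\!\left(\frac{\mu}{B}\log_m \frac{\mu}{B}\right)$ denotes the I/O cost of sorting them by external multiway mergesort. The randomized algorithm (input: set $\mathcal{S}$ of $K$ strings of total length $N$ bits; output: the sorted permutation of $\mathcal{S}$): 1. Partition every string of $\mathcal{S}$ into consecutive pieces of $L$ bits ("$L$-pieces"), where $L$ is chosen much larger than $2\log_2 K$. 2. Using a (random) hash function, assign to each $L$-piece a name, a bit string of length $2\log_2 K$; replace each string by the sequence of names of its pieces, obtaining the set $\mathcal{C}$ of "c-strings" (each keeping a pointer to its original string). 3. Sort $\mathcal{C}$ lexicographically by external mergesort. 4. For each pair of adjacent c-strings in sorted $\mathcal{C}$, compute their longest common prefix (in names) and mark the (at most two) mismatching names; let $lcp_x$ be the number of names shared by the $x$-th and $(x+1)$-th c-strings. 5. Collect the marked names together with their $L$-pieces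 (at most $2K$ pieces), sort these pieces, and assign each a rank (equal pieces get equal rank), written with $2\log_2 K$ bits. 6. Form a logical table $\mathcal{T}$ whose $b$-th column is the $b$-th c-string of sorted $\mathcal{C}$ (entry $\mathcal{T}[a,b]$ is its $a$-th name); replace each marked name by its rank and every other name by $2\log_2 K$ zero bits, logically padding shorter columns with zeros. 7. (a) For $x=2,\dots,K$, copy the first $lcp_{x-1}$ entries of column $x-1$ into column $x$ (not overwriting the mismatching names of column $x$). (b) For $x=K-1,\dots,1$, copy the first $lcp_x$ entries of column $x+1$ into column $x$. 8. Sort the columns of $\mathcal{T}$ lexicographically by external mergesort, and output the corresponding permutation of $\mathcal{S}$ via the correspondence string $\leftrightarrow$ c-string $\leftrightarrow$ column.
   Formalization: Since names of 2 log2 K bits can collide, "sorts" is shown for hashes that separate the first differing pieces of any two strings, hence with probability ≥ 1 − C(K,2)/K² > 1/2; the expected I/O bound is O(sort(K, N'+2KL) + n), so n has a constant factor; M ≥ 7B is assumed. *)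

theory Defs
  imports
    "HOL-Probability.Probability_Mass_Function"
    "HOL-Library.State_Monad"
    "HOL-Library.List_Lexorder"
begin

text \<open>
  The order on strings is the lexicographic one of \<^theory>\<open>HOL-Library.List_Lexorder\<close>
  (a proper prefix is smaller; \<^term>\<open>False < True\<close> on bits).
\<close>

subsection \<open>The external-memory machine\<close>

text \<open>
  The disk holds contiguous arrays. The entries of array \<^term>\<open>a\<close> are natural numbers written
  with \<open>width a\<close> bits, so entry \<open>i\<close> occupies the bits from \<open>i * width a\<close> (included) to
  \<open>(i + 1) * width a\<close> (excluded) of the array, and page \<open>p\<close> of the array consists of its bits
  from \<open>p * psize\<close> to \<open>(p + 1) * psize\<close>.

  Entries can be read or written only through one of the page frames of the internal memory. A frame
  holds one page at a time; loading a page costs one I/O, and a page that gets modified in memory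
  costs one further I/O, charged at its first modification, for being written back. Computation in
  internal memory is free; in particular, if two frames hold the same page, an update made through
  one of them is visible in the other one.

  A program that uses a nonexistent frame, leaves the bounds of an array, or writes a number that does
  not fit the width of the array is faulty: it clears the flag \<open>ok\<close>.
\<close>

datatype arr =
    Str | Len        \<comment> \<open>input: bits of the strings, lengths of the strings\<close>
  | CName | CDesc    \<comment> \<open>names of the c-strings, descriptors of the c-strings\<close>
  | Lcp              \<comment> \<open>longest common prefixes of adjacent c-strings\<close>
  | MKey | MDesc     \<comment> \<open>marked names\<close>
  | Pc | PDesc       \<comment> \<open>the pieces of the marked names\<close>
  | RKey | RDesc     \<comment> \<open>the ranks of the marked names\<close>
  | Tab              \<comment> \<open>the logical table, column after column\<close>
  | Out

record machine =
  psize :: nat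
  nframes :: nat
  sort_cost :: "nat \<Rightarrow> nat \<Rightarrow> nat"
  width :: "arr \<Rightarrow> nat"
  cells :: "arr \<Rightarrow> nat list"
  frame :: "nat \<Rightarrow> (arr \<times> nat \<times> bool) option"  \<comment> \<open>array, page, modified?\<close>
  ios :: nat
  ok :: bool

type_synonym 'a prog = "(machine, 'a) state"

definition page_access :: "nat \<Rightarrow> arr \<Rightarrow> bool \<Rightarrow> nat \<Rightarrow> machine \<Rightarrow> machine" where
  "page_access f a w p s =
     (if frame s f = Some (a, p, True) \<or> frame s f = Some (a, p, False) \<and> \<not> w then s
      else s\<lparr>frame := (frame s)(f := Some (a, p, w)),
             ios := ios s + (if frame s f = Some (a, p, False) then 0 else 1) + (if w then 1 else 0),
             ok := (ok s \<and> f < nframes s)\<rparr>)"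

definition pages_of :: "machine \<Rightarrow> arr \<Rightarrow> nat \<Rightarrow> nat list" where
  "pages_of s a i =
     (if width s a = 0 then []
      else [i * width s a div psize s ..< Suc (((i + 1) * width s a - 1) div psize s)])"

definition rd :: "nat \<Rightarrow> arr \<Rightarrow> nat \<Rightarrow> nat prog" where
  "rd f a i = State (\<lambda>s.
     (if i < length (cells s a) then cells s a ! i else 0,
      fold (page_access f a False) (pages_of s a i)
        (s\<lparr>ok := (ok s \<and> i < length (cells s a))\<rparr>)))"

definition wr :: "nat \<Rightarrow> arr \<Rightarrow> nat \<Rightarrow> nat \<Rightarrow> unit prog" where
  "wr f a i v = State (\<lambda>s.
     ((), fold (page_access f a True) (pages_of s a i)
       (s\<lparr>cells := (cells s)(a := (if i < length (cells s a) then (cells s a)[i := v]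
                                    else cells s a @ [v])),
          ok := (ok s \<and> i \<le> length (cells s a) \<and> v < 2 ^ width s a)\<rparr>)))"

definition size_of :: "arr \<Rightarrow> nat prog" where
  "size_of a = State (\<lambda>s. (length (cells s a), s))"

definition push :: "nat \<Rightarrow> arr \<Rightarrow> nat \<Rightarrow> unit prog" where
  "push f a v = do { n \<leftarrow> size_of a; wr f a n v }"

primrec loop :: "nat \<Rightarrow> (nat \<Rightarrow> 'r \<Rightarrow> 'r prog) \<Rightarrow> 'r \<Rightarrow> 'r prog" where
  "loop 0 body r = State_Monad.return r"
| "loop (Suc n) body r = do { r' \<leftarrow> loop n body r; body n r' }"

subsection \<open>External mergesort\<close>

fun split_lengths :: "nat list \<Rightarrow> 'a list \<Rightarrow> 'a list list" where
  "split_lengths [] xs = []"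
| "split_lengths (n # ns) xs = take n xs # split_lengths ns (drop n xs)"

text \<open>
  The multiway mergesort is a primitive. It sorts a sequence of strings stored contiguously
  in the array \<^term>\<open>d\<close>, each with a descriptor of \<^term>\<open>k\<close> words in the array \<^term>\<open>e\<close>,
  the first word being the length of the string and the other ones being satellite data. Strings and
  descriptors are permuted together. The cost is \<open>sort_cost\<close> of the number of strings and of
  the total number of bits moved, descriptors included; the contents of the frames are lost.
\<close>

definition mergesort :: "arr \<Rightarrow> arr \<Rightarrow> nat \<Rightarrow> unit prog" where
  "mergesort d e k = State (\<lambda>s.
     let descs = split_lengths (replicate (length (cells s e) div k) k) (cells s e);
         strs = split_lengths (map hd descs) (cells s d);
         ordered = sort_key fst (zip strs descs)
     in ((), s\<lparr>cells := (cells s)(d := concat (map fst ordered), e := concat (map snd ordered)),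
               frame := (\<lambda>_. None),
               ios := ios s + sort_cost s (length descs)
                 (length (cells s d) * width s d + length (cells s e) * width s e)\<rparr>))"

text \<open>
  The bound on the cost of sorting \<open>\<eta>\<close> strings of total length \<open>\<mu>\<close> bits with memory \<open>M\<close>
  and pages of size \<open>B\<close>, up to a constant factor. As usual, the number of pages and the
  logarithm are meant to be at least 1.
\<close>

definition sort_bound :: "nat \<Rightarrow> nat \<Rightarrow> nat \<Rightarrow> real \<Rightarrow> real" where
  "sort_bound M B \<eta> \<mu> = max 1 (\<mu> / B) * max 1 (log (real M / real B) (\<mu> / B))"

subsection \<open>The algorithm\<close>

definition num_pieces :: "nat \<Rightarrow> nat \<Rightarrow> nat" where
  "num_pieces L l = (l + L - 1) div L"

text \<open>
  The names are bit strings of a fixed length, represented by the numbers they denote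
  in binary; this respects their lexicographic order. A c-string descriptor consists of the number of
  its names, the index of its original string, and the position and length of that string on disk.
  The evaluation of the hash function \<^term>\<open>h\<close> on the piece being scanned causes no I/O.
\<close>

definition make_cstrings :: "(bool list \<Rightarrow> nat) \<Rightarrow> nat \<Rightarrow> nat \<Rightarrow> nat prog" where
  "make_cstrings h K L = loop K (\<lambda>i pos. do {
     l \<leftarrow> rd 0 Len i;
     _ \<leftarrow> loop (num_pieces L l) (\<lambda>j _. do {
       p \<leftarrow> loop (min L (l - j * L)) (\<lambda>t p. do {
         v \<leftarrow> rd 1 Str (pos + j * L + t);
         State_Monad.return (p @ [v = 1]) }) [];
       push 2 CName (h p) }) ();
     push 3 CDesc (num_pieces L l);
     push 3 CDesc i;
     push 3 CDesc pos;
     push 3 CDesc l;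
     State_Monad.return (pos + l) }) 0"

text \<open>
  The length, at most \<open>n\<close>, of the longest common prefix of the stretches of \<open>a\<close>
  starting at \<open>i\<close> and at \<open>j\<close>.
\<close>

definition common_prefix :: "nat \<Rightarrow> nat \<Rightarrow> arr \<Rightarrow> nat \<Rightarrow> nat \<Rightarrow> nat \<Rightarrow> nat prog" where
  "common_prefix f g a i j n = loop n (\<lambda>t c.
     if c = t then do {
       u \<leftarrow> rd f a (i + t);
       v \<leftarrow> rd g a (j + t);
       State_Monad.return (if u = v then Suc c else c) }
     else State_Monad.return c) 0"

text \<open>
  A marked name (the \<open>a\<close>-th one of a c-string of \<open>l\<close> names that starts at position \<open>off\<close> of
  \<^const>\<open>CName\<close>) is recorded by the disk position of its piece, the length of its piece and its own
  position in \<^const>\<open>CName\<close>. Nothing is marked if the c-string ends before the mismatch.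
\<close>

definition mark :: "nat \<Rightarrow> nat \<Rightarrow> nat \<Rightarrow> nat \<Rightarrow> nat \<Rightarrow> nat \<Rightarrow> unit prog" where
  "mark L off l pos slen a =
     (if a < l then do {
        push 5 MKey (pos + a * L);
        push 6 MDesc 1;
        push 6 MDesc (min L (slen - a * L));
        push 6 MDesc (off + a) }
      else State_Monad.return ())"

text \<open>
  The loop carries the offset of the current c-string and the length of its longest common prefix with
  the preceding one. If a c-string mismatches both neighbours at the same name, that name is marked once.
\<close>

definition mark_mismatches :: "nat \<Rightarrow> nat \<Rightarrow> (nat \<times> nat option) prog" where
  "mark_mismatches K L = loop K (\<lambda>x (off, left). do {
     l \<leftarrow> rd 0 CDesc (4 * x);
     pos \<leftarrow> rd 0 CDesc (4 * x + 2);
     slen \<leftarrow> rd 0 CDesc (4 * x + 3);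
     right \<leftarrow> (if Suc x < K then do {
         l' \<leftarrow> rd 1 CDesc (4 * Suc x);
         c \<leftarrow> common_prefix 2 3 CName off (off + l) (min l l');
         push 4 Lcp c;
         State_Monad.return (Some c) }
       else State_Monad.return None);
     (case left of None \<Rightarrow> State_Monad.return () | Some a \<Rightarrow> mark L off l pos slen a);
     (case right of None \<Rightarrow> State_Monad.return ()
      | Some a \<Rightarrow> if left = right then State_Monad.return () else mark L off l pos slen a);
     State_Monad.return (off + l, right) }) (0, None)"

text \<open>
  The marks are sorted by disk position, so that the pieces are collected in one
  scan of the input; then the pieces are sorted and ranked from 1 on, and the ranks
  are sorted by the positions of the marked names.
\<close>

definition collect_pieces :: "unit prog" where
  "collect_pieces = do {
     mergesort MKey MDesc 3;
     r \<leftarrow> size_of MKey;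
     loop r (\<lambda>i _. do {
       pos \<leftarrow> rd 0 MKey i;
       l \<leftarrow> rd 1 MDesc (3 * i + 1);
       tag \<leftarrow> rd 1 MDesc (3 * i + 2);
       _ \<leftarrow> loop l (\<lambda>t _. do { v \<leftarrow> rd 2 Str (pos + t); push 3 Pc v }) ();
       push 4 PDesc l;
       push 4 PDesc tag }) () }"

definition rank_pieces :: "unit prog" where
  "rank_pieces = do {
     mergesort Pc PDesc 2;
     r \<leftarrow> size_of PDesc;
     _ \<leftarrow> loop (r div 2) (\<lambda>i (off, l', \<rho>). do {
       l \<leftarrow> rd 0 PDesc (2 * i);
       tag \<leftarrow> rd 0 PDesc (2 * i + 1);
       c \<leftarrow> (if 0 < i \<and> l = l' then common_prefix 1 2 Pc (off - l') off l
              else State_Monad.return 0);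
       let \<rho>' = (if 0 < i \<and> l = l' \<and> c = l then \<rho> else Suc \<rho>);
       push 3 RKey tag;
       push 4 RDesc 1;
       push 4 RDesc \<rho>';
       State_Monad.return (off + l, l, \<rho>') }) (0, 0, 0);
     mergesort RKey RDesc 2 }"

text \<open>
  The columns are stored without the padding zeros and described by \<^const>\<open>CDesc\<close>. The loop
  carries the index of the next rank and the position of the name it belongs to.
\<close>

definition make_table :: "(nat \<times> nat) prog" where
  "make_table = do {
     n \<leftarrow> size_of CName;
     r \<leftarrow> size_of RKey;
     tag0 \<leftarrow> (if 0 < r then rd 0 RKey 0 else State_Monad.return n);
     loop n (\<lambda>q (k, tag).
       if tag = q then do {
         \<rho> \<leftarrow> rd 1 RDesc (2 * k + 1);
         push 2 Tab \<rho>;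
         tag' \<leftarrow> (if Suc k < r then rd 0 RKey (Suc k) else State_Monad.return n);
         State_Monad.return (Suc k, tag') }
       else do { push 2 Tab 0; State_Monad.return (k, tag) }) (0, tag0) }"

text \<open>
  In the left-to-right pass a name of the column being filled is marked iff its entry is
  not zero. The result of this pass is the offset of the last column, where the right-to-left
  pass starts.
\<close>

definition propagate_right :: "nat \<Rightarrow> nat prog" where
  "propagate_right K = loop (K - 1) (\<lambda>x off. do {
     l \<leftarrow> rd 0 CDesc (4 * x);
     c \<leftarrow> rd 1 Lcp x;
     _ \<leftarrow> loop c (\<lambda>a _. do {
       u \<leftarrow> rd 2 Tab (off + l + a);
       if u = 0 then do { v \<leftarrow> rd 3 Tab (off + a); wr 2 Tab (off + l + a) v }
       else State_Monad.return () }) ();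
     State_Monad.return (off + l) }) 0"

definition propagate_left :: "nat \<Rightarrow> nat \<Rightarrow> nat prog" where
  "propagate_left K off_last = loop (K - 1) (\<lambda>y off. do {
     let x = K - 2 - y;
     l \<leftarrow> rd 0 CDesc (4 * x);
     c \<leftarrow> rd 1 Lcp x;
     _ \<leftarrow> loop c (\<lambda>a _. do {
       v \<leftarrow> rd 2 Tab (off + (c - 1 - a));
       wr 3 Tab (off - l + (c - 1 - a)) v }) ();
     State_Monad.return (off - l) }) off_last"

text \<open>
  Sorting the columns without their padding zeros agrees with sorting the padded columns,
  except that it also decides between columns that become equal by padding.
\<close>

definition output_permutation :: "nat \<Rightarrow> unit prog" where
  "output_permutation K = do {
     mergesort Tab CDesc 4;
     loop K (\<lambda>x _. do { i \<leftarrow> rd 0 CDesc (4 * x + 1); push 1 Out i }) () }"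

definition string_sort :: "(bool list \<Rightarrow> nat) \<Rightarrow> nat \<Rightarrow> nat \<Rightarrow> unit prog" where
  "string_sort h K L = do {
     _ \<leftarrow> make_cstrings h K L;
     mergesort CName CDesc 4;
     _ \<leftarrow> mark_mismatches K L;
     collect_pieces;
     rank_pieces;
     _ \<leftarrow> make_table;
     off_last \<leftarrow> propagate_right K;
     _ \<leftarrow> propagate_left K off_last;
     output_permutation K }"

subsection \<open>Running the algorithm\<close>

text \<open>
  Names and ranks have \<open>\<lceil>2 log\<^sub>2 K\<rceil>\<close> bits. All other numbers are stored in words of logarithmic size.
\<close>

definition name_bits :: "nat \<Rightarrow> nat" where
  "name_bits K = nat \<lceil>2 * log 2 (real K)\<rceil>"

definition word_bits :: "nat \<Rightarrow> nat \<Rightarrow> nat" where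
  "word_bits N K = nat \<lceil>log 2 (real (2 * (N + K) + 1))\<rceil>"

definition total_length :: "bool list list \<Rightarrow> nat" where
  "total_length xs = sum_list (map length xs)"

definition initial :: "nat \<Rightarrow> nat \<Rightarrow> (nat \<Rightarrow> nat \<Rightarrow> nat) \<Rightarrow> bool list list \<Rightarrow> machine" where
  "initial M B srt xs =
     \<lparr>psize = B, nframes = M div B, sort_cost = srt,
      width = (\<lambda>a. if a \<in> {Str, Pc} then 1
                   else if a \<in> {CName, Tab} then name_bits (length xs)
                   else word_bits (total_length xs) (length xs)),
      cells = (\<lambda>_. [])(Str := map of_bool (concat xs), Len := map length xs),
      frame = (\<lambda>_. None), ios = 0, ok = True\<rparr>"

definition final ::
    "nat \<Rightarrow> nat \<Rightarrow> (nat \<Rightarrow> nat \<Rightarrow> nat) \<Rightarrow> bool list list \<Rightarrow> nat \<Rightarrow> (bool list \<Rightarrow> nat) \<Rightarrow> machine" where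
  "final M B srt xs L h = snd (run_state (string_sort h (length xs) L) (initial M B srt xs))"

subsection \<open>Random names\<close>

definition pieces :: "nat \<Rightarrow> bool list \<Rightarrow> bool list list" where
  "pieces L s = split_lengths (replicate (num_pieces L (length s)) L) s"

text \<open>
  A random hash function with values of \<open>b\<close> bits, on the nonempty pieces of at most \<open>L\<close> bits:
  the collision probability of distinct pieces is at most that of a uniformly random function.
\<close>

definition hash_family :: "nat \<Rightarrow> nat \<Rightarrow> (bool list \<Rightarrow> nat) pmf \<Rightarrow> bool" where
  "hash_family L b H \<longleftrightarrow>
     (\<forall>h \<in> set_pmf H. \<forall>p. length p \<in> {1..L} \<longrightarrow> h p < 2 ^ b) \<and>
     (\<forall>p q. length p \<in> {1..L} \<longrightarrow> length q \<in> {1..L} \<longrightarrow> p \<noteq> q \<longrightarrow>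
        measure_pmf.prob H {h. h p = h q} \<le> 1 / 2 ^ b)"

text \<open>
  The names are as good as injective for sorting if the first pieces in which any two of the strings
  differ get different names.
\<close>

definition separates :: "nat \<Rightarrow> bool list set \<Rightarrow> (bool list \<Rightarrow> nat) \<Rightarrow> bool" where
  "separates L S h \<longleftrightarrow>
     (\<forall>s \<in> S. \<forall>t \<in> S. \<forall>a. a < length (pieces L s) \<longrightarrow> a < length (pieces L t) \<longrightarrow>
        take a (pieces L s) = take a (pieces L t) \<longrightarrow> pieces L s ! a \<noteq> pieces L t ! a \<longrightarrow>
        h (pieces L s ! a) \<noteq> h (pieces L t ! a))"

definition is_sorting_permutation :: "bool list list \<Rightarrow> nat list \<Rightarrow> bool" where
  "is_sorting_permutation xs \<pi> \<longleftrightarrow>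
     distinct \<pi> \<and> set \<pi> = {..<length xs} \<and> sorted (map (\<lambda>i. xs ! i) \<pi>)"

end

theory Submission
  imports Defs
begin

text \<open>
  The sorted c-strings determine a compacted trie, and two strings are ordered by the pieces at the
  first mismatch of their c-strings. At this mismatch \<^emph>\<open>some\<close> c-string of the run of columns
  that share the prefix is adjacent to the mismatch, so its name is marked and ranked; the two passes
  spread the rank over the whole run. Hence columns compare like the strings whenever names of
  first differing pieces differ, and a union bound over the pairs of strings bounds the
  probability that this fails.

  Every frame scans an array monotonically. Therefore the I/Os are amortised against the page
  number of a cursor per frame, plus a credit that depends on whether the page of the cursor is
  already in the frame. Words of logarithmic size cost more than \<^term>\<open>K * L\<close> bits only if the
  average string has exponential length, and then sorting them is cheaper than one scan.
\<close>

section \<open>A program logic with amortised I/O accounting\<close>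

text \<open>The I/O bound is proved for every hash function whose values fit, so it survives any
  distribution; chance matters only for \<open>separates\<close>. The delicate point is what may be
  sorted: a scan may read all \<open>N\<close> input bits, a sort may not, since
  \<open>sort_bound\<close> at \<open>N\<close> can exceed the claim. \<open>bit_bound\<close>
  therefore omits the input length that \<open>page_bound\<close> contains, and every sorted array
  must be shown to hold only names, words or marked pieces.

  Faults are tracked exactly: every invariant contains \<open>ok\<close>, hence each write needs a
  proof that the value fits its width. The tightest case is a rank stored in the
  \<open>2 log K\<close> bits of a name, which needs the bound \<open>2 * (K - 1)\<close> on the
  number of marks rather than \<open>2 * K\<close>.

  Correctness is separated from the machine. The program is shown to compute
  \<open>left_pass\<close> of \<open>right_pass\<close> of a numeric table, whatever the collisions;
  only \<open>sorted_marked_table\<close>, which knows neither pages nor frames, assumes that names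
  separate pieces. There one strict implication suffices, from smaller pieces to smaller columns,
  because both orders are linear.\<close>

definition wp :: "'a prog \<Rightarrow> ('a \<Rightarrow> machine \<Rightarrow> bool) \<Rightarrow> machine \<Rightarrow> bool" where
  "wp m Q s = (case run_state m s of (r, s') \<Rightarrow> Q r s')"

lemma wp_bind [simp]: "wp (State_Monad.bind m k) Q s = wp m (\<lambda>r. wp (k r) Q) s"
  by (simp add: wp_def split: prod.splits)

lemma wp_return [simp]: "wp (State_Monad.return x) Q s = Q x s"
  by (simp add: wp_def)

lemma wp_size_of [simp]: "wp (size_of a) Q s = Q (length (cells s a)) s"
  by (simp add: wp_def size_of_def)

lemma wp_mono: "wp m Q s \<Longrightarrow> (\<And>r s'. Q r s' \<Longrightarrow> Q' r s') \<Longrightarrow> wp m Q' s"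
  by (auto simp: wp_def split: prod.splits)

lemma wp_loop:
  assumes "I 0 r s" "\<And>i r s. i < n \<Longrightarrow> I i r s \<Longrightarrow> wp (body i r) (I (Suc i)) s"
    "\<And>r s. I n r s \<Longrightarrow> Q r s"
  shows "wp (loop n body r) Q s"
proof -
  have "wp (loop j body r) (I j) s" if "j \<le> n" for j
    using that
  proof (induction j)
    case (Suc j)
    then have "wp (loop j body r) (I j) s" by simp
    then show ?case using Suc.prems assms(2)[of j] by (auto elim!: wp_mono)
  qed (use assms(1) in simp)
  from this[of n] show ?thesis by (auto intro: wp_mono assms(3))
qed

text \<open>A clean or absent page still has to be paid for when it is written.\<close>

definition page_credit :: "machine \<Rightarrow> nat \<Rightarrow> arr \<Rightarrow> nat \<Rightarrow> nat" where
  "page_credit s f a p =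
     (if frame s f = Some (a, p, True) then 0 else if frame s f = Some (a, p, False) then 1 else 2)"

lemma page_credit_le: "page_credit s f a p \<le> 2"
  by (simp add: page_credit_def)

text \<open>Credits lie between 0 and 2, so a step to a different page can change the credit by at
  most 2.\<close>

lemma page_credit_shift: "p \<le> q \<Longrightarrow> page_credit s f a q \<le> page_credit s f a p + 2 * (q - p)"
  by (cases "p = q") (auto simp: page_credit_def)

lemma page_credit_shift': "p \<le> q \<Longrightarrow> page_credit s f a p \<le> page_credit s f a q + 2 * (q - p)"
  by (cases "p = q") (auto simp: page_credit_def)

definition same_but :: "nat \<Rightarrow> machine \<Rightarrow> machine \<Rightarrow> bool" where
  "same_but f s s' \<longleftrightarrow> psize s' = psize s \<and> nframes s' = nframes s \<and> sort_cost s' = sort_cost s \<and>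
     width s' = width s \<and> cells s' = cells s \<and> (\<forall>g. g \<noteq> f \<longrightarrow> frame s' g = frame s g)"

text \<open>Loading a page is paid by the drop of the credit from 2 to 1, its first modification by
  the drop from 1 to 0. While the frame keeps the page, nothing is paid twice.\<close>

lemma page_access:
  assumes "f < nframes s"
  shows "same_but f s (page_access f a w p s)"
    "ok (page_access f a w p s) = ok s"
    "ios (page_access f a w p s) + page_credit (page_access f a w p s) f a p
       \<le> ios s + page_credit s f a p"
  using assms by (auto simp: page_access_def same_but_def page_credit_def)

text \<open>An entry that straddles page borders drags the frame along to its last page
  \<open>q\<close>; each page newly entered on the way needs 2 fresh units.\<close>

lemma fold_page_access:
  assumes "f < nframes s" "p \<le> q"
  shows "same_but f s (fold (page_access f a w) [p..<Suc q] s) \<and>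
    ok (fold (page_access f a w) [p..<Suc q] s) = ok s \<and>
    ios (fold (page_access f a w) [p..<Suc q] s)
      + page_credit (fold (page_access f a w) [p..<Suc q] s) f a q
      \<le> ios s + page_credit s f a p + 2 * (q - p)"
  using assms(2)
proof (induction q rule: dec_induct)
  case base
  then show ?case using page_access[OF assms(1), of a w p] by simp
next
  case (step q)
  let ?t = "fold (page_access f a w) [p..<Suc q] s"
  have f: "f < nframes ?t" using step assms by (auto simp: same_but_def)
  have "fold (page_access f a w) [p..<Suc (Suc q)] s = page_access f a w (Suc q) ?t"
    using step by simp
  moreover have "page_credit ?t f a (Suc q) \<le> page_credit ?t f a q + 2"
    using page_credit_shift[of q "Suc q" ?t f a] by simp
  ultimately show ?case
    using step page_access[OF f, of a w "Suc q"] by (auto simp: same_but_def)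
qed

text \<open>
  A cursor \<^term>\<open>(a, i)\<close> of a frame says that the next access through this frame is to the array
  \<^term>\<open>a\<close>, at an entry from \<^term>\<open>i\<close> on in an ascending scan, and before \<^term>\<open>i\<close> in a descending one.
\<close>

locale em =
  fixes B nf :: nat and W :: "arr \<Rightarrow> nat" and srt :: "nat \<Rightarrow> nat \<Rightarrow> nat"
  assumes B: "1 \<le> B" and nf: "7 \<le> nf"
begin

definition pg :: "arr \<Rightarrow> nat \<Rightarrow> nat" where "pg a i = i * W a div B"

lemma pg_mono: "i \<le> j \<Longrightarrow> pg a i \<le> pg a j"
  by (simp add: pg_def div_le_mono)

lemma pg_0 [simp]: "pg a 0 = 0"
  by (simp add: pg_def)

abbreviation cpg :: "arr \<times> nat \<Rightarrow> nat" where "cpg c \<equiv> pg (fst c) (snd c)"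

section \<open>Potentials of cursors and the cost of one access\<close>

definition credit :: "machine \<Rightarrow> nat \<Rightarrow> arr \<times> nat \<Rightarrow> nat" where
  "credit s f c = page_credit s f (fst c) (cpg c)"

definition state :: "(arr \<Rightarrow> nat list) \<Rightarrow> machine \<Rightarrow> bool" where
  "state C s \<longleftrightarrow> psize s = B \<and> nframes s = nf \<and> sort_cost s = srt \<and> width s = W \<and> cells s = C \<and> ok s"

lemma access:
  fixes i :: nat and a :: arr and w :: bool
  assumes s: "state C s" and f: "f < 7"
  defines "s' \<equiv> fold (page_access f a w) (pages_of s a i) s"
  shows "state C s'" "g \<noteq> f \<Longrightarrow> credit s' g c = credit s g c"
    "\<exists>y. pg a i \<le> y \<and> y \<le> pg a (Suc i) \<and>
      ios s' + page_credit s' f a y \<le> ios s + page_credit s f a (pg a i) + 2 * (y - pg a i)"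
proof -
  have fn: "f < nframes s" using f nf s by (simp add: state_def)
  \<comment> \<open>This is the page of the last bit of entry \<open>i\<close>, where the frame ends
    up. It can be \<open>pg a i\<close> itself, and it can be smaller than the page on which the
    next entry starts.\<close>
  define y where "y = ((i + 1) * W a - 1) div B"
  have "state C s' \<and> (g \<noteq> f \<longrightarrow> credit s' g c = credit s g c) \<and> (\<exists>y. pg a i \<le> y \<and> y \<le> pg a (Suc i) \<and>
      ios s' + page_credit s' f a y \<le> ios s + page_credit s f a (pg a i) + 2 * (y - pg a i))"
  proof (cases "W a = 0")
    \<comment> \<open>Width 0 does occur: for a single string, names have \<open>2 log 1 = 0\<close>
      bits. Such an entry occupies no page.\<close>
    case True
    then have "s' = s" using s by (simp add: s'_def pages_of_def state_def)
    moreover have "pg a i = 0" "pg a (Suc i) = 0" using True by (auto simp: pg_def)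
    ultimately show ?thesis using s by auto
  next
    case False
    have y1: "pg a i \<le> y" unfolding y_def pg_def using False by (intro div_le_mono) auto
    have y2: "y \<le> pg a (Suc i)" unfolding y_def pg_def by (intro div_le_mono) auto
    have s': "s' = fold (page_access f a w) [pg a i..<Suc y] s"
      using False s by (simp add: s'_def pages_of_def y_def pg_def state_def)
    show ?thesis using fold_page_access[OF fn y1, of a w] y1 y2 s unfolding s'[symmetric]
      by (auto simp: state_def same_but_def credit_def page_credit_def)
  qed
  then show "state C s'" "g \<noteq> f \<Longrightarrow> credit s' g c = credit s g c"
    "\<exists>y. pg a i \<le> y \<and> y \<le> pg a (Suc i) \<and>
      ios s' + page_credit s' f a y \<le> ios s + page_credit s f a (pg a i) + 2 * (y - pg a i)" by auto
qed

text \<open>In an ascending scan the cursor earns 6 units for each page it passes; in a descending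
  scan (\<open>desc\<close>) these units are paid in advance and released as the cursor falls. Seven
  cursors suffice because the marking phase, the most demanding one, uses seven frames.\<close>

definition asc :: "(arr \<Rightarrow> nat list) \<Rightarrow> (nat \<Rightarrow> arr \<times> nat) \<Rightarrow> nat \<Rightarrow> machine \<Rightarrow> bool" where
  "asc C \<gamma> T s \<longleftrightarrow> state C s \<and>
     ios s + (\<Sum>f<7. credit s f (\<gamma> f)) \<le> T + 6 * (\<Sum>f<7. cpg (\<gamma> f))"

definition desc :: "(arr \<Rightarrow> nat list) \<Rightarrow> (nat \<Rightarrow> arr \<times> nat) \<Rightarrow> nat \<Rightarrow> machine \<Rightarrow> bool" where
  "desc C \<gamma> T s \<longleftrightarrow> state C s \<and>
     ios s + (\<Sum>f<7. credit s f (\<gamma> f)) + 6 * (\<Sum>f<7. cpg (\<gamma> f)) \<le> T"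

text \<open>This is the interface between phases. Nothing is known about the frames, since a sort
  clears them and each phase assigns them to new arrays.\<close>

definition at_rest :: "(arr \<Rightarrow> nat list) \<Rightarrow> nat \<Rightarrow> machine \<Rightarrow> bool" where
  "at_rest C t s \<longleftrightarrow> state C s \<and> ios s \<le> t"

lemma asc_cells: "asc C \<gamma> T s \<Longrightarrow> cells s = C"
  by (simp add: asc_def state_def)

text \<open>The additive form avoids a subtraction of natural numbers when one cursor
  changes.\<close>

lemma sum_upd:
  fixes F G :: "nat \<Rightarrow> nat"
  assumes "f < 7" "\<And>g. g \<noteq> f \<Longrightarrow> F g = G g"
  shows "sum F {..<7} + G f = sum G {..<7} + F f"
proof -
  have "sum F ({..<7} - {f}) = sum G ({..<7} - {f})" using assms(2) by (intro sum.cong) auto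
  then show ?thesis using assms(1)
    sum.remove[of "{..<7}" f F] sum.remove[of "{..<7}" f G] by simp
qed

lemma access_upd:
  fixes i j :: nat and w :: bool
  assumes s: "state C s" and f: "f < 7" and c: "\<gamma> f = (a, c)"
  defines "s' \<equiv> fold (page_access f a w) (pages_of s a i) s"
  shows "(\<Sum>g<7. credit s' g ((\<gamma>(f := (a, j))) g)) + page_credit s f a (pg a c) =
      (\<Sum>g<7. credit s g (\<gamma> g)) + page_credit s' f a (pg a j)"
    "(\<Sum>g<7. cpg ((\<gamma>(f := (a, j))) g)) + pg a c = (\<Sum>g<7. cpg (\<gamma> g)) + pg a j"
proof -
  show "(\<Sum>g<7. credit s' g ((\<gamma>(f := (a, j))) g)) + page_credit s f a (pg a c) =
      (\<Sum>g<7. credit s g (\<gamma> g)) + page_credit s' f a (pg a j)"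
    using sum_upd[OF f, of "\<lambda>g. credit s' g ((\<gamma>(f := (a, j))) g)" "\<lambda>g. credit s g (\<gamma> g)"]
      access(2)[OF s f] c by (simp add: s'_def credit_def)
  show "(\<Sum>g<7. cpg ((\<gamma>(f := (a, j))) g)) + pg a c = (\<Sum>g<7. cpg (\<gamma> g)) + pg a j"
    using sum_upd[OF f, of "\<lambda>g. cpg ((\<gamma>(f := (a, j))) g)" "\<lambda>g. cpg (\<gamma> g)"] c by simp
qed

text \<open>The frame catches up from the cursor to entry \<open>i\<close>, crosses the entry, and
  the cursor then moves to the start of the next entry. These three stretches of pages are
  consecutive and cost 2 per page, well within the 6 per page that are earned.\<close>

lemma asc_access:
  assumes s: "asc C \<gamma> T s" and f: "f < 7" and a: "fst (\<gamma> f) = a" and i: "snd (\<gamma> f) \<le> i"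
  shows "asc C (\<gamma>(f := (a, Suc i))) T (fold (page_access f a w) (pages_of s a i) s)"
proof -
  define c where "c = snd (\<gamma> f)"
  have c: "\<gamma> f = (a, c)" using a c_def by auto
  have i: "c \<le> i" using i c_def by simp
  define s' where "s' = fold (page_access f a w) (pages_of s a i) s"
  have st: "state C s" using s by (simp add: asc_def)
  obtain y where y: "pg a i \<le> y" "y \<le> pg a (Suc i)"
    "ios s' + page_credit s' f a y \<le> ios s + page_credit s f a (pg a i) + 2 * (y - pg a i)"
    using access(3)[OF st f, where a = a and i = i and w = w] s'_def by auto
  have "page_credit s f a (pg a i) \<le> page_credit s f a (pg a c) + 2 * (pg a i - pg a c)"
    by (intro page_credit_shift pg_mono i)
  moreover have "page_credit s' f a (pg a (Suc i)) \<le> page_credit s' f a y + 2 * (pg a (Suc i) - y)"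
    by (intro page_credit_shift y)
  moreover have "pg a c \<le> pg a i" by (intro pg_mono i)
  ultimately show ?thesis
    using s y access(1)[OF st f, where a = a and i = i and w = w]
      access_upd(1)[where \<gamma> = \<gamma> and f = f and a = a and w = w and i = i and j = "Suc i", OF st f c]
      access_upd(2)[where \<gamma> = \<gamma> and j = "Suc i", OF st f c]
    unfolding asc_def s'_def[symmetric] by auto
qed

text \<open>Needed for an entry that is read and then possibly overwritten through the same frame:
  the cursor must not pass it yet. Crossing the entry costs 2 per page and coming back to its first
  page another 2; nothing is earned, so \<open>T\<close> grows.\<close>

lemma asc_access_stay:
  assumes s: "asc C \<gamma> T s" and f: "f < 7" and c: "\<gamma> f = (a, i)"
  shows "asc C \<gamma> (T + 4 * (pg a (Suc i) - pg a i)) (fold (page_access f a w) (pages_of s a i) s)"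
proof -
  define s' where "s' = fold (page_access f a w) (pages_of s a i) s"
  have st: "state C s" using s by (simp add: asc_def)
  obtain y where y: "pg a i \<le> y" "y \<le> pg a (Suc i)"
    "ios s' + page_credit s' f a y \<le> ios s + page_credit s f a (pg a i) + 2 * (y - pg a i)"
    using access(3)[OF st f, where a = a and i = i and w = w] s'_def by auto
  have "page_credit s' f a (pg a i) \<le> page_credit s' f a y + 2 * (y - pg a i)"
    by (intro page_credit_shift' y)
  moreover have "\<gamma>(f := (a, i)) = \<gamma>" using c by auto
  ultimately show ?thesis
    using s y access(1)[OF st f, where a = a and i = i and w = w]
      access_upd(1)[where \<gamma> = \<gamma> and f = f and a = a and w = w and i = i and j = i, OF st f c]
      access_upd(2)[where \<gamma> = \<gamma> and j = i, OF st f c]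
    unfolding asc_def s'_def[symmetric] by auto
qed

text \<open>This is the origin of the rate 6. Going down to entry \<open>i\<close> costs 2 per page,
  but the entry itself is accessed upwards: crossing it costs 2 per page and returning to its first
  page 2 more. All these pages lie between \<open>pg a i\<close> and the old cursor, as
  \<open>i < c\<close>.\<close>

lemma desc_access:
  assumes s: "desc C \<gamma> T s" and f: "f < 7" and a: "fst (\<gamma> f) = a" and i: "i < snd (\<gamma> f)"
  shows "desc C (\<gamma>(f := (a, i))) T (fold (page_access f a w) (pages_of s a i) s)"
proof -
  define c where "c = snd (\<gamma> f)"
  have c: "\<gamma> f = (a, c)" using a c_def by auto
  have i: "i < c" using i c_def by simp
  define s' where "s' = fold (page_access f a w) (pages_of s a i) s"
  have st: "state C s" using s by (simp add: desc_def)
  obtain y where y: "pg a i \<le> y" "y \<le> pg a (Suc i)"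
    "ios s' + page_credit s' f a y \<le> ios s + page_credit s f a (pg a i) + 2 * (y - pg a i)"
    using access(3)[OF st f, where a = a and i = i and w = w] s'_def by auto
  have "page_credit s f a (pg a i) \<le> page_credit s f a (pg a c) + 2 * (pg a c - pg a i)"
    using i by (intro page_credit_shift' pg_mono) simp
  moreover have "page_credit s' f a (pg a i) \<le> page_credit s' f a y + 2 * (y - pg a i)"
    by (intro page_credit_shift' y)
  moreover have "pg a (Suc i) \<le> pg a c" using i by (intro pg_mono) simp
  ultimately show ?thesis
    using s y access(1)[OF st f, where a = a and i = i and w = w]
      access_upd(1)[where \<gamma> = \<gamma> and f = f and a = a and w = w and i = i and j = i, OF st f c]
      access_upd(2)[where \<gamma> = \<gamma> and j = i, OF st f c]
    unfolding desc_def s'_def[symmetric] by auto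
qed

lemma frame_cong:
  assumes "frame s' = frame s"
  shows "credit s' f c = credit s f c"
  using assms by (simp add: credit_def page_credit_def)

lemma rd_eq:
  assumes "cells s = C" "ok s" "i < length (C a)"
  shows "run_state (rd f a i) s = (C a ! i, fold (page_access f a False) (pages_of s a i) s)"
proof -
  have "s\<lparr>ok := (ok s \<and> i < length (cells s a))\<rparr> = s" using assms by simp
  then show ?thesis using assms(1,3) by (simp only: rd_def state.sel if_True)
qed

lemma wp_rd:
  assumes "asc C \<gamma> T s" "f < 7" "fst (\<gamma> f) = a" "snd (\<gamma> f) \<le> i" "i < length (C a)"
    "\<And>s'. asc C (\<gamma>(f := (a, Suc i))) T s' \<Longrightarrow> Q (C a ! i) s'"
  shows "wp (rd f a i) Q s"
  using rd_eq[of s C i a f] asc_access[OF assms(1-4), where w = False] assms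
  by (simp add: wp_def asc_def state_def)

lemma wp_rd_stay:
  assumes "asc C \<gamma> T s" "f < 7" "\<gamma> f = (a, i)" "i < length (C a)"
    "\<And>s'. asc C \<gamma> (T + 4 * (pg a (Suc i) - pg a i)) s' \<Longrightarrow> Q (C a ! i) s'"
  shows "wp (rd f a i) Q s"
  using rd_eq[of s C i a f] asc_access_stay[OF assms(1-3), where w = False] assms
  by (simp add: wp_def asc_def state_def)

lemma wp_rd_desc:
  assumes "desc C \<gamma> T s" "f < 7" "fst (\<gamma> f) = a" "i < snd (\<gamma> f)" "i < length (C a)"
    "\<And>s'. desc C (\<gamma>(f := (a, i))) T s' \<Longrightarrow> Q (C a ! i) s'"
  shows "wp (rd f a i) Q s"
  using rd_eq[of s C i a f] desc_access[OF assms(1-4), where w = False] assms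
  by (simp add: wp_def desc_def state_def)

definition put :: "arr \<Rightarrow> nat \<Rightarrow> nat \<Rightarrow> machine \<Rightarrow> machine" where
  "put a i v s = s\<lparr>cells := (cells s)(a := (if i < length (cells s a) then (cells s a)[i := v]
                                    else cells s a @ [v])),
          ok := (ok s \<and> i \<le> length (cells s a) \<and> v < 2 ^ width s a)\<rparr>"

lemma wr_eq: "run_state (wr f a i v) s = ((), fold (page_access f a True) (pages_of (put a i v s) a i) (put a i v s))"
  by (simp add: wr_def put_def pages_of_def)

lemma credit_put: "credit (put a i v s) f c = credit s f c"
  by (intro frame_cong) (simp add: put_def)

lemma state_put:
  assumes "state C s" "i \<le> length (C a)" "v < 2 ^ W a"
  shows "state (C(a := (if i < length (C a) then (C a)[i := v] else C a @ [v]))) (put a i v s)"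
    "ios (put a i v s) = ios s"
  using assms by (auto simp: state_def put_def)

lemma put_asc:
  assumes "asc C \<gamma> T s" "i \<le> length (C a)" "v < 2 ^ W a"
  shows "asc (C(a := (if i < length (C a) then (C a)[i := v] else C a @ [v]))) \<gamma> T (put a i v s)"
  using assms state_put[of C s i a v] by (simp add: asc_def credit_put)

lemma put_desc:
  assumes "desc C \<gamma> T s" "i \<le> length (C a)" "v < 2 ^ W a"
  shows "desc (C(a := (if i < length (C a) then (C a)[i := v] else C a @ [v]))) \<gamma> T (put a i v s)"
  using assms state_put[of C s i a v] by (simp add: desc_def credit_put)

lemma wp_wr:
  assumes "asc C \<gamma> T s" "f < 7" "fst (\<gamma> f) = a" "snd (\<gamma> f) \<le> i" "i < length (C a)" "v < 2 ^ W a"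
    "\<And>s'. asc (C(a := (C a)[i := v])) (\<gamma>(f := (a, Suc i))) T s' \<Longrightarrow> Q () s'"
  shows "wp (wr f a i v) Q s"
  using asc_access[OF put_asc[where i = i, OF assms(1) _ assms(6)] assms(2-4), where w = True] assms
  by (simp add: wp_def wr_eq)

lemma wp_wr_desc:
  assumes "desc C \<gamma> T s" "f < 7" "fst (\<gamma> f) = a" "i < snd (\<gamma> f)" "i < length (C a)" "v < 2 ^ W a"
    "\<And>s'. desc (C(a := (C a)[i := v])) (\<gamma>(f := (a, i))) T s' \<Longrightarrow> Q () s'"
  shows "wp (wr f a i v) Q s"
  using desc_access[OF put_desc[where i = i, OF assms(1) _ assms(6)] assms(2-4), where w = True] assms
  by (simp add: wp_def wr_eq)

lemma wp_push:
  assumes "asc C \<gamma> T s" "f < 7" "fst (\<gamma> f) = a" "snd (\<gamma> f) \<le> length (C a)" "v < 2 ^ W a"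
    "\<And>s'. asc (C(a := C a @ [v])) (\<gamma>(f := (a, Suc (length (C a))))) T s' \<Longrightarrow> Q () s'"
  shows "wp (push f a v) Q s"
  using asc_access[OF put_asc[OF assms(1) _ assms(5), of "length (C a)"] assms(2-4), where w = True] assms
  by (simp add: wp_def push_def wr_eq asc_cells[OF assms(1)] size_of_def)

text \<open>Cursors may skip entries for free: passing a page raises the credit by at most 2 and
  earns 6.\<close>

lemma asc_weaken:
  assumes s: "asc C \<gamma> T s" and "C = C'" "T \<le> T'"
    "\<And>f. f < 7 \<Longrightarrow> fst (\<gamma> f) = fst (\<gamma>' f) \<and> snd (\<gamma> f) \<le> snd (\<gamma>' f)"
  shows "asc C' \<gamma>' T' s"
proof -
  have le: "cpg (\<gamma> f) \<le> cpg (\<gamma>' f)" if "f < 7" for f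
    using assms(4)[OF that] by (auto intro: pg_mono)
  have "credit s f (\<gamma>' f) + 6 * cpg (\<gamma> f) \<le> credit s f (\<gamma> f) + 6 * cpg (\<gamma>' f)" if "f < 7" for f
    using page_credit_shift[OF le[OF that], of s f "fst (\<gamma> f)"] le[OF that] assms(4)[OF that]
    by (simp add: credit_def)
  then have "(\<Sum>f<7. credit s f (\<gamma>' f) + 6 * cpg (\<gamma> f)) \<le> (\<Sum>f<7. credit s f (\<gamma> f) + 6 * cpg (\<gamma>' f))"
    by (intro sum_mono) simp
  then show ?thesis using assms(1-3) by (simp add: asc_def sum.distrib flip: sum_distrib_left)
qed

lemma sum7: "(\<Sum>f<7. F f) = F 0 + F 1 + F 2 + F 3 + F 4 + F 5 + F (6::nat)" for F :: "nat \<Rightarrow> nat"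
  by (simp add: numeral_eq_Suc)

lemma sum_credit_le: "(\<Sum>f<7. credit s f (\<gamma> f)) \<le> 14"
proof -
  have "(\<Sum>f<7. credit s f (\<gamma> f)) \<le> (\<Sum>f<(7::nat). 2)"
    by (intro sum_mono) (simp add: credit_def page_credit_le)
  then show ?thesis by simp
qed

lemma rest_asc:
  assumes "at_rest C t s" "\<And>f. f < 7 \<Longrightarrow> snd (\<gamma> f) = 0"
  shows "asc C \<gamma> (t + 14) s"
  using assms sum_credit_le[of s \<gamma>] by (simp add: at_rest_def asc_def)

text \<open>A phase starts with at most 14 units of credit, two for each of the seven frames. An
  ascending scan from page 0 needs no more; a descending one also deposits the pages of its starting
  cursors.\<close>

lemma rest_desc:
  assumes "at_rest C t s"
  shows "desc C \<gamma> (t + 14 + 6 * (\<Sum>f<7. cpg (\<gamma> f))) s"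
  using assms sum_credit_le[of s \<gamma>] by (simp add: at_rest_def desc_def)

lemma asc_rest:
  assumes "asc C \<gamma> T s" "C = C'" "T + 6 * (\<Sum>f<7. cpg (\<gamma> f)) \<le> t"
  shows "at_rest C' t s"
  using assms by (simp add: at_rest_def asc_def)

lemma desc_rest:
  assumes "desc C \<gamma> T s" "C = C'" "T \<le> t"
  shows "at_rest C' t s"
  using assms by (simp add: at_rest_def desc_def)

lemma split_lengths_concat: "split_lengths (map length xss) (concat xss) = xss"
  by (induction xss) auto

text \<open>The arrays are viewed as concatenations of a list \<open>its\<close> of pairs of a
  string and its descriptor. Because each descriptor starts with the length of its string, cutting
  the arrays recovers exactly this list, so the sort becomes \<open>sort_key fst\<close> on
  it.\<close>

lemma wp_mergesort:
  assumes s: "at_rest C t s" and d: "C d = concat (map fst its)" and e: "C e = concat (map snd its)"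
    and its: "\<And>u v. (u, v) \<in> set its \<Longrightarrow> length v = k \<and> hd v = length u"
    and k: "0 < k" and de: "d \<noteq> e"
    and Q: "\<And>s'. at_rest (C(d := concat (map fst (sort_key fst its)), e := concat (map snd (sort_key fst its))))
      (t + srt (length its) (length (C d) * W d + length (C e) * W e)) s' \<Longrightarrow> Q () s'"
  shows "wp (mergesort d e k) Q s"
proof -
  have c: "cells s = C" using s by (simp add: at_rest_def state_def)
  have l: "map length (map snd its) = replicate (length its) k"
    using its by (intro replicate_eqI) fastforce+
  then have "length (concat (map snd its)) = length its * k"
    by (simp add: length_concat sum_list_replicate)
  then have n: "length (C e) div k = length its" using e k by simp
  have descs: "split_lengths (replicate (length (cells s e) div k) k) (cells s e) = map snd its"
    unfolding c n using split_lengths_concat[of "map snd its"] l e by simp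
  have hds: "map hd (map snd its) = map length (map fst its)" using its by fastforce
  have strs: "split_lengths (map hd (map snd its)) (cells s d) = map fst its"
    unfolding hds c d by (rule split_lengths_concat)
  define ms where "ms = snd (run_state (mergesort d e k) s)"
  have ms: "ms = s\<lparr>cells := (cells s)(d := concat (map fst (sort_key fst its)), e := concat (map snd (sort_key fst its))),
      frame := (\<lambda>_. None),
      ios := ios s + sort_cost s (length its) (length (C d) * W d + length (C e) * W e)\<rparr>"
    using s c unfolding ms_def mergesort_def Let_def state.sel descs strs zip_map_fst_snd
    by (simp add: at_rest_def state_def)
  have "at_rest (C(d := concat (map fst (sort_key fst its)), e := concat (map snd (sort_key fst its))))
      (t + srt (length its) (length (C d) * W d + length (C e) * W e)) ms"
    using s unfolding ms by (simp add: at_rest_def state_def)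
  then have "Q () ms" by (rule Q)
  then show ?thesis by (auto simp: wp_def ms_def split: prod.splits)
qed

end

section \<open>Concatenated arrays\<close>

definition offs :: "'a list list \<Rightarrow> nat \<Rightarrow> nat" where
  "offs xss i = length (concat (take i xss))"

lemma offs_0 [simp]: "offs xss 0 = 0"
  by (simp add: offs_def)

lemma offs_Suc: "i < length xss \<Longrightarrow> offs xss (Suc i) = offs xss i + length (xss ! i)"
  by (simp add: offs_def take_Suc_conv_app_nth)

lemma offs_length: "offs xss (length xss) = length (concat xss)"
  by (simp add: offs_def)

lemma offs_mono: "i \<le> j \<Longrightarrow> offs xss i \<le> offs xss j"
proof -
  assume "i \<le> j"
  then have "take j xss = take i xss @ take (j - i) (drop i xss)" by (metis le_add_diff_inverse take_add)
  then show ?thesis by (simp add: offs_def)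
qed

lemma offs_le: "offs xss i \<le> length (concat xss)"
  using offs_mono[of "min i (length xss)" "length xss" xss] offs_length[of xss]
  by (cases "i \<le> length xss") (auto simp: offs_def min_def)

lemma offs_Suc_le: "i < length xss \<Longrightarrow> offs xss i + length (xss ! i) \<le> length (concat xss)"
  using offs_le[of xss "Suc i"] by (simp add: offs_Suc)

lemma offs_Suc_le': "i < j \<Longrightarrow> j < length xss \<Longrightarrow> offs xss i + length (xss ! i) \<le> offs xss j"
  using offs_mono[of "Suc i" j xss] by (simp add: offs_Suc)

lemma drop_offs_concat: "i < length xss \<Longrightarrow> drop (offs xss i) (concat xss) = xss ! i @ concat (drop (Suc i) xss)"
  by (subst id_take_nth_drop[of i xss], simp, simp add: offs_def)

lemma nth_concat_offs:
  assumes "i < length xss" "k < length (xss ! i)"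
  shows "concat xss ! (offs xss i + k) = xss ! i ! k"
  using drop_offs_concat[OF assms(1)] assms(2) offs_Suc_le[OF assms(1)]
  by (metis add_leE nth_append nth_drop)

lemma take_drop_concat:
  assumes "i < length xss" "k + n \<le> length (xss ! i)"
  shows "take n (drop (offs xss i + k) (concat xss)) = take n (drop k (xss ! i))"
  using drop_offs_concat[OF assms(1)] assms(2)
  by (simp add: add.commute flip: drop_drop)

lemma split_lengths_replicate_nth:
  "j < n \<Longrightarrow> split_lengths (replicate n L) s ! j = take L (drop (j * L) s)"
proof (induction n arbitrary: s j)
  case (Suc n)
  then show ?case by (cases j) (auto simp: add.commute)
qed simp

lemma length_split_lengths [simp]: "length (split_lengths ns s) = length ns"
  by (induction ns s rule: split_lengths.induct) auto

lemma length_pieces [simp]: "length (pieces L s) = num_pieces L (length s)"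
  by (simp add: pieces_def)

lemma pieces_nth: "j < num_pieces L (length s) \<Longrightarrow> pieces L s ! j = take L (drop (j * L) s)"
  by (simp add: pieces_def split_lengths_replicate_nth)

text \<open>This replaces the rounded-up quotient by a linear condition: a piece exists iff it
  starts inside the string.\<close>

lemma num_pieces_less:
  assumes "1 \<le> L"
  shows "j < num_pieces L l \<longleftrightarrow> j * L < l"
proof -
  have "j < num_pieces L l \<longleftrightarrow> Suc j \<le> (l + L - 1) div L" by (auto simp: num_pieces_def)
  also have "\<dots> \<longleftrightarrow> Suc j * L \<le> l + L - 1" using assms by (simp add: less_eq_div_iff_mult_less_eq)
  also have "\<dots> \<longleftrightarrow> j * L < l" using assms by (auto simp: algebra_simps)
  finally show ?thesis .
qed

lemma num_pieces_le: "1 \<le> L \<Longrightarrow> num_pieces L l \<le> l"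
  using num_pieces_less[of L l l] by (metis less_irrefl_nat linorder_not_less mult.commute mult_le_mono1 nat_mult_1)

(* otherwise simp rewrites frame 1 to Suc 0, which the rules for rd and push do not match *)
declare One_nat_def [simp del]

section \<open>The phases of the algorithm\<close>

definition cdesc :: "nat \<Rightarrow> bool list list \<Rightarrow> nat \<Rightarrow> nat list" where
  "cdesc L xs i = [num_pieces L (length (xs ! i)), i, offs xs i, length (xs ! i)]"

context em
begin

lemma wp_read_bits:
  assumes "asc C \<gamma> T s" "fst (\<gamma> 1) = Str" "snd (\<gamma> 1) \<le> q" "C Str = map of_bool bs" "q + n \<le> length bs"
    "\<And>s'. asc C (\<gamma>(1 := (Str, q + n))) T s' \<Longrightarrow> Q (take n (drop q bs)) s'"
  shows "wp (loop n (\<lambda>t p. do { v \<leftarrow> rd 1 Str (q + t); State_Monad.return (p @ [v = 1]) }) []) Q s"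
proof (rule wp_loop[where I = "\<lambda>t p s. p = take t (drop q bs) \<and> asc C (\<gamma>(1 := (Str, q + t))) T s"], goal_cases)
  case 1
  show ?case
    using assms(1-3) by (auto intro: asc_weaken)
next
  case (2 t p s)
  note t = 2(1) and I = 2(2)
  have "map of_bool bs ! (q + t) = (1::nat) \<longleftrightarrow> drop q bs ! t" using t assms(5) by simp
  moreover have "take (Suc t) (drop q bs) = take t (drop q bs) @ [drop q bs ! t]"
    using t assms(5) by (intro take_Suc_conv_app_nth) simp
  ultimately show ?case
    using I t assms(4,5) by (auto intro!: wp_rd)
qed (use assms(6) in auto)

lemma wp_names:
  assumes "asc C \<gamma> T s" "\<gamma> 1 = (Str, q)" "\<gamma> 2 = (CName, length (C CName))" "C Str = map of_bool (concat xs)"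
    and i: "i < length xs" and q: "q = offs xs i" and L: "1 \<le> L"
    and h: "\<And>p. length p \<in> {1..L} \<Longrightarrow> h p < 2 ^ W CName"
    and Q: "\<And>s'. asc (C(CName := C CName @ map h (pieces L (xs ! i))))
      (\<gamma>(1 := (Str, q + length (xs ! i)), 2 := (CName, length (C CName) + num_pieces L (length (xs ! i))))) T s' \<Longrightarrow> Q () s'"
  shows "wp (loop (num_pieces L (length (xs ! i))) (\<lambda>j _. do {
       p \<leftarrow> loop (min L (length (xs ! i) - j * L)) (\<lambda>t p. do {
         v \<leftarrow> rd 1 Str (q + j * L + t);
         State_Monad.return (p @ [v = 1]) }) [];
       push 2 CName (h p) }) ()) Q s"
proof -
  let ?l = "length (xs ! i)" and ?C = "\<lambda>j. C(CName := C CName @ map h (take j (pieces L (xs ! i))))"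
  \<comment> \<open>The last piece may be shorter than \<open>L\<close>, so the cursor stops at the
    end of the string.\<close>
  let ?\<gamma> = "\<lambda>j. \<gamma>(1 := (Str, q + min (j * L) ?l), 2 := (CName, length (C CName) + j))"
  show ?thesis
  proof (rule wp_loop[where I = "\<lambda>j _. asc (?C j) (?\<gamma> j) T"], goal_cases)
    case 1
    show ?case
      using assms(1-3) by (auto intro: asc_weaken)
  next
    case (2 j s)
    note j = 2(1) and I = 2(2)
    let ?n = "min L (?l - j * L)"
    have jl: "j * L < ?l" using j num_pieces_less[OF L] by simp
    have bound: "q + ?l \<le> length (concat xs)" using offs_Suc_le[OF i] q by simp
    have "take ?n (drop (q + j * L) (concat xs)) = take ?n (drop (j * L) (xs ! i))"
      unfolding q using i jl by (intro take_drop_concat) auto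
    also have "\<dots> = pieces L (xs ! i) ! j" using j by (simp add: pieces_nth min_def)
    finally have p: "take ?n (drop (q + j * L) (concat xs)) = pieces L (xs ! i) ! j" .
    have "length (pieces L (xs ! i) ! j) = ?n" using j by (simp add: pieces_nth min_def)
    \<comment> \<open>The width of names is guaranteed only on nonempty pieces of at most
      \<open>L\<close> bits; \<open>jl\<close> gives nonemptiness.\<close>
    then have hp: "h (pieces L (xs ! i) ! j) < 2 ^ W CName" using jl L by (intro h) auto
    have *: "j * L + ?n = min (Suc j * L) ?l" using jl by (auto simp: min_def)
    show ?case
      unfolding wp_bind
    proof (rule wp_read_bits[OF I, where bs = "concat xs"])
      fix s' assume s': "asc (?C j) ((?\<gamma> j)(1 := (Str, q + j * L + ?n))) T s'"
      show "wp (push 2 CName (h (take ?n (drop (q + j * L) (concat xs))))) (\<lambda>_. asc (?C (Suc j)) (?\<gamma> (Suc j)) T) s'"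
        unfolding p
      proof (rule wp_push[OF s'], simp_all add: hp j less_imp_le)
        fix s''
        assume "asc (C(CName := C CName @ map h (take j (pieces L (xs ! i))) @ [h (pieces L (xs ! i) ! j)]))
          (\<gamma>(1 := (Str, q + j * L + ?n), 2 := (CName, Suc (length (C CName) + j)))) T s''"
        then show "asc (C(CName := C CName @ map h (take (Suc j) (pieces L (xs ! i)))))
          (\<gamma>(1 := (Str, q + min (L + j * L) ?l), 2 := (CName, Suc (length (C CName) + j)))) T s''"
          using j * by (auto simp: take_Suc_conv_app_nth add.assoc)
      qed
    qed (use assms(4) jl bound in auto)
  next
    case (3 r s)
    note I = 3
    have "min (num_pieces L ?l * L) ?l = ?l"
      using num_pieces_less[OF L, of "num_pieces L ?l" ?l] by auto
    then show ?case using I by (auto intro!: Q)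
  qed
qed

lemma wp_make_cstrings:
  assumes s: "at_rest C t s" and Str: "C Str = map of_bool (concat xs)" and Len: "C Len = map length xs"
    and empty: "C CName = []" "C CDesc = []" and L: "1 \<le> L"
    and h: "\<And>p. length p \<in> {1..L} \<Longrightarrow> h p < 2 ^ W CName"
    and word: "length (concat xs) + length xs < 2 ^ W CDesc"
    and K: "K = length xs"
  defines "names \<equiv> concat (map (map h \<circ> pieces L) xs)"
  shows "wp (make_cstrings h K L) (\<lambda>_. at_rest
      (C(CName := names, CDesc := concat (map (cdesc L xs) [0..<K])))
      (t + 14 + 6 * (pg Len K + pg Str (length (concat xs)) + pg CName (length names) + pg CDesc (4 * K)))) s"
proof -
  let ?N = "\<lambda>i. concat (map (map h \<circ> pieces L) (take i xs))"
  let ?C = "\<lambda>i. C(CName := ?N i, CDesc := concat (map (cdesc L xs) [0..<i]))"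
  let ?\<gamma> = "\<lambda>i. (\<lambda>_. (Len, 0))(0 := (Len, i), 1 := (Str, offs xs i), 2 := (CName, length (?N i)), 3 := (CDesc, 4 * i))"
  have lenD: "length (concat (map (cdesc L xs) [0..<i])) = 4 * i" for i
    by (induction i) (auto simp: cdesc_def)
  show ?thesis
    unfolding make_cstrings_def
  proof (rule wp_loop[where I = "\<lambda>i pos s. pos = offs xs i \<and> asc (?C i) (?\<gamma> i) (t + 14) s"], goal_cases)
    case 1
    have "?C 0 = C" using empty by (auto simp: fun_eq_iff)
    moreover have "asc C (?\<gamma> 0) (t + 14) s" by (rule rest_asc[OF s]) auto
    ultimately show ?case by simp
  next
    case (2 i pos s)
    note i = 2(1)
    from 2 have pos: "pos = offs xs i" and I: "asc (?C i) (?\<gamma> i) (t + 14) s" by auto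
    let ?s = "xs ! i"
    have i': "i < length xs" using i K by simp
    have b: "offs xs i + length ?s \<le> length (concat xs)" by (rule offs_Suc_le[OF i'])
    have np: "num_pieces L (length ?s) \<le> length ?s" by (rule num_pieces_le[OF L])
    have N: "?N (Suc i) = ?N i @ map h (pieces L ?s)" using i' by (simp add: take_Suc_conv_app_nth)
    show ?case
      unfolding wp_bind wp_return
      apply (rule wp_rd[OF I])
          apply (use i' Len in simp_all)
      apply (rule wp_names[where i = i and xs = xs and h = h and L = L])
              apply assumption
             apply (use i' Str pos L h in simp_all)
      apply (rule wp_push, assumption, simp_all add: lenD)
       apply (use np b word in simp)
      apply (rule wp_push, assumption, simp_all add: lenD)
       apply (use i K word in simp)
      apply (rule wp_push, assumption, simp_all add: lenD)
       apply (use b word in simp)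
      apply (rule wp_push, assumption, simp_all add: lenD)
       apply (use b word in simp)
      apply (rule conjI, simp add: offs_Suc i')
      apply (rotate_tac -1, erule asc_weaken)
        apply (simp add: fun_eq_iff N cdesc_def)
       apply simp
      apply (auto simp: offs_Suc i' N)
      done
  next
    case (3 r s)
    then have "asc (?C K) (?\<gamma> K) (t + 14) s" by simp
    then show ?case
      by (rule asc_rest) (auto simp: sum7 K names_def offs_length)
  qed
qed

end

section \<open>Longest common prefixes and marks at mismatches\<close>

lemma offs_uniform:
  assumes "\<And>v. v \<in> set its \<Longrightarrow> length v = k" "x \<le> length its"
  shows "offs its x = k * x"
  using assms(2)
proof (induction x)
  case (Suc x)
  then show ?case using assms(1)[of "its ! x"] by (simp add: offs_Suc)
qed simp

lemma length_concat_uniform: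
  assumes "\<And>v. v \<in> set its \<Longrightarrow> length v = k"
  shows "length (concat its) = k * length its"
  using offs_uniform[OF assms order_refl] offs_length[of its] by simp

lemma nth_concat_uniform:
  assumes "\<And>v. v \<in> set its \<Longrightarrow> length v = k" "x < length its" "r < k"
  shows "concat its ! (k * x + r) = its ! x ! r"
  using nth_concat_offs[of x its r] offs_uniform[where x = x, OF assms(1)] assms by simp

fun lcp :: "'a list \<Rightarrow> 'a list \<Rightarrow> nat" where
  "lcp (x # xs) (y # ys) = (if x = y then Suc (lcp xs ys) else 0)"
| "lcp _ _ = 0"

lemma lcp_le: "lcp u v \<le> length u" "lcp u v \<le> length v"
  by (induction u v rule: lcp.induct) auto

lemma nth_lcp: "a < lcp u v \<Longrightarrow> u ! a = v ! a"
  by (induction u v arbitrary: a rule: lcp.induct) (auto simp: nth_Cons split: if_splits nat.splits)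

lemma nth_lcp_neq: "lcp u v < length u \<Longrightarrow> lcp u v < length v \<Longrightarrow> u ! lcp u v \<noteq> v ! lcp u v"
  by (induction u v rule: lcp.induct) auto

lemma le_lcp: "n \<le> lcp u v \<longleftrightarrow> n \<le> length u \<and> n \<le> length v \<and> take n u = take n v"
proof (induction u v arbitrary: n rule: lcp.induct)
  case (1 x xs y ys)
  then show ?case by (cases n) auto
qed auto

definition lcps :: "'a list list \<Rightarrow> nat \<Rightarrow> nat" where
  "lcps ns x = lcp (ns ! x) (ns ! Suc x)"

definition left_lcp :: "'a list list \<Rightarrow> nat \<Rightarrow> nat option" where
  "left_lcp ns x = (if x = 0 then None else Some (lcps ns (x - 1)))"

definition right_lcp :: "'a list list \<Rightarrow> nat \<Rightarrow> nat option" where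
  "right_lcp ns x = (if Suc x < length ns then Some (lcps ns x) else None)"

definition below :: "nat \<Rightarrow> nat option \<Rightarrow> nat list" where
  "below l m = (case m of None \<Rightarrow> [] | Some a \<Rightarrow> if a < l then [a] else [])"

text \<open>If both neighbours are left at the same name, a single mark remains. Equal options also
  arise for a lone c-string, where both are \<open>None\<close> and nothing is marked.\<close>

definition marks_at :: "'a list list \<Rightarrow> nat \<Rightarrow> nat list" where
  "marks_at ns x = below (length (ns ! x)) (left_lcp ns x) @
     (if left_lcp ns x = right_lcp ns x then [] else below (length (ns ! x)) (right_lcp ns x))"

definition marks :: "'a list list \<Rightarrow> nat \<Rightarrow> (nat \<times> nat) list" where
  "marks ns k = concat (map (\<lambda>x. map (Pair x) (marks_at ns x)) [0..<k])"

lemma marks_Suc: "marks ns (Suc x) = marks ns x @ map (Pair x) (marks_at ns x)"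
  by (simp add: marks_def)

locale em_words = em B nf W srt for B nf W srt +
  fixes w nb :: nat
  assumes W: "W = (\<lambda>a. if a \<in> {Str, Pc} then 1 else if a \<in> {CName, Tab} then nb else w)"
begin

lemma width_simps [simp]: "W Str = 1" "W Pc = 1" "W CName = nb" "W Tab = nb" "W Len = w" "W CDesc = w"
  "W Lcp = w" "W MKey = w" "W MDesc = w" "W PDesc = w" "W RKey = w" "W RDesc = w" "W Out = w"
  by (simp_all add: W)

lemma wp_rdv:
  assumes "asc C \<gamma> T s" "f < 7" "fst (\<gamma> f) = a" "snd (\<gamma> f) \<le> i" "i < length (C a)" "C a ! i = v"
    "\<And>s'. asc C (\<gamma>(f := (a, Suc i))) T s' \<Longrightarrow> Q v s'"
  shows "wp (rd f a i) Q s"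
  using wp_rd[of C \<gamma> T s f a i Q] assms by simp

lemma wp_common_prefix:
  assumes s: "asc C \<gamma> T s" and fg: "f < 7" "g < 7" "f \<noteq> g"
    and a: "fst (\<gamma> f) = a" "fst (\<gamma> g) = a" "snd (\<gamma> f) \<le> i" "snd (\<gamma> g) \<le> j"
    and le: "i + n \<le> length (C a)" "j + n \<le> length (C a)" and n: "n = min (length u) (length v)"
    and uv: "\<And>t. t < n \<Longrightarrow> C a ! (i + t) = u ! t" "\<And>t. t < n \<Longrightarrow> C a ! (j + t) = v ! t"
    and Q: "\<And>s'. asc C (\<gamma>(f := (a, i + n), g := (a, j + n))) T s' \<Longrightarrow> Q (lcp u v) s'"
  shows "wp (common_prefix f g a i j n) Q s"
  unfolding common_prefix_def
\<comment> \<open>The counter follows \<open>t\<close> up to the first mismatch and stands still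
  afterwards. The remaining rounds make no access, but the cursors are still moved on, so their
  final position does not depend on the mismatch.\<close>
proof (rule wp_loop[where I = "\<lambda>t c. \<lambda>s. c = min t (lcp u v) \<and> asc C (\<gamma>(f := (a, i + t), g := (a, j + t))) T s"], goal_cases)
  case 1
  show ?case
    using a fg by (auto intro!: asc_weaken[OF s])
next
  case (2 t c s)
  note t = 2(1) and I = 2(2)
  show ?case
  proof (cases "c = t")
    case False
    then show ?thesis using I by (auto intro!: asc_weaken[OF conjunct2[OF I]])
  next
    case True
    then have tl: "t \<le> lcp u v" using I by simp
    have eq: "u ! t = v ! t \<longleftrightarrow> t < lcp u v"
      using nth_lcp_neq[of u v] nth_lcp[of t u v] tl t n by (cases "t = lcp u v") auto
    have r: "(if u ! t = v ! t then Suc t else t) = min (Suc t) (lcp u v)" unfolding eq using tl by auto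
    have I': "asc C (\<gamma>(f := (a, i + t), g := (a, j + t))) T s" using I by simp
    have *: "i + t < length (C a)" "j + t < length (C a)" using t le by auto
    show ?thesis
      apply (simp only: True refl if_True wp_bind wp_return)
      apply (rule wp_rd[OF I'], simp_all add: fg fg(3)[symmetric] *)
      apply (rule wp_rd, assumption, simp_all add: fg fg(3)[symmetric] *)
      apply (use r uv[OF t] in \<open>auto split: if_splits\<close>)
      done
  qed
next
  case (3 r s)
  moreover have "lcp u v \<le> n" using lcp_le[of u v] n by simp
  ultimately show ?case using Q by simp
qed

lemma wp_mark:
  assumes s: "asc C \<gamma> T s" and \<gamma>: "\<gamma> 5 = (MKey, length (C MKey))" "\<gamma> 6 = (MDesc, length (C MDesc))"
    and b: "a < l \<Longrightarrow> pos + a * L < 2 ^ w" "slen < 2 ^ w" "a < l \<Longrightarrow> off + a < 2 ^ w" "(1::nat) < 2 ^ w"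
    and Q: "\<And>s'. asc (C(MKey := C MKey @ map (\<lambda>a. pos + a * L) (below l (Some a)),
        MDesc := C MDesc @ concat (map (\<lambda>a. [1, min L (slen - a * L), off + a]) (below l (Some a)))))
      (\<gamma>(5 := (MKey, length (C MKey) + length (below l (Some a))),
         6 := (MDesc, length (C MDesc) + 3 * length (below l (Some a))))) T s' \<Longrightarrow> Q () s'"
  shows "wp (mark L off l pos slen a) Q s"
proof (cases "a < l")
  case False
  have "\<gamma>(5 := (MKey, length (C MKey)), 6 := (MDesc, length (C MDesc))) = \<gamma>" using \<gamma> by auto
  then show ?thesis using False Q[of s] s by (simp add: mark_def below_def)
next
  case True
  show ?thesis
    unfolding mark_def wp_bind wp_return
    apply (use True in simp)
    apply (rule wp_push[OF s], simp_all add: \<gamma> b)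
    apply (rule wp_push, assumption, simp_all add: \<gamma> b)
    apply (rule wp_push, assumption, simp_all add: \<gamma> b)
     apply (rule le_less_trans[OF _ b(2)], simp)
    apply (rule wp_push, assumption, simp_all add: \<gamma> b)
    apply (rule Q)
    apply (rotate_tac -1, erule asc_weaken)
      apply (auto simp: below_def fun_eq_iff)
    done
qed


lemma wp_mark_mismatches:
  assumes s: "at_rest C t s"
    and CN: "C CName = concat ns" and CD: "C CDesc = concat (map (\<lambda>x. [length (ns ! x), idx x, p x, sl x]) [0..<K])"
    and empty: "C Lcp = []" "C MKey = []" "C MDesc = []"
    and K: "K = length ns"
    and b: "\<And>x a. x < K \<Longrightarrow> a < length (ns ! x) \<Longrightarrow> p x + a * L < 2 ^ w" "\<And>x. x < K \<Longrightarrow> sl x < 2 ^ w"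
      "length (concat ns) < 2 ^ w" "(1::nat) < 2 ^ w"
  defines "ms \<equiv> marks ns K"
  shows "wp (mark_mismatches K L) (\<lambda>_. at_rest
      (C(Lcp := map (lcps ns) [0..<K - 1], MKey := map (\<lambda>(x, a). p x + a * L) ms,
         MDesc := concat (map (\<lambda>(x, a). [1, min L (sl x - a * L), offs ns x + a]) ms)))
      (t + 14 + 6 * (2 * pg CDesc (5 * K + 1) + 2 * pg CName (length (concat ns)) + pg Lcp K
        + pg MKey (length ms) + pg MDesc (3 * length ms)))) s"
proof -
  let ?mk = "\<lambda>x. map (\<lambda>(x, a). p x + a * L) (marks ns x)"
  let ?md = "\<lambda>x. concat (map (\<lambda>(x, a). [1, min L (sl x - a * L), offs ns x + a]) (marks ns x))"
  \<comment> \<open>There are only \<open>K - 1\<close> adjacent pairs, so the last round adds no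
    entry to \<open>Lcp\<close>.\<close>
  let ?C = "\<lambda>x. C(Lcp := map (lcps ns) [0..<min x (K - 1)], MKey := ?mk x, MDesc := ?md x)"
  \<comment> \<open>Frames 2 and 3 scan the names one c-string apart. Since each c-string is
    compared with its successor only, neither of them ever moves back. Frame 1 likewise reads the
    next descriptor ahead of frame 0.\<close>
  let ?\<gamma> = "\<lambda>x. (\<lambda>_. (Len, 0))(0 := (CDesc, 4 * x), 1 := (CDesc, 4 * x + 1), 2 := (CName, offs ns x),
      3 := (CName, offs ns (Suc x)), 4 := (Lcp, min x (K - 1)),
      5 := (MKey, length (marks ns x)), 6 := (MDesc, 3 * length (marks ns x)))"
  have lmd: "length (?md x) = 3 * length (marks ns x)" for x
    by (subst length_concat_uniform[where k = 3]) auto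
  have CDn: "C CDesc ! (4 * x + r) = [length (ns ! x), idx x, p x, sl x] ! r" "4 * x + r < length (C CDesc)"
    if "x < K" "r < 4" for x r
  proof -
    let ?d = "map (\<lambda>x. [length (ns ! x), idx x, p x, sl x]) [0..<K]"
    have u: "length v = 4" if "v \<in> set ?d" for v using that by auto
    show "C CDesc ! (4 * x + r) = [length (ns ! x), idx x, p x, sl x] ! r"
      unfolding CD using that by (subst nth_concat_uniform[where its = ?d and k = 4, OF u]) auto
    show "4 * x + r < length (C CDesc)"
      unfolding CD using that by (subst length_concat_uniform[where its = ?d and k = 4, OF u]) auto
  qed
  have CDn0: "C CDesc ! (4 * x) = length (ns ! x)" "4 * x < length (C CDesc)"
    and CDn2: "C CDesc ! (4 * x + 2) = p x" "4 * x + 2 < length (C CDesc)"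
    and CDn3: "C CDesc ! (4 * x + 3) = sl x" "4 * x + 3 < length (C CDesc)" if "x < K" for x
    using CDn[OF that, of 0] CDn[OF that, of 2] CDn[OF that, of 3] by (auto simp: numeral_eq_Suc)
  show ?thesis
    unfolding mark_mismatches_def
  proof (rule wp_loop[where I = "\<lambda>x r s. fst r = offs ns x \<and> (x < K \<longrightarrow> snd r = left_lcp ns x) \<and> asc (?C x) (?\<gamma> x) (t + 14) s"], goal_cases)
    case 1
    have "?C 0 = C" using empty by (auto simp: fun_eq_iff marks_def)
    moreover have "asc C ((\<lambda>_. (Len, 0))(0 := (CDesc, 0), 1 := (CDesc, 0), 2 := (CName, 0), 3 := (CName, 0),
        4 := (Lcp, 0), 5 := (MKey, 0), 6 := (MDesc, 0))) (t + 14) s"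
      by (rule rest_asc[OF s]) auto
    then have "asc C (?\<gamma> 0) (t + 14) s" by (rule asc_weaken) auto
    ultimately show ?case
      by (simp add: left_lcp_def)
  next
    case (2 x r s)
    note x = 2(1)
    from 2 have r: "r = (offs ns x, left_lcp ns x)" and I: "asc (?C x) (?\<gamma> x) (t + 14) s" by (auto intro: prod_eqI)
    let ?l = "length (ns ! x)"
    have x': "x < length ns" using x K by simp
    have ob: "offs ns x + ?l \<le> length (concat ns)" by (rule offs_Suc_le[OF x'])
    let ?C1 = "(?C x)(Lcp := map (lcps ns) [0..<min (Suc x) (K - 1)])"
    let ?\<gamma>1 = "(?\<gamma> x)(0 := (CDesc, 4 * Suc x), 1 := (CDesc, 4 * Suc x + 1), 2 := (CName, offs ns (Suc x)),
      3 := (CName, offs ns (Suc (Suc x))), 4 := (Lcp, min (Suc x) (K - 1)))"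
    have marks: "wp (do {
        (case left_lcp ns x of None \<Rightarrow> State_Monad.return () | Some a \<Rightarrow> mark L (offs ns x) ?l (p x) (sl x) a);
        (case right_lcp ns x of None \<Rightarrow> State_Monad.return ()
          | Some a \<Rightarrow> if left_lcp ns x = right_lcp ns x then State_Monad.return () else mark L (offs ns x) ?l (p x) (sl x) a);
        State_Monad.return (offs ns x + ?l, right_lcp ns x) })
      (\<lambda>r s. fst r = offs ns (Suc x) \<and> (Suc x < K \<longrightarrow> snd r = left_lcp ns (Suc x)) \<and> asc (?C (Suc x)) (?\<gamma> (Suc x)) (t + 14) s) s'"
      if s': "asc ?C1 ?\<gamma>1 (t + 14) s'" for s'
    proof -
      have m: "wp (case m of None \<Rightarrow> State_Monad.return () | Some a \<Rightarrow> mark L (offs ns x) ?l (p x) (sl x) a) Q s''"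
        if "asc D \<delta> T s''" "\<delta> 5 = (MKey, length (D MKey))" "\<delta> 6 = (MDesc, length (D MDesc))"
        and Q: "\<And>s'. asc (D(MKey := D MKey @ map (\<lambda>a. p x + a * L) (below ?l m),
          MDesc := D MDesc @ concat (map (\<lambda>a. [1, min L (sl x - a * L), offs ns x + a]) (below ?l m))))
          (\<delta>(5 := (MKey, length (D MKey) + length (below ?l m)),
           6 := (MDesc, length (D MDesc) + 3 * length (below ?l m)))) T s' \<Longrightarrow> Q () s'" for D \<delta> T m Q s''
      proof (cases m)
        case None
        have "\<delta>(5 := (MKey, length (D MKey)), 6 := (MDesc, length (D MDesc))) = \<delta>" using that by auto
        then show ?thesis using None Q[of s''] that(1) by (simp add: below_def)
      next
        case (Some a)
        show ?thesis unfolding Some option.case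
          by (rule wp_mark[OF that(1-3)]) (use b x x' ob Q Some in auto)
      qed
      let ?R = "if left_lcp ns x = right_lcp ns x then None else right_lcp ns x"
      have R: "(case right_lcp ns x of None \<Rightarrow> State_Monad.return ()
          | Some a \<Rightarrow> if left_lcp ns x = right_lcp ns x then State_Monad.return () else mark L (offs ns x) ?l (p x) (sl x) a)
        = (case ?R of None \<Rightarrow> State_Monad.return () | Some a \<Rightarrow> mark L (offs ns x) ?l (p x) (sl x) a)"
        by (auto split: option.split)
      have ma: "marks_at ns x = below ?l (left_lcp ns x) @ below ?l ?R"
        by (simp add: marks_at_def below_def)
      have nx: "right_lcp ns x = left_lcp ns (Suc x)" if "Suc x < K"
        using that K by (simp add: right_lcp_def left_lcp_def)
      have lb: "length (concat (map (\<lambda>a. [1, min L (sl x - a * L), offs ns x + a]) as)) = 3 * length as" for as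
        by (induction as) auto
      have len: "length (marks ns (Suc x)) = length (marks ns x) + (length (below ?l (left_lcp ns x)) + length (below ?l ?R))"
        by (simp add: marks_Suc ma)
      show ?thesis
        unfolding R wp_bind wp_return
        apply (rule m[OF s'], simp, simp add: lmd)
        apply (rule m, assumption, simp, simp add: lmd lb)
        apply (intro conjI impI, simp add: offs_Suc x', simp add: nx)
        apply (rotate_tac -1, erule asc_weaken)
          apply (simp add: fun_eq_iff marks_Suc ma o_def)
         apply simp
        apply (simp add: lmd lb len)
        done
    qed
    show ?case
    proof (cases "Suc x < K")
      case False
      then have xK: "min (Suc x) (K - 1) = min x (K - 1)" by simp
      have rn: "right_lcp ns x = None" using False K by (simp add: right_lcp_def)
      show ?thesis
        unfolding r prod.case wp_bind
        apply (rule wp_rdv[OF I], (use CDn0[OF x] in \<open>simp; fail\<close>)+)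
        apply (rule wp_rdv, assumption, (use CDn2[OF x] in \<open>simp; fail\<close>)+)
        apply (rule wp_rdv, assumption, (use CDn3[OF x] in \<open>simp; fail\<close>)+)
        apply (subst if_not_P[OF False])
        apply (simp only: wp_return flip: rn)
        apply (rule marks[unfolded wp_bind])
        apply (rotate_tac -1, erule asc_weaken)
          apply (simp add: xK fun_eq_iff)
         apply simp
        apply (use offs_mono[of "Suc x" "Suc (Suc x)" ns] offs_mono[of x "Suc x" ns] in \<open>auto simp: xK\<close>)
        done
    next
      case True
      have rn: "right_lcp ns x = Some (lcps ns x)" using True K by (simp add: right_lcp_def)
      have xK: "min (Suc x) (K - 1) = Suc x" "min x (K - 1) = x" using True by auto
      have Sx: "Suc x < length ns" using True K by simp
      have lcp: "lcps ns x < 2 ^ w"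
        using lcp_le(1)[of "ns ! x" "ns ! Suc x"] ob b(3) by (simp add: lcps_def)
      show ?thesis
        unfolding r prod.case wp_bind
        apply (rule wp_rdv[OF I], (use CDn0[OF x] in \<open>simp; fail\<close>)+)
        apply (rule wp_rdv, assumption, (use CDn2[OF x] in \<open>simp; fail\<close>)+)
        apply (rule wp_rdv, assumption, (use CDn3[OF x] in \<open>simp; fail\<close>)+)
        apply (subst if_P[OF True])
        apply (simp only: wp_bind)
        apply (rule wp_rdv, assumption, (use CDn0[OF True] in \<open>simp; fail\<close>)+)
        apply (subst wp_bind)
        apply (rule wp_common_prefix[where u = "ns ! x" and v = "ns ! Suc x"], assumption, (simp; fail)+)
                 apply (simp add: offs_Suc x')
                apply (use offs_Suc_le[OF Sx] ob in \<open>simp add: CN offs_Suc x'\<close>)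
               apply (use offs_Suc_le[OF Sx] in \<open>simp add: CN offs_Suc x'\<close>)
              apply simp
             apply (simp add: CN nth_concat_offs x')
            apply (use nth_concat_offs[OF Sx] in \<open>simp add: CN offs_Suc x'\<close>)
        apply (fold lcps_def)
        apply (subst wp_bind)
        apply (rule wp_push, assumption, simp, simp, simp, simp add: lcp)
        apply (simp only: wp_return flip: rn)
        apply (rule marks[unfolded wp_bind])
        apply (rotate_tac -1, erule asc_weaken)
          apply (simp add: fun_eq_iff xK)
         apply simp
        apply (use offs_Suc_le'[of "Suc x" "Suc (Suc x)" ns] offs_mono[of x "Suc x" ns] Sx True in \<open>auto simp: offs_Suc x' xK\<close>)
        done
    qed
  next
    case (3 r s)
    then have *: "asc (?C K) (?\<gamma> K) (t + 14) s" by simp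
    \<comment> \<open>The leading frame 3 ends one c-string past the last one; \<open>take\<close>
      saturates there, so it is simply at the end of the names. The lookahead frame on the
      descriptors ends at \<open>4 * K + 1\<close>, within \<open>5 * K + 1\<close>.\<close>
    have "offs ns (Suc K) = length (concat ns)" using K by (simp add: offs_def)
    then show ?case
      using pg_mono[of "4 * K" "5 * K + 1" CDesc] pg_mono[of "4 * K + 1" "5 * K + 1" CDesc] pg_mono[of "min K (K - 1)" K Lcp]
      by (intro asc_rest[OF *]) (auto simp: sum7 K ms_def offs_length)
  qed
qed

end

section \<open>Collecting, sorting and ranking the marked pieces\<close>

lemma insort_key_map: "insort_key f (g x) (map g xs) = map g (insort_key (\<lambda>a. f (g a)) x xs)"
  by (induction xs) auto

lemma sort_key_map: "sort_key f (map g xs) = map g (sort_key (\<lambda>a. f (g a)) xs)"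
  by (induction xs) (auto simp: insort_key_map)

text \<open>This identifies the counter carried by the ranking loop, the number of distinct values
  seen so far, with a rank that no longer depends on how equal pieces were ordered.\<close>

lemma card_take_sorted:
  fixes us :: "'a::linorder list"
  assumes "sorted us" "i < length us"
  shows "card (set (take (Suc i) us)) = card {v \<in> set us. v \<le> us ! i}"
proof -
  have "set (take (Suc i) us) = {v \<in> set us. v \<le> us ! i}"
  proof (intro equalityI subsetI)
    fix v assume "v \<in> set (take (Suc i) us)"
    then obtain j where "j < length us" "j \<le> i" "v = us ! j" by (auto simp: in_set_conv_nth)
    then show "v \<in> {v \<in> set us. v \<le> us ! i}" using assms by (auto intro: sorted_nth_mono)
  next
    fix v assume "v \<in> {v \<in> set us. v \<le> us ! i}"
    then obtain j where j: "j < length us" "v = us ! j" "us ! j \<le> us ! i" by (auto simp: in_set_conv_nth)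
    show "v \<in> set (take (Suc i) us)"
    proof (cases "j \<le> i")
      case True
      then show ?thesis using j by (auto simp: in_set_conv_nth intro!: exI[of _ j])
    next
      case False
      then have "us ! i = us ! j" using j assms sorted_nth_mono[of us i j] by simp
      then show ?thesis using j assms by (auto simp: in_set_conv_nth intro!: exI[of _ i])
    qed
  qed
  then show ?thesis by simp
qed

text \<open>In a sorted list a value that occurred before occurs in particular at the preceding
  index, so comparing neighbours detects every repetition.\<close>

lemma card_insert_sorted:
  fixes us :: "'a::linorder list"
  assumes "sorted us" "i < length us"
  shows "card (set (take (Suc i) us)) =
    (if 0 < i \<and> us ! i = us ! (i - 1) then card (set (take i us)) else Suc (card (set (take i us))))"
proof -
  have t: "set (take (Suc i) us) = insert (us ! i) (set (take i us))"
    using assms by (simp add: take_Suc_conv_app_nth)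
  have "us ! i \<in> set (take i us) \<longleftrightarrow> 0 < i \<and> us ! i = us ! (i - 1)"
  proof
    assume "us ! i \<in> set (take i us)"
    then obtain j where j: "j < i" "us ! i = us ! j" by (auto simp: in_set_conv_nth)
    then show "0 < i \<and> us ! i = us ! (i - 1)"
      using assms sorted_nth_mono[of us j "i - 1"] sorted_nth_mono[of us "i - 1" i] by (auto intro: antisym)
  next
    assume "0 < i \<and> us ! i = us ! (i - 1)"
    then show "us ! i \<in> set (take i us)" using assms by (auto simp: in_set_conv_nth intro!: exI[of _ "i - 1"])
  qed
  then show ?thesis by (simp add: t card_insert_if)
qed

text \<open>Marks are sorted by disk position and ranks by position in the table; both keys are
  stored as strings of one word.\<close>

lemma sorted_singletons: "sorted (map (\<lambda>p. [p]) ps) \<longleftrightarrow> sorted (ps :: 'a::linorder list)"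
  by (induction ps) auto

lemma lcp_eq_length: "length u = length v \<Longrightarrow> lcp u v = length v \<longleftrightarrow> u = v"
  by (induction u v rule: lcp.induct) auto

text \<open>Counting distinct pieces up to and including \<open>u\<close> gives equal pieces equal
  ranks and starts at 1 for pieces that occur. The value 0 thus stays free to mean unmarked.\<close>

definition piece_rank :: "(nat list \<times> nat) list \<Rightarrow> nat list \<Rightarrow> nat" where
  "piece_rank its u = card {v \<in> fst ` set its. v \<le> u}"

context em_words
begin

lemma wp_copy_bits:
  assumes s: "asc C \<gamma> T s" and \<gamma>: "fst (\<gamma> 2) = Str" "snd (\<gamma> 2) \<le> pos" "\<gamma> 3 = (Pc, length (C Pc))"
    and Str: "C Str = map of_bool bs" and le: "pos + l \<le> length bs"
    and Q: "\<And>s'. asc (C(Pc := C Pc @ map of_bool (take l (drop pos bs))))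
      (\<gamma>(2 := (Str, pos + l), 3 := (Pc, length (C Pc) + l))) T s' \<Longrightarrow> Q () s'"
  shows "wp (loop l (\<lambda>t _. do { v \<leftarrow> rd 2 Str (pos + t); push 3 Pc v }) ()) Q s"
proof (rule wp_loop[where I = "\<lambda>t _. asc (C(Pc := C Pc @ map of_bool (take t (drop pos bs))))
      (\<gamma>(2 := (Str, pos + t), 3 := (Pc, length (C Pc) + t))) T"], goal_cases)
  case 1
  show ?case
    using \<gamma> by (auto intro: asc_weaken[OF s])
next
  case (2 t r s)
  note t = 2(1) and I = 2(2)
  have l: "length (take t (drop pos bs)) = t" using t le by simp
  have T: "take (Suc t) (drop pos bs) = take t (drop pos bs) @ [bs ! (pos + t)]"
    using t le by (simp add: take_Suc_conv_app_nth)
  show ?case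
    unfolding wp_bind
    apply (rule wp_rdv[OF I, where v = "of_bool (bs ! (pos + t))"], (use t le Str in \<open>simp; fail\<close>)+)
    apply (rule wp_push, assumption, simp, simp, (use l in \<open>simp; fail\<close>)+)
    apply (rotate_tac -1, erule asc_weaken)
      apply (simp add: fun_eq_iff T)
     apply simp
    apply (use l in \<open>auto simp: T\<close>)
    done
qed (use Q in auto)

text \<open>Distinct starting positions and disjoint stretches are what make the sorted marks
  readable in a single ascending scan of the input. The order \<open>ms'\<close> is left
  existential: later phases need only that it is a permutation.\<close>

lemma wp_collect_pieces:
  fixes ms :: "(nat \<times> nat \<times> nat) list"
  assumes s: "at_rest C t s"
    and MK: "C MKey = map fst ms" and MD: "C MDesc = concat (map (\<lambda>(p, l, g). [1, l, g]) ms)"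
    and Pc: "C Pc = []" "C PDesc = []" and Str: "C Str = map of_bool bs"
    and ms: "\<And>p l g. (p, l, g) \<in> set ms \<Longrightarrow> p + l \<le> length bs \<and> l < 2 ^ w \<and> g < 2 ^ w"
    and dist: "distinct (map fst ms)"
    and disj: "\<And>p l g p' l' g'. (p, l, g) \<in> set ms \<Longrightarrow> (p', l', g') \<in> set ms \<Longrightarrow> p < p' \<Longrightarrow> p + l \<le> p'"
  defines "pc \<equiv> \<lambda>(p, l, g). map of_bool (take l (drop p bs))"
  shows "wp collect_pieces (\<lambda>_ s'. \<exists>ms'. mset ms' = mset ms \<and> at_rest
     (C(MKey := map fst ms', MDesc := concat (map (\<lambda>(p, l, g). [1, l, g]) ms'),
        Pc := concat (map pc ms'), PDesc := concat (map (\<lambda>(p, l, g). [l, g]) ms')))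
     (t + srt (length ms) (length ms * w + 3 * length ms * w) + 14
      + 6 * (pg MKey (length ms) + pg MDesc (3 * length ms) + pg Str (length bs)
         + pg Pc (length (concat (map pc ms))) + pg PDesc (2 * length ms))) s') s"
proof -
  let ?r = "length ms" and ?it = "\<lambda>(p, l, g). ([p], [1, l, g])"
  define ms' where "ms' = sort_key (\<lambda>m. fst (?it m)) ms"
  have mset: "mset ms' = mset ms" by (simp add: ms'_def)
  then have set: "set ms' = set ms" and len: "length ms' = ?r"
    by (auto dest: mset_eq_setD mset_eq_length)
  have "sorted (map (\<lambda>m. fst (?it m)) ms')" unfolding ms'_def by (rule sorted_sort_key)
  moreover have "map (\<lambda>m. fst (?it m)) ms' = map (\<lambda>p. [p]) (map fst ms')" by auto
  ultimately have srt: "sorted (map fst ms')" by (simp only: sorted_singletons)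
  have "mset (map fst ms') = mset (map fst ms)" using mset by simp
  then have "distinct (map fst ms')" using dist mset_eq_imp_distinct_iff by blast
  then have sw: "sorted_wrt (<) (map fst ms')" using srt by (simp add: strict_sorted_iff)
  have nd: "fst (ms' ! i) < fst (ms' ! j)" if "i < j" "j < ?r" for i j
    using sorted_wrt_nth_less[OF sw that(1)] that len by simp
  have MDl: "length (concat (map (\<lambda>(p, l, g). [1, l, g]) ms)) = 3 * length ms" for ms :: "(nat \<times> nat \<times> nat) list"
    by (induction ms) auto
  have MDn: "concat (map (\<lambda>(p, l, g). [1, l, g]) ms) ! (3 * i + r) = (case ms ! i of (p, l, g) \<Rightarrow> [1, l, g] ! r)"
    if "i < length ms" "r < 3" for ms :: "(nat \<times> nat \<times> nat) list" and i r
    using that by (subst nth_concat_uniform[where k = 3]) (auto split: prod.splits)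
  have PDl: "length (concat (map (\<lambda>(p, l, g). [l, g]) ms)) = 2 * length ms" for ms :: "(nat \<times> nat \<times> nat) list"
    by (induction ms) auto
  let ?Cs = "C(MKey := map fst ms', MDesc := concat (map (\<lambda>(p, l, g). [1, l, g]) ms'))"
  let ?ts = "t + srt ?r (?r * w + 3 * ?r * w)"
  let ?P = "\<lambda>i. concat (map pc (take i ms'))" and ?D = "\<lambda>i. concat (map (\<lambda>(p, l, g). [l, g]) (take i ms'))"
  \<comment> \<open>The cursor on the input stands at the end of the piece copied last, or at 0
    before the first one.\<close>
  let ?e = "\<lambda>i. if i = 0 then 0 else fst (ms' ! (i - 1)) + fst (snd (ms' ! (i - 1)))"
  let ?C = "\<lambda>i. ?Cs(Pc := ?P i, PDesc := ?D i)"
  let ?\<gamma> = "\<lambda>i. (\<lambda>_. (Len, 0))(0 := (MKey, i), 1 := (MDesc, 3 * i), 2 := (Str, ?e i),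
      3 := (Pc, length (?P i)), 4 := (PDesc, 2 * i))"
  show ?thesis
    unfolding collect_pieces_def wp_bind
  proof (rule wp_mergesort[where its = "map ?it ms", OF s], goal_cases)
    show "C MKey = concat (map fst (map ?it ms))" unfolding MK by (induction ms) auto
    show "C MDesc = concat (map snd (map ?it ms))" unfolding MD by (simp add: o_def case_prod_unfold)
  next
    case (6 s1)
    note 6
    moreover have "concat (map fst (map ?it ms')) = map fst ms'" by (induction ms') auto
    moreover have "concat (map snd (map ?it ms')) = concat (map (\<lambda>(p, l, g). [1, l, g]) ms')"
      by (simp add: o_def case_prod_unfold)
    ultimately have s1: "at_rest ?Cs ?ts s1"
      by (simp add: sort_key_map MK MD MDl flip: ms'_def)
    then have sz: "length (cells s1 MKey) = ?r" by (simp add: at_rest_def state_def len)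
    show ?case
      unfolding wp_size_of sz
    proof (rule wp_loop[where I = "\<lambda>i _. asc (?C i) (?\<gamma> i) (?ts + 14)"], goal_cases)
      case 1
      have "?C 0 = ?Cs" using Pc by (auto simp: fun_eq_iff)
      moreover have "asc ?Cs (?\<gamma> 0) (?ts + 14) s1" by (rule rest_asc[OF s1]) auto
      ultimately show ?case by simp
    next
      case (2 i r s)
      note i = 2(1) and I = 2(2)
      obtain p l g where m: "ms' ! i = (p, l, g)" by (metis prod_cases3)
      then have in_ms: "(p, l, g) \<in> set ms" using i len set by (metis nth_mem)
      note b = ms[OF in_ms]
      have e: "?e i \<le> p"
      proof (cases "i = 0")
        case False
        obtain p' l' g' where m': "ms' ! (i - 1) = (p', l', g')" by (metis prod_cases3)
        then have "(p', l', g') \<in> set ms" using i len set False by (metis less_imp_diff_less nth_mem)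
        moreover have "p' < p" using nd[of "i - 1" i] False i m m' by simp
        ultimately show ?thesis using disj[OF _ in_ms] m' False by simp
      qed simp
      have i': "i < length ms'" using i len by simp
      have T: "take (Suc i) ms' = take i ms' @ [(p, l, g)]" using i' m by (simp add: take_Suc_conv_app_nth)
      have lp: "length (pc (p, l, g)) = l" using b by (auto simp: pc_def)
      have lt: "min (length ms') i = i" using i' by simp
      have M: "concat (map (\<lambda>(p, l, g). [1, l, g]) ms') ! (3 * i + 1) = l"
        "concat (map (\<lambda>(p, l, g). [1, l, g]) ms') ! (3 * i + 2) = g"
        using MDn[OF i', of 1] MDn[OF i', of 2] m by auto
      show ?case
        unfolding wp_bind
        apply (rule wp_rdv[OF I, where v = p], (use i' m in \<open>simp; fail\<close>)+)
        apply (rule wp_rdv[where v = l], assumption, (use i' M in \<open>simp add: MDl; fail\<close>)+)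
        apply (rule wp_rdv[where v = g], assumption, (use i' M in \<open>simp add: MDl; fail\<close>)+)
        apply (rule wp_copy_bits[where bs = bs], assumption, (use e b Str in \<open>simp; fail\<close>)+)
        apply (rule wp_push, assumption, (use b in \<open>simp add: PDl lt; fail\<close>)+)
        apply (rule wp_push, assumption, (use b in \<open>simp add: PDl lt; fail\<close>)+)
        apply (rotate_tac -1, erule asc_weaken)
          apply (simp add: fun_eq_iff T pc_def)
         apply simp
        apply (use lp in \<open>auto simp: T PDl lt m\<close>)
        done
    next
      case (3 r s)
      note I = 3
      have e: "?e ?r \<le> length bs"
      proof (cases "?r = 0")
        case False
        obtain p' l' g' where m': "ms' ! (?r - 1) = (p', l', g')" by (metis prod_cases3)
        then have "(p', l', g') \<in> set ms" using len set False by (metis diff_less less_one nth_mem zero_less_iff_neq_zero)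
        then show ?thesis using ms m' False by simp
      qed simp
      \<comment> \<open>The budget speaks of the unsorted marks; permuting the pieces preserves
        their total length.\<close>
      have "mset (concat (map pc ms')) = mset (concat (map pc ms))"
        using mset by (simp add: mset_concat flip: sum_mset_sum_list)
      then have "length (concat (map pc ms')) = length (concat (map pc ms))" by (rule mset_eq_length)
      then have "at_rest
       (C(MKey := map fst ms', MDesc := concat (map (\<lambda>(p, l, g). [1, l, g]) ms'),
          Pc := concat (map pc ms'), PDesc := concat (map (\<lambda>(p, l, g). [l, g]) ms')))
       (?ts + 14 + 6 * (pg MKey ?r + pg MDesc (3 * ?r) + pg Str (length bs)
         + pg Pc (length (concat (map pc ms))) + pg PDesc (2 * ?r))) s"
        by (intro asc_rest[OF I]) (use pg_mono[OF e, of Str] len in \<open>auto simp: sum7\<close>)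
      then show ?case
        using mset by blast
    qed
  qed auto
qed

text \<open>Of the final order \<open>its2\<close> only its sortedness by position is recorded. The
  rank refers to the unsorted \<open>its\<close>, which is legitimate because
  \<open>piece_rank\<close> depends on the set of pieces alone.\<close>

lemma wp_rank_pieces:
  fixes its :: "(nat list \<times> nat) list"
  assumes s: "at_rest C t s"
    and Pc: "C Pc = concat (map fst its)" and PD: "C PDesc = concat (map (\<lambda>(u, g). [length u, g]) its)"
    and RK: "C RKey = []" "C RDesc = []"
    and g: "\<And>u g. (u, g) \<in> set its \<Longrightarrow> g < 2 ^ w" and n: "length its < 2 ^ w" "(1::nat) < 2 ^ w"
  shows "wp rank_pieces (\<lambda>_ s'. \<exists>its1 its2. mset its2 = mset its \<and> sorted (map snd its2) \<and> at_rest
     (C(Pc := concat (map fst its1), PDesc := concat (map (\<lambda>(u, g). [length u, g]) its1),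
        RKey := map snd its2, RDesc := concat (map (\<lambda>(u, g). [1, piece_rank its u]) its2)))
     (t + srt (length its) (length (C Pc) + 2 * length its * w) + 14
      + 6 * (pg PDesc (2 * length its) + 2 * pg Pc (length (C Pc)) + pg RKey (length its) + pg RDesc (2 * length its))
      + srt (length its) (length its * w + 2 * length its * w)) s') s"
proof -
  let ?r = "length its" and ?it = "\<lambda>(u, g). (u, [length u, g])"
  define its1 where "its1 = sort_key (\<lambda>m. fst (?it m)) its"
  define us where "us = map fst its1"
  have mset1: "mset its1 = mset its" by (simp add: its1_def)
  then have set1: "set its1 = set its" and len1: "length its1 = ?r"
    by (auto dest: mset_eq_setD mset_eq_length)
  have lus: "length us = ?r" by (simp add: us_def len1)
  have "sorted (map (\<lambda>m. fst (?it m)) its1)" unfolding its1_def by (rule sorted_sort_key)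
  moreover have "map (\<lambda>m. fst (?it m)) its1 = us" by (auto simp: us_def)
  ultimately have sus: "sorted us" by simp
  have rank: "card (set (take (Suc i) us)) = piece_rank its (us ! i)" if "i < ?r" for i
  proof -
    have "set us = fst ` set its" by (simp add: us_def set1)
    then show ?thesis using card_take_sorted[OF sus, of i] that lus by (simp add: piece_rank_def)
  qed
  have lcu: "length (concat us) = length (C Pc)"
  proof -
    have "mset (concat us) = mset (C Pc)"
      unfolding us_def Pc using mset1 by (simp add: mset_concat flip: sum_mset_sum_list)
    then show ?thesis by (rule mset_eq_length)
  qed
  have PDl: "length (concat (map (\<lambda>(u, g). [length u, g]) its)) = 2 * length its" for its :: "(nat list \<times> nat) list"
    by (induction its) auto
  have RDl: "length (concat (map (\<lambda>(u, g). [1, f u]) its)) = 2 * length its" for f and its :: "(nat list \<times> nat) list"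
    by (induction its) auto
  have PDn: "concat (map (\<lambda>(u, g). [length u, g]) its1) ! (2 * i + r) = [length (us ! i), snd (its1 ! i)] ! r"
    if "i < ?r" "r < 2" for i r
    using that len1 by (subst nth_concat_uniform[where k = 2]) (auto simp: us_def split: prod.splits)
  let ?Cs = "C(Pc := concat us, PDesc := concat (map (\<lambda>(u, g). [length u, g]) its1))"
  let ?ts = "t + srt ?r (length (C Pc) + 2 * ?r * w)"
  let ?R = "\<lambda>i. map snd (take i its1)" and ?D = "\<lambda>i. concat (map (\<lambda>(u, g). [1, piece_rank its u]) (take i its1))"
  let ?C = "\<lambda>i. ?Cs(RKey := ?R i, RDesc := ?D i)"
  \<comment> \<open>Frame 1 trails frame 2 by one piece, so comparing a piece with its predecessor
    moves both forward. At \<open>i = 0\<close> truncated subtraction puts both at the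
    start.\<close>
  let ?\<gamma> = "\<lambda>i. (\<lambda>_. (Len, 0))(0 := (PDesc, 2 * i), 1 := (Pc, offs us (i - 1)), 2 := (Pc, offs us i),
      3 := (RKey, i), 4 := (RDesc, 2 * i))"
  let ?t1 = "?ts + 14 + 6 * (pg PDesc (2 * ?r) + 2 * pg Pc (length (C Pc)) + pg RKey ?r + pg RDesc (2 * ?r))"
  show ?thesis
    unfolding rank_pieces_def wp_bind
  proof (rule wp_mergesort[where its = "map ?it its", OF s], goal_cases)
    show "C Pc = concat (map fst (map ?it its))" unfolding Pc by (simp add: o_def case_prod_unfold)
    show "C PDesc = concat (map snd (map ?it its))" unfolding PD by (simp add: o_def case_prod_unfold)
  next
    case (6 s1)
    note 6
    moreover have "concat (map fst (map ?it its1)) = concat us"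
      by (simp add: us_def o_def case_prod_unfold)
    moreover have "concat (map snd (map ?it its1)) = concat (map (\<lambda>(u, g). [length u, g]) its1)"
      by (simp add: o_def case_prod_unfold)
    ultimately have s1: "at_rest ?Cs ?ts s1"
      by (simp add: sort_key_map PD PDl flip: its1_def)
    then have sz: "length (cells s1 PDesc) div 2 = ?r" by (simp add: at_rest_def state_def len1 PDl)
    show ?case
      unfolding wp_size_of sz
    proof (rule wp_loop[where I = "\<lambda>i r s. r = (offs us i, if i = 0 then 0 else length (us ! (i - 1)), card (set (take i us)))
         \<and> asc (?C i) (?\<gamma> i) (?ts + 14) s"], goal_cases)
      case 1
      have "?C 0 = ?Cs" using RK by (auto simp: fun_eq_iff)
      moreover have "asc ?Cs (?\<gamma> 0) (?ts + 14) s1" by (rule rest_asc[OF s1]) auto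
      ultimately show ?case by simp
    next
      case (2 i r s)
      note i = 2(1)
      from 2 have r: "r = (offs us i, if i = 0 then 0 else length (us ! (i - 1)), card (set (take i us)))"
        and I: "asc (?C i) (?\<gamma> i) (?ts + 14) s" by auto
      let ?l = "length (us ! i)" and ?l' = "if i = 0 then 0 else length (us ! (i - 1))"
      have i': "i < length us" using i lus by simp
      have in1: "its1 ! i \<in> set its" using i len1 set1 by (metis nth_mem)
      have gb: "snd (its1 ! i) < 2 ^ w" using g[of "fst (its1 ! i)" "snd (its1 ! i)"] in1 by simp
      have rb: "card (set (take (Suc i) us)) < 2 ^ w"
        using card_length[of "take (Suc i) us"] i' lus n by simp
      have T: "take (Suc i) its1 = take i its1 @ [its1 ! i]" using i len1 by (simp add: take_Suc_conv_app_nth)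
      have usi: "us ! i = fst (its1 ! i)" using i len1 by (simp add: us_def)
      have M: "concat (map (\<lambda>(u, g). [length u, g]) its1) ! (2 * i) = ?l"
        "concat (map (\<lambda>(u, g). [length u, g]) its1) ! (2 * i + 1) = snd (its1 ! i)"
        using PDn[OF i, of 0] PDn[OF i, of 1] by auto
      have lt: "min (length its1) i = i" using i len1 by simp
      let ?\<rho> = "card (set (take (Suc i) us))"
      let ?Q = "\<lambda>r s. r = (offs us (Suc i), if Suc i = 0 then 0 else length (us ! (Suc i - 1)), card (set (take (Suc i) us)))
         \<and> asc (?C (Suc i)) (?\<gamma> (Suc i)) (?ts + 14) s"
      have fin: "wp (do {
         push 3 RKey (snd (its1 ! i));
         push 4 RDesc 1;
         push 4 RDesc ?\<rho>;
         State_Monad.return (offs us i + ?l, ?l, ?\<rho>) }) ?Q s'"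
        if "asc (?C i) ((?\<gamma> i)(0 := (PDesc, 2 * Suc i), 1 := (Pc, offs us i), 2 := (Pc, offs us (Suc i)))) (?ts + 14) s'" for s'
        unfolding wp_bind wp_return
        apply (rule wp_push[OF that], (simp add: lt gb; fail)+)
        apply (rule wp_push, assumption, (simp add: lt RDl n; fail)+)
        apply (rule wp_push, assumption, (simp add: lt RDl rb; fail)+)
        apply (rule conjI, simp add: offs_Suc i')
        apply (rotate_tac -1, erule asc_weaken)
          apply (use rank[OF i] usi in \<open>simp add: fun_eq_iff T case_prod_unfold\<close>)
         apply simp
        apply (simp add: RDl lt)
        done
      let ?k = "\<lambda>c. do {
         let \<rho>' = (if 0 < i \<and> ?l = ?l' \<and> c = ?l then card (set (take i us)) else Suc (card (set (take i us))));
         push 3 RKey (snd (its1 ! i));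
         push 4 RDesc 1;
         push 4 RDesc \<rho>';
         State_Monad.return (offs us i + ?l, ?l, \<rho>') }"
      have mid: "wp (do {
       c \<leftarrow> (if 0 < i \<and> ?l = ?l' then common_prefix 1 2 Pc (offs us i - ?l') (offs us i) ?l
              else State_Monad.return 0); ?k c }) ?Q s'"
        if s': "asc (?C i) ((?\<gamma> i)(0 := (PDesc, 2 * Suc i))) (?ts + 14) s'" for s'
      proof (cases "0 < i \<and> ?l = ?l'")
        case False
        then have "\<not> (0 < i \<and> us ! i = us ! (i - 1))" by auto
        then have \<rho>: "Suc (card (set (take i us))) = ?\<rho>" using card_insert_sorted[OF sus i'] by auto
        have c: "(if 0 < i \<and> ?l = ?l' \<and> 0 = ?l then card (set (take i us)) else Suc (card (set (take i us)))) = ?\<rho>"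
          using False \<rho> by auto
        have "asc (?C i) ((?\<gamma> i)(0 := (PDesc, 2 * Suc i), 1 := (Pc, offs us i), 2 := (Pc, offs us (Suc i)))) (?ts + 14) s'"
          by (rule asc_weaken[OF s']) (use offs_mono[of i "Suc i" us] offs_mono[of "i - 1" i us] in auto)
        from fin[OF this] show ?thesis
          unfolding wp_bind if_not_P[OF False] wp_return Let_def c .
      next
        case True
        then have i0: "0 < i" and ll: "?l = length (us ! (i - 1))" by auto
        have im: "i - 1 < length us" using i' by simp
        have o: "offs us i - ?l' = offs us (i - 1)" "offs us (i - 1) + ?l = offs us i"
          using offs_Suc[OF im] i0 ll by simp_all
        have ol: "offs us i + ?l \<le> length (concat us)" by (rule offs_Suc_le[OF i'])
        let ?c = "lcp (us ! (i - 1)) (us ! i)"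
        have ceq: "?c = ?l \<longleftrightarrow> us ! i = us ! (i - 1)"
          using lcp_eq_length[OF ll[symmetric]] by (simp add: eq_commute)
        \<comment> \<open>Equal lengths with a common prefix of full length mean equal pieces, so
          the test of the program is the test of \<open>card_insert_sorted\<close>.\<close>
        have ceq': "(0 < i \<and> ?l = ?l' \<and> ?c = ?l) \<longleftrightarrow> (0 < i \<and> us ! i = us ! (i - 1))"
          using True ceq by blast
        have c: "(if 0 < i \<and> ?l = ?l' \<and> ?c = ?l then card (set (take i us)) else Suc (card (set (take i us)))) = ?\<rho>"
          unfolding ceq' by (simp only: card_insert_sorted[OF sus i'])
        show ?thesis
          unfolding wp_bind if_P[OF True] o(1)
        proof (rule wp_common_prefix[where u = "us ! (i - 1)" and v = "us ! i", OF s'])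
          fix s'' assume "asc (?C i) ((?\<gamma> i)(0 := (PDesc, 2 * Suc i), 1 := (Pc, offs us (i - 1) + ?l), 2 := (Pc, offs us i + ?l))) (?ts + 14) s''"
          then have "asc (?C i) ((?\<gamma> i)(0 := (PDesc, 2 * Suc i), 1 := (Pc, offs us i), 2 := (Pc, offs us (Suc i)))) (?ts + 14) s''"
            by (simp add: o offs_Suc i')
          from fin[OF this] show "wp (?k ?c) ?Q s''"
            unfolding wp_bind wp_return Let_def c .
        next
          fix t assume t: "t < ?l"
          show "?C i Pc ! (offs us (i - 1) + t) = us ! (i - 1) ! t"
            using nth_concat_offs[OF im, of t] t ll by simp
          show "?C i Pc ! (offs us i + t) = us ! i ! t"
            using nth_concat_offs[OF i', of t] t by simp
        qed (use ol o ll in auto)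
      qed
      show ?case
        unfolding r prod.case
        apply (subst wp_bind)
        apply (rule wp_rdv[OF I, where v = ?l], (use i len1 M in \<open>simp add: PDl; fail\<close>)+)
        apply (subst wp_bind)
        apply (rule wp_rdv[where v = "snd (its1 ! i)"], assumption, (use i len1 M in \<open>simp add: PDl; fail\<close>)+)
        apply (rule mid)
        apply (rotate_tac -1, erule asc_weaken)
          apply simp
         apply simp
        apply auto
        done
    next
      case (3 r s)
      then have I: "asc (?C ?r) (?\<gamma> ?r) (?ts + 14) s" by simp
      let ?Cr = "?Cs(RKey := map snd its1, RDesc := concat (map (\<lambda>(u, g). [1, piece_rank its u]) its1))"
      have s2: "at_rest ?Cr ?t1 s"
        by (rule asc_rest[OF I])
          (use pg_mono[OF offs_le, of Pc us "?r - 1"] pg_mono[OF offs_le, of Pc us ?r] in \<open>auto simp: sum7 len1 lcu\<close>)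
      let ?jt = "\<lambda>(u, g). ([g], [1, piece_rank its u])"
      define its2 where "its2 = sort_key (\<lambda>m. fst (?jt m)) its1"
      have mset2: "mset its2 = mset its" by (simp add: its2_def mset1)
      have "sorted (map (\<lambda>m. fst (?jt m)) its2)" unfolding its2_def by (rule sorted_sort_key)
      moreover have "map (\<lambda>m. fst (?jt m)) its2 = map (\<lambda>p. [p]) (map snd its2)" by auto
      ultimately have srt2: "sorted (map snd its2)" by (simp only: sorted_singletons)
      show ?case
      proof (rule wp_mergesort[where its = "map ?jt its1", OF s2])
        have *: "concat (map fst (map ?jt its)) = map snd its" for its by (induction its) auto
        have **: "concat (map snd (map ?jt xs)) = concat (map (\<lambda>(u, g). [1, piece_rank its u]) xs)" for xs
          by (simp add: o_def case_prod_unfold)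
        show "?Cr RKey = concat (map fst (map ?jt its1))" unfolding * by simp
        show "?Cr RDesc = concat (map snd (map ?jt its1))" unfolding ** by simp
        fix s' assume "at_rest (?Cr(RKey := concat (map fst (sort_key fst (map ?jt its1))),
            RDesc := concat (map snd (sort_key fst (map ?jt its1)))))
          (?t1 + srt (length (map ?jt its1)) (length (?Cr RKey) * W RKey + length (?Cr RDesc) * W RDesc)) s'"
        then have "at_rest (C(Pc := concat (map fst its1), PDesc := concat (map (\<lambda>(u, g). [length u, g]) its1),
        RKey := map snd its2, RDesc := concat (map (\<lambda>(u, g). [1, piece_rank its u]) its2)))
            (?t1 + srt ?r (?r * w + 2 * ?r * w)) s'"
          unfolding sort_key_map its2_def[symmetric] * ** by (simp add: RDl len1 us_def)
        then show "\<exists>its1 its2. mset its2 = mset its \<and> sorted (map snd its2) \<and> at_rest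
     (C(Pc := concat (map fst its1), PDesc := concat (map (\<lambda>(u, g). [length u, g]) its1),
        RKey := map snd its2, RDesc := concat (map (\<lambda>(u, g). [1, piece_rank its u]) its2)))
     (?t1 + srt ?r (?r * w + 2 * ?r * w)) s'"
          using mset2 srt2 by blast
      qed auto
    qed
  qed auto
qed

end

section \<open>The logical table\<close>

text \<open>Only the column lengths of \<open>ns\<close> are used. Values of \<open>F\<close>
  outside this shape are invisible, which is why intermediate tables may be replaced freely through
  \<open>table_cong\<close>.\<close>

definition table :: "'b list list \<Rightarrow> (nat \<Rightarrow> nat \<Rightarrow> nat) \<Rightarrow> nat list" where
  "table ns F = concat (map (\<lambda>x. map (F x) [0..<length (ns ! x)]) [0..<length ns])"

lemma offs_map_length:
  assumes "map length xss = map length yss"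
  shows "offs xss i = offs yss i"
proof -
  have "map length (take i xss) = map length (take i yss)" using assms by (metis take_map)
  then show ?thesis by (simp add: offs_def length_concat)
qed

lemma table_columns: "map length (map (\<lambda>x. map (F x) [0..<length (ns ! x)]) [0..<length ns]) = map length ns"
  by (rule nth_equalityI) auto

lemma length_table [simp]: "length (table ns F) = length (concat ns)"
  unfolding table_def length_concat table_columns ..

lemma nth_table:
  assumes "x < length ns" "a < length (ns ! x)"
  shows "table ns F ! (offs ns x + a) = F x a"
  using nth_concat_offs[of x "map (\<lambda>x. map (F x) [0..<length (ns ! x)]) [0..<length ns]" a] assms
  unfolding table_def offs_map_length[OF table_columns] by simp

lemma table_cong:
  assumes "\<And>x a. x < length ns \<Longrightarrow> a < length (ns ! x) \<Longrightarrow> F x a = G x a"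
  shows "table ns F = table ns G"
  unfolding table_def using assms by (intro arg_cong[where f = concat] map_cong) auto

lemma ex_offs:
  assumes "i < length (concat ns)"
  shows "\<exists>x a. x < length ns \<and> a < length (ns ! x) \<and> i = offs ns x + a"
  using assms
proof (induction ns arbitrary: i)
  case (Cons n ns)
  show ?case
  proof (cases "i < length n")
    case True
    then show ?thesis by (intro exI[of _ 0] exI[of _ i]) simp
  next
    case False
    with Cons.prems have "i - length n < length (concat ns)" by auto
    with Cons.IH obtain x a where "x < length ns" "a < length (ns ! x)" "i - length n = offs ns x + a" by blast
    then show ?thesis using False by (intro exI[of _ "Suc x"] exI[of _ a]) (simp add: offs_def)
  qed
qed simp

lemma offs_inj:
  assumes "x < length ns" "a < length (ns ! x)" "y < length ns" "b < length (ns ! y)"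
    "offs ns x + a = offs ns y + b"
  shows "x = y \<and> a = b"
  using assms offs_Suc_le'[of x y ns] offs_Suc_le'[of y x ns] by (cases x y rule: linorder_cases) auto

lemma table_update:
  assumes x: "x < length ns" "a < length (ns ! x)"
  shows "(table ns F)[offs ns x + a := v] = table ns (F(x := (F x)(a := v)))"
proof (rule nth_equalityI)
  fix i assume "i < length ((table ns F)[offs ns x + a := v])"
  then have il: "i < length (concat ns)" by simp
  then obtain y b where y: "y < length ns" "b < length (ns ! y)" "i = offs ns y + b" using ex_offs by blast
  show "(table ns F)[offs ns x + a := v] ! i = table ns (F(x := (F x)(a := v))) ! i"
  proof (cases "y = x \<and> b = a")
    case True
    then show ?thesis using il nth_table[OF y(1,2)] y(3) by simp
  next
    case False
    then have "offs ns x + a \<noteq> i" using offs_inj[OF x y(1,2)] y(3) by auto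
    then have "(table ns F)[offs ns x + a := v] ! i = F y b" using nth_table[OF y(1,2)] y(3) by simp
    then show ?thesis using nth_table[OF y(1,2)] y(3) False by auto
  qed
qed simp

text \<open>The zero test implements the rule that mismatching names of the receiving column are not
  overwritten, as the ranks of marked names are positive.\<close>

primrec right_pass :: "(nat \<Rightarrow> nat) \<Rightarrow> (nat \<Rightarrow> nat \<Rightarrow> nat) \<Rightarrow> nat \<Rightarrow> nat \<Rightarrow> nat" where
  "right_pass lc F 0 = F 0"
| "right_pass lc F (Suc x) = (\<lambda>a. if a < lc x \<and> F (Suc x) a = 0 then right_pass lc F x a else F (Suc x) a)"

text \<open>The column \<^term>\<open>n - y\<close>, when the last column is \<^term>\<open>n\<close>.\<close>

primrec left_pass :: "(nat \<Rightarrow> nat) \<Rightarrow> (nat \<Rightarrow> nat \<Rightarrow> nat) \<Rightarrow> nat \<Rightarrow> nat \<Rightarrow> nat \<Rightarrow> nat" where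
  "left_pass lc F n 0 = F n"
| "left_pass lc F n (Suc y) = (\<lambda>a. if a < lc (n - Suc y) then left_pass lc F n y a else F (n - Suc y) a)"

context em_words
begin

lemma desc_weaken:
  assumes s: "desc C \<gamma> T s" and "C = C'" "T \<le> T'"
    "\<And>f. f < 7 \<Longrightarrow> fst (\<gamma> f) = fst (\<gamma>' f) \<and> snd (\<gamma>' f) \<le> snd (\<gamma> f)"
  shows "desc C' \<gamma>' T' s"
proof -
  have le: "cpg (\<gamma>' f) \<le> cpg (\<gamma> f)" if "f < 7" for f
    using assms(4)[OF that] by (auto intro: pg_mono)
  have "credit s f (\<gamma>' f) + 6 * cpg (\<gamma>' f) \<le> credit s f (\<gamma> f) + 6 * cpg (\<gamma> f)" if "f < 7" for f
    using page_credit_shift'[OF le[OF that], of s f "fst (\<gamma> f)"] le[OF that] assms(4)[OF that]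
    by (simp add: credit_def)
  then have "(\<Sum>f<7. credit s f (\<gamma>' f) + 6 * cpg (\<gamma>' f)) \<le> (\<Sum>f<7. credit s f (\<gamma> f) + 6 * cpg (\<gamma> f))"
    by (intro sum_mono) simp
  then show ?thesis using assms(1-3) by (simp add: desc_def sum.distrib flip: sum_distrib_left)
qed

lemma wp_rdv_desc:
  assumes "desc C \<gamma> T s" "f < 7" "fst (\<gamma> f) = a" "i < snd (\<gamma> f)" "i < length (C a)" "C a ! i = v"
    "\<And>s'. desc C (\<gamma>(f := (a, i))) T s' \<Longrightarrow> Q v s'"
  shows "wp (rd f a i) Q s"
  using wp_rd_desc[of C \<gamma> T s f a i Q] assms by simp

lemma wp_make_table:
  assumes s: "at_rest C t s" and CN: "length (C CName) = n" and RK: "C RKey = map fst rs"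
    and RD: "C RDesc = concat (map (\<lambda>(g, \<rho>). [1, \<rho>]) rs)" and Tab: "C Tab = []"
    and sorted: "sorted_wrt (<) (map fst rs)"
    and b: "\<And>g \<rho>. (g, \<rho>) \<in> set rs \<Longrightarrow> g < n \<and> \<rho> < 2 ^ nb"
  shows "wp make_table (\<lambda>_. at_rest
     (C(Tab := map (\<lambda>q. case map_of rs q of Some \<rho> \<Rightarrow> \<rho> | None \<Rightarrow> 0) [0..<n]))
     (t + 14 + 6 * (pg RKey (length rs) + pg RDesc (2 * length rs) + pg Tab n))) s"
proof -
  \<comment> \<open>In \<open>?tag\<close> the value \<open>n\<close> is a sentinel: it differs from
    every position \<open>q < n\<close>, so the comparison fails once all marks are
    consumed.\<close>
  let ?v = "\<lambda>q. case map_of rs q of Some \<rho> \<Rightarrow> \<rho> | None \<Rightarrow> 0"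
  let ?r = "length rs" and ?tag = "\<lambda>k. if k < length rs then fst (rs ! k) else n"
  have c: "cells s = C" using s by (simp add: at_rest_def state_def)
  have RDl: "length (concat (map (\<lambda>(g, \<rho>). [1, \<rho>]) rs)) = 2 * length rs" for rs :: "(nat \<times> nat) list"
    by (induction rs) auto
  have RDn: "C RDesc ! (2 * k + 1) = snd (rs ! k)" "2 * k + 1 < length (C RDesc)" if "k < ?r" for k
  proof -
    show "C RDesc ! (2 * k + 1) = snd (rs ! k)"
      unfolding RD using that by (subst nth_concat_uniform[where k = 2]) (auto split: prod.splits)
    show "2 * k + 1 < length (C RDesc)" unfolding RD RDl using that by simp
  qed
  let ?C = "\<lambda>q. C(Tab := map ?v [0..<q])"
  \<comment> \<open>The position of mark \<open>k\<close> has already been read ahead, hence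
    \<open>Suc k\<close>; the minimum covers the exhausted list.\<close>
  let ?\<gamma> = "\<lambda>q k. (\<lambda>_. (Len, 0))(0 := (RKey, min (Suc k) ?r), 1 := (RDesc, 2 * k), 2 := (Tab, q))"
  have less: "fst (rs ! i) < fst (rs ! j)" if "i < j" "j < ?r" for i j
    using sorted_wrt_nth_less[OF sorted that(1)] that by simp
  have dist: "distinct (map fst rs)" using sorted by (simp add: strict_sorted_iff)
  have "at_rest (?C 0) t s" using s Tab by (auto simp: fun_upd_idem)
  then have "asc (?C 0) ((\<lambda>_. (Len, 0))(0 := (RKey, 0), 1 := (RDesc, 0), 2 := (Tab, 0))) (t + 14) s"
    by (rule rest_asc) auto
  note I0 = this
  \<comment> \<open>All earlier marks lie below \<open>q\<close> and the next one not below
    \<open>q\<close>. Together with strict sortedness, a failed comparison therefore proves that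
    \<open>q\<close> is unmarked.\<close>
  let ?I = "\<lambda>q r s. snd r = ?tag (fst r) \<and> fst r \<le> ?r \<and> (\<forall>j<fst r. fst (rs ! j) < q) \<and> (q < n \<longrightarrow> q \<le> snd r) \<and>
    asc (?C q) (?\<gamma> q (fst r)) (t + 14) s"
  have loop: "wp (loop n (\<lambda>q (k, tag).
       if tag = q then do {
         \<rho> \<leftarrow> rd 1 RDesc (2 * k + 1);
         push 2 Tab \<rho>;
         tag' \<leftarrow> (if Suc k < ?r then rd 0 RKey (Suc k) else State_Monad.return n);
         State_Monad.return (Suc k, tag') }
       else do { push 2 Tab 0; State_Monad.return (k, tag) }) (0, ?tag 0))
    (\<lambda>_. at_rest (C(Tab := map ?v [0..<n]))
     (t + 14 + 6 * (pg RKey (length rs) + pg RDesc (2 * length rs) + pg Tab n))) s'"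
    if s': "asc (?C 0) (?\<gamma> 0 0) (t + 14) s'" for s'
  proof (rule wp_loop[where I = ?I], goal_cases)
    case 1
    show ?case using s' by auto
  next
    case (2 q r s)
    note q = 2(1) and I = 2(2)
    define k where "k = fst r"
    have r: "r = (k, ?tag k)" using I by (simp add: k_def prod_eq_iff)
    have k: "k \<le> ?r" and lt: "\<forall>j<k. fst (rs ! j) < q" and tag: "snd r = ?tag k" and qr: "q \<le> snd r"
      and a: "asc (?C q) (?\<gamma> q k) (t + 14) s"
      using I q unfolding k_def by blast+
    have qt: "q \<le> ?tag k" using tag qr by simp
    show ?case
    proof (cases "?tag k = q")
      case True
      then have kr: "k < ?r" and kq: "fst (rs ! k) = q" using q by (auto split: if_splits)
      have in_rs: "(q, snd (rs ! k)) \<in> set rs" using kr kq by (metis nth_mem prod.collapse)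
      then have v: "?v q = snd (rs ! k)" using dist by simp
      have lt': "\<forall>j<Suc k. fst (rs ! j) < Suc q" using lt kq by (auto simp: less_Suc_eq)
      have qt': "Suc q \<le> ?tag (Suc k)" if "Suc q < n" using less[of k "Suc k"] kq that by auto
      show ?thesis
        unfolding r prod.case if_P[OF True] wp_bind
        apply (rule wp_rdv[OF a, where v = "?v q"], simp, simp, simp, (use RDn[OF kr] in \<open>simp; fail\<close>), (use RDn[OF kr] v in \<open>simp; fail\<close>))
        apply (rule wp_push, assumption, simp, simp, simp, (use b[OF in_rs] v in \<open>simp; fail\<close>))
        apply (cases "Suc k < ?r")
        subgoal
          apply (simp only: if_True wp_return)
          apply (rule wp_rdv[where v = "fst (rs ! Suc k)"], assumption, simp, simp, simp, simp add: RK, simp add: RK)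
          apply (simp only: wp_return fst_conv snd_conv)
          apply (intro conjI lt')
             apply simp
            apply simp
          using qt' apply simp
          apply (rotate_tac -1, erule asc_weaken)
            apply simp
           apply simp
          apply auto
          done
        subgoal
          apply (simp only: if_False wp_return fst_conv snd_conv)
          apply (intro conjI lt')
             apply simp
            apply (use kr in simp)
           apply (use kr in simp)
          apply (rotate_tac -1, erule asc_weaken)
            apply simp
           apply simp
          apply auto
          done
        done
    next
      case False
      have "q \<notin> set (map fst rs)"
      proof
        assume "q \<in> set (map fst rs)"
        then obtain j where j: "j < ?r" "fst (rs ! j) = q" by (auto simp: in_set_conv_nth)
        then have "k \<le> j" using lt by (meson less_irrefl not_le)
        then have "?tag k \<le> q" using j less[of k j] by (cases "k = j") auto
        then show False using qt False by simp
      qed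
      then have v: "?v q = 0" by (simp add: map_of_eq_None_iff[THEN iffD2])
      show ?thesis
        unfolding r prod.case if_not_P[OF False] wp_bind wp_return
        apply (rule wp_push[OF a], simp, simp, simp, simp)
        apply (simp only: fst_conv snd_conv)
        apply (intro conjI refl k)
          apply (use lt in \<open>auto simp: less_Suc_eq\<close>)[1]
         apply (use qt False in \<open>auto split: if_splits\<close>)[1]
        apply (rotate_tac -1, erule asc_weaken)
          apply (simp add: v)
         apply simp
        apply simp
        done
    qed
  next
    case (3 r s)
    note I = 3
    from 3 have a: "asc (?C n) (?\<gamma> n (fst r)) (t + 14) s" and "fst r \<le> ?r" by auto
    then show ?case
      using pg_mono[of "min (Suc (fst r)) ?r" ?r RKey] pg_mono[of "2 * fst r" "2 * ?r" RDesc]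
      by (intro asc_rest[OF a]) (auto simp: sum7)
  qed
  have l: "length (C RKey) = ?r" by (simp add: RK)
  show ?thesis
    unfolding make_table_def wp_bind wp_size_of c CN l
  proof (cases "?r = 0", goal_cases)
    case 1
    then show ?case using loop[of s] I0 by simp
  next
    case 2
    then have r: "0 < ?r" by simp
    show ?case
      unfolding if_P[OF r]
      by (rule wp_rdv[OF I0, where v = "?tag 0"], simp, simp, simp, (use r in \<open>simp add: RK; fail\<close>)+,
          rule loop, erule asc_weaken, simp, simp, use r in \<open>auto simp: Suc_le_eq\<close>)
  qed
qed

text \<open>The target entry is tested and perhaps overwritten through the same frame, so its read
  is a staying access. Its surcharge of 4 per page telescopes over the table and explains the extra
  summand of the bound.\<close>

lemma wp_propagate_right:
  assumes s: "at_rest C t s" and K: "K = length ns" "1 \<le> K"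
    and CD: "\<And>x. x < K \<Longrightarrow> C CDesc ! (4 * x) = length (ns ! x)" "length (C CDesc) = 4 * K"
    and Lcp: "C Lcp = map lc [0..<K - 1]"
    and lc: "\<And>x. Suc x < K \<Longrightarrow> lc x \<le> length (ns ! x) \<and> lc x \<le> length (ns ! Suc x)"
    and Tab: "C Tab = table ns F" and b: "\<And>x a. F x a < 2 ^ nb"
  shows "wp (propagate_right K) (\<lambda>off s. off = offs ns (K - 1) \<and> at_rest (C(Tab := table ns (right_pass lc F)))
     (t + 14 + 6 * (pg CDesc (4 * K) + pg Lcp K + 2 * pg Tab (length (concat ns))) + 4 * pg Tab (length (concat ns))) s) s"
proof -
  let ?F = "\<lambda>x z. if z \<le> x then right_pass lc F z else F z"
  let ?C = "\<lambda>x. C(Tab := table ns (?F x))"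
  let ?\<gamma> = "\<lambda>x. (\<lambda>_. (Len, 0))(0 := (CDesc, 4 * x), 1 := (Lcp, x), 2 := (Tab, offs ns (Suc x)), 3 := (Tab, offs ns x))"
  have bR: "right_pass lc F x a < 2 ^ nb" for x a
    by (induction x arbitrary: a) (auto simp: b)
  show ?thesis
    unfolding propagate_right_def
  proof (rule wp_loop[where I = "\<lambda>x off s. off = offs ns x \<and> asc (?C x) (?\<gamma> x) (t + 14 + 4 * pg Tab (offs ns (Suc x))) s"], goal_cases)
    case 1
    have "table ns F = table ns (?F 0)" by (rule table_cong) auto
    then have C0: "C = ?C 0" using Tab by (metis fun_upd_triv)
    have "asc C ((\<lambda>_. (Len, 0))(0 := (CDesc, 0), 1 := (Lcp, 0), 2 := (Tab, 0), 3 := (Tab, 0))) (t + 14) s"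
      by (rule rest_asc[OF s]) auto
    then have "asc (?C 0) (?\<gamma> 0) (t + 14 + 4 * pg Tab (offs ns (Suc 0))) s"
      by (rule asc_weaken) (use C0 in auto)
    then show ?case by simp
  next
    case (2 x off s)
    note x = 2(1)
    from 2 have off: "off = offs ns x" and I: "asc (?C x) (?\<gamma> x) (t + 14 + 4 * pg Tab (offs ns (Suc x))) s" by auto
    have x1: "x < length ns" "Suc x < length ns" using x K by auto
    have lx: "lc x \<le> length (ns ! x)" "lc x \<le> length (ns ! Suc x)" using lc[of x] x by auto
    let ?o = "offs ns (Suc x)"
    have oS: "offs ns x + length (ns ! x) = ?o" using offs_Suc[OF x1(1)] by simp
    \<comment> \<open>The table in the middle of column \<open>Suc x\<close>: its first
      \<open>a\<close> entries are final and the rest is still original.\<close>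
    let ?G = "\<lambda>a z. if z \<le> x then right_pass lc F z else if z = Suc x
      then (\<lambda>b. if b < a then right_pass lc F (Suc x) b else F (Suc x) b) else F z"
    let ?D = "\<lambda>a. C(Tab := table ns (?G a))"
    let ?\<delta> = "\<lambda>a. (?\<gamma> x)(0 := (CDesc, 4 * Suc x), 1 := (Lcp, Suc x), 2 := (Tab, ?o + a), 3 := (Tab, offs ns x + a))"
    have inner: "wp (loop (lc x) (\<lambda>a _. do {
       u \<leftarrow> rd 2 Tab (?o + a);
       if u = 0 then do { v \<leftarrow> rd 3 Tab (offs ns x + a); wr 2 Tab (?o + a) v }
       else State_Monad.return () }) ()) Q s'"
      if s': "asc (?D 0) (?\<delta> 0) (t + 14 + 4 * pg Tab ?o) s'"
      and Q: "\<And>r s'. asc (?D (lc x)) (?\<delta> (lc x)) (t + 14 + 4 * pg Tab (?o + lc x)) s' \<Longrightarrow> Q r s'" for s' Q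
    proof (rule wp_loop[where I = "\<lambda>a _. asc (?D a) (?\<delta> a) (t + 14 + 4 * pg Tab (?o + a))"], goal_cases)
      case 1
      show ?case using s' by simp
    next
      case (2 a r s)
      note a = 2(1) and I = 2(2)
      have ax: "a < length (ns ! x)" "a < length (ns ! Suc x)" using a lx by auto
      have il: "?o + a < length (concat ns)" using offs_Suc_le[OF x1(2)] ax by simp
      have il': "offs ns x + a < length (concat ns)" using offs_Suc_le[OF x1(1)] ax by simp
      have u: "table ns (?G a) ! (?o + a) = F (Suc x) a"
        using nth_table[OF x1(2) ax(2), of "?G a"] by simp
      have v: "table ns (?G a) ! (offs ns x + a) = right_pass lc F x a"
        using nth_table[OF x1(1) ax(1), of "?G a"] by simp
      have G: "table ns (?G (Suc a)) = table ns ((?G a)(Suc x := ((?G a) (Suc x))(a := right_pass lc F (Suc x) a)))"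
        by (rule table_cong) (auto simp: less_Suc_eq)
      have pgT: "t + 14 + 4 * pg Tab (?o + a) + 4 * (pg Tab (Suc (?o + a)) - pg Tab (?o + a))
          = t + 14 + 4 * pg Tab (?o + Suc a)"
        using pg_mono[of "?o + a" "Suc (?o + a)" Tab] by simp
      show ?case
        unfolding wp_bind
      proof (rule wp_rd_stay[OF I], goal_cases)
        case (4 s1)
        then have s1: "asc (?D a) (?\<delta> a) (t + 14 + 4 * pg Tab (?o + Suc a)) s1" unfolding pgT .
        have u': "?D a Tab ! (?o + a) = F (Suc x) a" using u by simp
        show ?case
          unfolding u'
        proof (cases "F (Suc x) a = 0", goal_cases)
          case 1
          note True = this
          then have R: "right_pass lc F (Suc x) a = right_pass lc F x a" using a by simp
          have T: "(table ns (?G a))[?o + a := right_pass lc F x a] = table ns (?G (Suc a))"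
            unfolding G R by (rule table_update[OF x1(2) ax(2)])
          show ?case
            unfolding if_P[OF True] wp_bind
            apply (rule wp_rdv[OF s1, where v = "right_pass lc F x a"], simp, simp, simp, (use il' v in \<open>simp; fail\<close>)+)
            apply (rule wp_wr, assumption, simp, simp, simp, (use il bR in \<open>simp; fail\<close>)+)
            apply (rotate_tac -1, erule asc_weaken)
              apply (simp add: T del: right_pass.simps)
             apply simp
            apply simp
            done
        next
          case 2
          note False = this
          then have R: "right_pass lc F (Suc x) a = F (Suc x) a" by simp
          have T: "table ns (?G a) = table ns (?G (Suc a))"
            by (rule table_cong) (use R in \<open>auto simp: less_Suc_eq simp del: right_pass.simps\<close>)
          show ?case
            unfolding if_not_P[OF False] wp_return
            by (rule asc_weaken[OF s1]) (simp_all add: T del: right_pass.simps)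
        qed
      qed (use il in simp_all)
    qed (rule Q)
    show ?case
      unfolding off
      apply (subst wp_bind)
      apply (rule wp_rdv[OF I, where v = "length (ns ! x)"], simp, simp, simp, (use CD x in \<open>simp; fail\<close>)+)
      apply (subst wp_bind)
      apply (rule wp_rdv[where v = "lc x"], assumption, simp, simp, simp, (use Lcp x in \<open>simp; fail\<close>)+)
      apply (subst wp_bind)
      apply (unfold oS)
      apply (rule inner)
       apply (rotate_tac -1, erule asc_weaken)
         apply (intro arg_cong2[where f = "\<lambda>C. fun_upd C Tab"] table_cong refl, simp)
        apply simp
       apply (simp add: oS)
      apply (unfold wp_return)
      apply (rule conjI, rule refl)
      apply (rotate_tac -1, erule asc_weaken)
        apply (intro arg_cong2[where f = "\<lambda>C. fun_upd C Tab"] table_cong refl)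
        apply (auto simp: le_Suc_eq)[1]
       apply (use lx offs_Suc[OF x1(2)] in \<open>simp add: pg_mono\<close>)
      apply (use lx offs_Suc[OF x1(2)] oS in auto)
      done
  next
    case (3 off s)
    then have off: "off = offs ns (K - 1)" and I: "asc (?C (K - 1)) (?\<gamma> (K - 1)) (t + 14 + 4 * pg Tab (offs ns (Suc (K - 1)))) s" by auto
    have "table ns (?F (K - 1)) = table ns (right_pass lc F)" using K by (intro table_cong) auto
    then show ?case
      using off pg_mono[of "4 * (K - 1)" "4 * K" CDesc] pg_mono[of "K - 1" K Lcp]
        pg_mono[OF offs_le, of Tab ns "Suc (K - 1)"] pg_mono[OF offs_le, of Tab ns "K - 1"]
      by (intro conjI asc_rest[OF I]) (auto simp: sum7)
  qed
qed

text \<open>Inside each column the entries are copied from the highest index down, so that the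
  cursors descend within columns as well as between them. No zero test is needed: on a shared prefix
  the next column already holds a propagated entry for the same names.\<close>

lemma wp_propagate_left:
  assumes s: "at_rest C t s" and K: "K = length ns" "1 \<le> K"
    and CD: "\<And>x. x < K \<Longrightarrow> C CDesc ! (4 * x) = length (ns ! x)" "length (C CDesc) = 4 * K"
    and Lcp: "C Lcp = map lc [0..<K - 1]"
    and lc: "\<And>x. Suc x < K \<Longrightarrow> lc x \<le> length (ns ! x) \<and> lc x \<le> length (ns ! Suc x)"
    and Tab: "C Tab = table ns G" and b: "\<And>x a. G x a < 2 ^ nb"
  defines "Z \<equiv> \<lambda>z. left_pass lc G (K - 1) (K - 1 - z)"
  shows "wp (propagate_left K (offs ns (K - 1))) (\<lambda>_. at_rest (C(Tab := table ns Z))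
     (t + 14 + 6 * (pg CDesc (4 * K) + pg Lcp K + 2 * pg Tab (length (concat ns))))) s"
proof -
  let ?F = "\<lambda>y z. if K - 1 - y \<le> z then Z z else G z"
  let ?C = "\<lambda>y. C(Tab := table ns (?F y))"
  let ?\<gamma> = "\<lambda>y. (\<lambda>_. (Len, 0))(0 := (CDesc, 4 * (K - 1 - y)), 1 := (Lcp, K - 1 - y),
      2 := (Tab, offs ns (K - y)), 3 := (Tab, offs ns (K - 1 - y)))"
  let ?T = "t + 14 + 6 * (pg CDesc (4 * K) + pg Lcp K + 2 * pg Tab (length (concat ns)))"
  have bL: "left_pass lc G n y a < 2 ^ nb" for n y a
    by (induction y arbitrary: a) (auto simp: b)
  have bZ: "Z z a < 2 ^ nb" for z a by (simp add: Z_def bL)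
  have ZS: "Z x = (\<lambda>a. if a < lc x then Z (Suc x) a else G x a)" if "Suc x < K" for x
  proof -
    have *: "K - 1 - x = Suc (K - 1 - Suc x)" "K - 1 - Suc (K - 1 - Suc x) = x" using that by auto
    show ?thesis unfolding Z_def *(1) by (simp only: left_pass.simps *(2))
  qed
  show ?thesis
    unfolding propagate_left_def
  proof (rule wp_loop[where I = "\<lambda>y off s. off = offs ns (K - 1 - y) \<and> desc (?C y) (?\<gamma> y) ?T s"], goal_cases)
    case 1
    have "table ns G = table ns (?F 0)"
    \<comment> \<open>The last column has no right neighbour, so its final value is the initial
      one.\<close>
    proof (rule table_cong)
      fix x a assume "x < length ns"
      then have "x = K - 1" if "K - 1 \<le> x" using that K by simp
      then show "G x a = ?F 0 x a" by (auto simp: Z_def)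
    qed
    then have C0: "C = ?C 0" using Tab by (metis fun_upd_triv)
    have "desc C (?\<gamma> 0) (t + 14 + 6 * (\<Sum>f<(7::nat). cpg (?\<gamma> 0 f))) s"
      by (rule rest_desc[OF s])
    then have "desc (?C 0) (?\<gamma> 0) ?T s"
      by (rule desc_weaken) (use C0 pg_mono[of "4 * (K - 1)" "4 * K" CDesc] pg_mono[of "K - 1" K Lcp]
        pg_mono[OF offs_le, of Tab ns "K"] pg_mono[OF offs_le, of Tab ns "K - 1"] in \<open>auto simp: sum7\<close>)
    then show ?case by simp
  next
    case (2 y off s)
    note y = 2(1)
    from 2 have off: "off = offs ns (K - 1 - y)" and I: "desc (?C y) (?\<gamma> y) ?T s" by auto
    define x where "x = K - 2 - y"
    have xe: "K - 1 - y = Suc x" "K - y = Suc (Suc x)" "K - 1 - Suc y = x" "K - Suc y = Suc x" using y by (auto simp: x_def)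
    have Sx: "Suc x < K" using y by (auto simp: x_def)
    have x1: "x < length ns" "Suc x < length ns" using Sx K by auto
    have lx: "lc x \<le> length (ns ! x)" "lc x \<le> length (ns ! Suc x)" using lc[OF Sx] by auto
    let ?o = "offs ns (Suc x)"
    have oS: "offs ns x + length (ns ! x) = ?o" using offs_Suc[OF x1(1)] by simp
    have oSS: "offs ns (Suc (Suc x)) = ?o + length (ns ! Suc x)" using offs_Suc[OF x1(2)] .
    have om: "?o - length (ns ! x) = offs ns x" using oS by simp
    let ?l = "lc x"
    \<comment> \<open>After \<open>a\<close> rounds exactly the top \<open>a\<close> of the
      \<open>?l\<close> shared entries are copied.\<close>
    let ?H = "\<lambda>a z. if Suc x \<le> z then Z z else if z = x
      then (\<lambda>b. if ?l - a \<le> b \<and> b < ?l then Z (Suc x) b else G x b) else G z"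
    let ?D = "\<lambda>a. C(Tab := table ns (?H a))"
    let ?\<delta> = "\<lambda>a. (\<lambda>_. (Len, 0))(0 := (CDesc, 4 * x), 1 := (Lcp, x), 2 := (Tab, ?o + (?l - a)), 3 := (Tab, offs ns x + (?l - a)))"
    have inner: "wp (loop ?l (\<lambda>a _. do {
       v \<leftarrow> rd 2 Tab (?o + (?l - 1 - a));
       wr 3 Tab (offs ns x + (?l - 1 - a)) v }) ()) Q s'"
      if s': "desc (?D 0) (?\<delta> 0) ?T s'" and Q: "\<And>r s'. desc (?D ?l) (?\<delta> ?l) ?T s' \<Longrightarrow> Q r s'" for s' Q
    proof (rule wp_loop[where I = "\<lambda>a _. desc (?D a) (?\<delta> a) ?T"], goal_cases)
      case 1
      show ?case by (rule s')
    next
      case (2 a r s)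
      note a = 2(1) and I = 2(2)
      define e where "e = ?l - 1 - a"
      have e: "?l - a = Suc e" "?l - Suc a = e" "e < ?l" using a by (auto simp: e_def)
      have ex: "e < length (ns ! x)" "e < length (ns ! Suc x)" using e lx by auto
      have il: "?o + e < length (concat ns)" using offs_Suc_le[OF x1(2)] ex by simp
      have il': "offs ns x + e < length (concat ns)" using offs_Suc_le[OF x1(1)] ex by simp
      have u: "table ns (?H a) ! (?o + e) = Z (Suc x) e"
        using nth_table[OF x1(2) ex(2), of "?H a"] by simp
      have H: "table ns (?H (Suc a)) = table ns ((?H a)(x := ((?H a) x)(e := Z (Suc x) e)))"
        by (rule table_cong) (use e in auto)
      have T: "(table ns (?H a))[offs ns x + e := Z (Suc x) e] = table ns (?H (Suc a))"
        unfolding H by (rule table_update[OF x1(1) ex(1)])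
      show ?case
        unfolding wp_bind e_def[symmetric]
        apply (rule wp_rdv_desc[OF I, where v = "Z (Suc x) e"], simp, simp, (use e in \<open>simp; fail\<close>), (use il u in \<open>simp; fail\<close>)+)
        apply (rule wp_wr_desc, assumption, simp, simp, (use e in \<open>simp; fail\<close>), (use il' bZ in \<open>simp; fail\<close>)+)
        apply (rotate_tac -1, erule desc_weaken)
          apply (simp add: T)
         apply simp
        apply (simp add: e)
        done
    qed (rule Q)
    have D0: "table ns (?F y) = table ns (?H 0)" unfolding xe by (rule table_cong) auto
    have Dl: "table ns (?H ?l) = table ns (?F (Suc y))"
      unfolding xe by (rule table_cong) (use ZS[OF Sx] in \<open>auto simp: le_Suc_eq not_less_eq_eq\<close>)
    have x2: "K - 2 - y = x" by (simp add: x_def)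
    show ?case
      unfolding off Let_def x2
      apply (subst wp_bind)
      apply (rule wp_rdv_desc[OF I, where v = "length (ns ! x)"], simp, simp, (use xe in \<open>simp; fail\<close>), (use CD Sx in \<open>simp; fail\<close>)+)
      apply (subst wp_bind)
      apply (rule wp_rdv_desc[where v = "lc x"], assumption, simp, simp, (use xe in \<open>simp; fail\<close>), (use Lcp Sx in \<open>simp; fail\<close>)+)
      apply (subst wp_bind)
      apply (unfold xe om)
      apply (rule inner)
       apply (rotate_tac -1, erule desc_weaken)
         apply (simp only: D0[unfolded xe])
        apply simp
       apply (use lx oS oSS in auto)[1]
      apply (unfold wp_return)
      apply (rule conjI, rule refl)
      apply (rotate_tac -1, erule desc_weaken)
        apply (simp only: Dl[unfolded xe])
       apply simp
      apply (use lx oS oSS in auto)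
      done
  next
    case (3 off s)
    then have I: "desc (?C (K - 1)) (?\<gamma> (K - 1)) ?T s" by auto
    show ?case
      by (rule desc_rest[OF I]) simp_all
  qed
qed

lemma wp_output_permutation:
  assumes s: "at_rest C t s" and Tab: "C Tab = concat (map fst its)" and CD: "C CDesc = concat (map snd its)"
    and its: "\<And>u v. (u, v) \<in> set its \<Longrightarrow> length v = 4 \<and> hd v = length u \<and> v ! 1 < 2 ^ w"
    and K: "K = length its" and Out: "C Out = []"
  shows "wp (output_permutation K) (\<lambda>_ s'. ok s' \<and> cells s' Out = map (\<lambda>(u, v). v ! 1) (sort_key fst its) \<and>
      ios s' \<le> t + srt K (length (C Tab) * nb + 4 * K * w) + 14 + 6 * (pg CDesc (4 * K) + pg Out K)) s"
proof -
  let ?js = "sort_key fst its"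
  have js: "set ?js = set its" "length ?js = K" by (simp_all add: K)
  have u: "length v = 4" if "v \<in> set (map snd ?js)" for v using that its by auto
  have u': "length v = 4" if "v \<in> set (map snd its)" for v using that its by auto
  let ?ts = "t + srt K (length (C Tab) * nb + 4 * K * w)"
  let ?Cs = "C(Tab := concat (map fst ?js), CDesc := concat (map snd ?js))"
  let ?o = "\<lambda>(u, v). v ! 1" and ?\<gamma> = "\<lambda>x. (\<lambda>_. (Len, 0))(0 := (CDesc, 4 * x), 1 := (Out, x))"
  let ?C = "\<lambda>x. ?Cs(Out := map ?o (take x ?js))"
  show ?thesis
    unfolding output_permutation_def wp_bind
  proof (rule wp_mergesort[where its = its, OF s Tab CD])
    fix s1 assume "at_rest ?Cs (t + srt (length its) (length (C Tab) * W Tab + length (C CDesc) * W CDesc)) s1"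
    moreover have "length (concat (map snd its)) = 4 * length its"
      by (subst length_concat_uniform[OF u']) simp_all
    ultimately have s1: "at_rest ?Cs ?ts s1" by (simp add: CD K)
    show "wp (loop K (\<lambda>x _. do { i \<leftarrow> rd 0 CDesc (4 * x + 1); push 1 Out i }) ())
      (\<lambda>_ s'. ok s' \<and> cells s' Out = map ?o ?js \<and> ios s' \<le> ?ts + 14 + 6 * (pg CDesc (4 * K) + pg Out K)) s1"
    proof (rule wp_loop[where I = "\<lambda>x _. asc (?C x) (?\<gamma> x) (?ts + 14)"], goal_cases)
      case 1
      have "asc ?Cs (?\<gamma> 0) (?ts + 14) s1" by (rule rest_asc[OF s1]) auto
      then show ?case by (rule asc_weaken) (auto simp: Out fun_eq_iff)
    next
      case (2 x r s)
      note x = 2(1) and I = 2(2)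
      have d: "concat (map snd ?js) ! (4 * x + 1) = snd (?js ! x) ! 1"
        using x js(2) by (subst nth_concat_uniform[OF u]) simp_all
      have l: "4 * x + 1 < length (concat (map snd ?js))"
        using x js(2) by (subst length_concat_uniform[OF u]) simp_all
      have "?js ! x \<in> set its" using x js by (metis nth_mem)
      then have b: "snd (?js ! x) ! 1 < 2 ^ w" using its[of "fst (?js ! x)" "snd (?js ! x)"] by simp
      show ?case
        unfolding wp_bind
        apply (rule wp_rdv[OF I, where v = "snd (?js ! x) ! 1"], simp, simp, simp, (use d l in \<open>simp; fail\<close>)+)
        apply (rule wp_push, assumption, simp, simp, (use x js(2) b in \<open>simp; fail\<close>)+)
        apply (rotate_tac -1, erule asc_weaken)
          apply (use x js(2) in \<open>simp add: fun_eq_iff take_Suc_conv_app_nth case_prod_unfold\<close>)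
         apply simp
        apply (use x js(2) in simp)
        done
    next
      case (3 r s)
      note I = 3
      from 3 have "at_rest (?C K) (?ts + 14 + 6 * (pg CDesc (4 * K) + pg Out K)) s"
        by (rule asc_rest) (auto simp: sum7)
      then show ?case
        by (simp add: at_rest_def state_def js(2)[symmetric] del: length_sort)
    qed
  qed (use its in auto)
qed

end

section \<open>Correctness of the propagated table\<close>

lemma list_less_at:
  fixes u v :: "'a::linorder list"
  assumes "take l u = take l v" "l < length u" "l < length v" "u ! l \<noteq> v ! l"
  shows "u < v \<longleftrightarrow> u ! l < v ! l"
  using assms
proof (induction l arbitrary: u v)
  case 0
  then show ?case by (cases u; cases v) auto
next
  case (Suc l)
  then show ?case by (cases u; cases v) auto
qed

lemma append_ge: "v \<le> v @ (w :: 'a::linorder list)"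
  by (induction v) auto

lemma prefix_le:
  fixes u v :: "'a::linorder list"
  assumes "take l v = take l u" "l = length v"
  shows "v \<le> u"
  using append_ge[of "take l u" "drop l u"] assms by simp

text \<open>In lexicographic order the lists with a given prefix form an interval. In the sorted
  c-strings this makes the columns that share a prefix contiguous.\<close>

lemma take_between:
  fixes u v x :: "'a::linorder list"
  assumes "u \<le> v" "v \<le> x" "take l u = take l x" "l \<le> length u" "l \<le> length x"
  shows "take l v = take l u \<and> l \<le> length v"
  using assms
proof (induction l arbitrary: u v x)
  case (Suc l)
  then obtain a u' b x' where *: "u = a # u'" "x = b # x'" by (metis Suc_le_length_iff)
  then have "v \<noteq> []" using Suc.prems by auto
  then obtain c v' where "v = c # v'" by (cases v) auto
  then show ?case using Suc.prems Suc.IH[of u' v' x'] * by (auto simp: le_less)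
qed simp

lemma less_take_drop:
  fixes s t :: "'a::linorder list"
  assumes "s < t"
  shows "take l s < take l t \<or> take l s = take l t \<and> drop l s < drop l t"
  using assms
proof (induction l arbitrary: s t)
  case (Suc l)
  then show ?case by (cases s; cases t) auto
qed simp

lemma pieces_Nil [simp]: "1 \<le> L \<Longrightarrow> pieces L [] = []"
  by (simp add: pieces_def num_pieces_def)

lemma pieces_Cons:
  assumes "1 \<le> L" "s \<noteq> []"
  shows "pieces L s = take L s # pieces L (drop L s)"
proof -
  have "j < num_pieces L (length s) \<longleftrightarrow> j < Suc (num_pieces L (length s - L))" for j
    using assms num_pieces_less[OF assms(1)] by (cases j) auto
  then have l: "num_pieces L (length s) = Suc (num_pieces L (length s - L))"
    by (metis less_irrefl_nat linorder_less_linear)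
  show ?thesis unfolding pieces_def l by (simp add: l)
qed

text \<open>Cutting into pieces preserves the order. If the first pieces differ, they decide; a
  short last piece is either decided by a bit or is a proper prefix, and hence smaller, just as for
  the whole strings. Otherwise the remainders are compared.\<close>

lemma pieces_less:
  assumes L: "1 \<le> L" and "s < t"
  shows "pieces L s < pieces L t"
  using assms(2)
proof (induction "length s" arbitrary: s t rule: less_induct)
  case less
  have t: "t \<noteq> []" using less.prems by auto
  show ?case
  proof (cases "s = []")
    case True
    then show ?thesis using L t by (simp add: pieces_Cons)
  next
    case False
    have "length (drop L s) < length s" using False L by simp
    then show ?thesis
      using less.hyps[of "drop L s" "drop L t"] less_take_drop[OF less.prems, of L]
      by (auto simp: pieces_Cons[OF L False] pieces_Cons[OF L t])
  qed
qed

lemma map_of_bool_less: "u < v \<Longrightarrow> map of_bool u < (map of_bool v :: nat list)"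
proof (induction u arbitrary: v)
  case Nil
  then show ?case by (cases v) auto
next
  case (Cons a u)
  then show ?case by (cases v) auto
qed

lemma piece_rank_less:
  assumes "u < v" "v \<in> fst ` set its"
  shows "piece_rank its u < piece_rank its v"
proof -
  have "v \<in> {x \<in> fst ` set its. x \<le> v}" "v \<notin> {x \<in> fst ` set its. x \<le> u}" using assms by auto
  moreover have "{x \<in> fst ` set its. x \<le> u} \<subseteq> {x \<in> fst ` set its. x \<le> v}" using assms(1) by auto
  ultimately have "{x \<in> fst ` set its. x \<le> u} \<subset> {x \<in> fst ` set its. x \<le> v}" by blast
  then show ?thesis unfolding piece_rank_def by (intro psubset_card_mono) auto
qed

lemma piece_rank_pos:
  assumes "u \<in> fst ` set its"
  shows "0 < piece_rank its u"
proof -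
  have "finite {v \<in> fst ` set its. v \<le> u}" by simp
  moreover have "{v \<in> fst ` set its. v \<le> u} \<noteq> {}" using assms by blast
  ultimately show ?thesis unfolding piece_rank_def by (simp only: card_gt_0_iff simp_thms)
qed

lemma piece_rank_le: "piece_rank its u \<le> length its"
proof -
  have "piece_rank its u \<le> card (fst ` set its)" unfolding piece_rank_def by (intro card_mono) auto
  also have "\<dots> \<le> length its" by (meson card_image_le card_length finite_set le_trans)
  finally show ?thesis .
qed

lemma in_below: "a \<in> set (below l m) \<longleftrightarrow> a < l \<and> m = Some a"
  by (cases m) (auto simp: below_def)

lemma in_marks_at:
  "a \<in> set (marks_at ns x) \<longleftrightarrow> a < length (ns ! x) \<and> (left_lcp ns x = Some a \<or> right_lcp ns x = Some a)"
  unfolding marks_at_def by (auto simp: in_below)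

section \<open>Spreading of marks over runs of columns\<close>

locale marked_table =
  fixes ns :: "nat list list" and K :: nat and F :: "nat \<Rightarrow> nat \<Rightarrow> nat"
  assumes K: "K = length ns" "1 \<le> K"
    and F: "\<And>x a. x < K \<Longrightarrow> a < length (ns ! x) \<Longrightarrow> F x a \<noteq> 0 \<longleftrightarrow> a \<in> set (marks_at ns x)"
begin

abbreviation "lc \<equiv> lcps ns"
abbreviation "R \<equiv> right_pass lc F"
definition Z :: "nat \<Rightarrow> nat \<Rightarrow> nat" where "Z z = left_pass lc R (K - 1) (K - 1 - z)"


lemma run_eq:
  assumes "x \<le> y" "y < K" "\<And>z. x \<le> z \<Longrightarrow> z < y \<Longrightarrow> a < lc z" "a < length (ns ! x)"
  shows "take (Suc a) (ns ! x) = take (Suc a) (ns ! y) \<and> a < length (ns ! y)"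
  using assms
proof (induction y rule: dec_induct)
  case (step y)
  have "Suc a \<le> lc y" using step.prems(2)[of y] step.hyps by simp
  then have "take (Suc a) (ns ! y) = take (Suc a) (ns ! Suc y)" "a < length (ns ! Suc y)"
    unfolding lcps_def le_lcp by auto
  then show ?case using step by simp
qed simp

text \<open>The right pass restarts at every marked entry it meets. Hence a column of the run
  carries the value of the last mark at or before it.\<close>

lemma R_run:
  assumes "x \<le> y" "y < K" "\<And>z. x \<le> z \<Longrightarrow> z < y \<Longrightarrow> a < lc z" "a \<in> set (marks_at ns x)"
  shows "\<exists>z. x \<le> z \<and> z \<le> y \<and> a \<in> set (marks_at ns z) \<and> R y a = F z a"
  using assms
proof (induction y rule: dec_induct)
  case base
  have "F x a \<noteq> 0" using F[of x a] base by (simp add: in_marks_at)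
  then have "R x a = F x a" by (cases x) auto
  then show ?case using base by auto
next
  case (step y)
  have al: "a < lc y" using step.prems(2)[of y] step.hyps by simp
  then have l: "a < length (ns ! Suc y)" using lcp_le(2)[of "ns ! y" "ns ! Suc y"] by (simp add: lcps_def)
  show ?case
  proof (cases "F (Suc y) a = 0")
    case True
    obtain z where "x \<le> z" "z \<le> y" "a \<in> set (marks_at ns z)" "R y a = F z a" using step by auto
    then show ?thesis using True al by (intro exI[of _ z]) simp
  next
    case False
    then have "a \<in> set (marks_at ns (Suc y))" using F[of "Suc y" a] step.prems l by simp
    then show ?thesis using False step by (intro exI[of _ "Suc y"]) simp
  qed
qed

lemma Z_Suc:
  assumes "Suc x < K"
  shows "Z x a = (if a < lc x then Z (Suc x) a else R x a)"
proof -
  have *: "K - 1 - x = Suc (K - 1 - Suc x)" "K - 1 - Suc (K - 1 - Suc x) = x" using assms by auto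
  show ?thesis unfolding Z_def *(1) by (simp only: left_pass.simps *(2))
qed

lemma Z_chain:
  assumes "x \<le> y" "y < K" "\<And>z. x \<le> z \<Longrightarrow> z < y \<Longrightarrow> a < lc z"
  shows "Z x a = Z y a"
  using assms
proof (induction y rule: dec_induct)
  case (step y)
  then show ?case using Z_Suc[of y a] by simp
qed simp

text \<open>The mark \<open>m\<close> may lie on either side of \<open>x\<close>. The right pass
  carries a mark of the run to the right end of the run, and the left pass brings it back to
  \<open>x\<close>. The value may come from another mark \<open>z\<close> than \<open>m\<close>, but
  one with the same names up to \<open>a\<close>.\<close>

lemma Z_run:
  assumes x: "x < K" "a < length (ns ! x)" and lr: "l \<le> x" "x \<le> r" "r < K"
    and run: "\<And>z. l \<le> z \<Longrightarrow> z < r \<Longrightarrow> a < lc z" and m: "m \<in> {l..r}" "a \<in> set (marks_at ns m)"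
  shows "\<exists>z<K. a \<in> set (marks_at ns z) \<and> Z x a = F z a \<and> take (Suc a) (ns ! z) = take (Suc a) (ns ! x)"
proof -
  \<comment> \<open>The given run need not extend as far right as possible, whereas the left pass
    copies from the last column of the maximal run. So \<open>e\<close> is the end of that maximal
    run; there the left pass changes nothing and \<open>Z\<close> equals \<open>R\<close>.\<close>
  define E where "E = {e. x \<le> e \<and> e < K \<and> (\<forall>z. x \<le> z \<longrightarrow> z < e \<longrightarrow> a < lc z)}"
  define e where "e = Max E"
  have fE: "finite E" by (auto simp: E_def)
  have rE: "r \<in> E" using lr run by (auto simp: E_def)
  then have eE: "e \<in> E" unfolding e_def by (intro Max_in fE) auto
  have re: "r \<le> e" using rE fE by (simp add: e_def)
  have xe: "x \<le> e" "e < K" and erun: "\<And>z. x \<le> z \<Longrightarrow> z < e \<Longrightarrow> a < lc z" using eE by (auto simp: E_def)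
  have stop: "\<not> a < lc e" if "Suc e < K"
  proof
    assume "a < lc e"
    then have "Suc e \<in> E" using eE that by (auto simp: E_def less_Suc_eq)
    then show False using Max_ge[OF fE, of "Suc e"] by (simp add: e_def)
  qed
  have "Z e a = R e a"
  proof (cases "Suc e < K")
    case True
    then show ?thesis using Z_Suc[OF True] stop by simp
  next
    case False
    then have "e = K - 1" using xe by simp
    then show ?thesis by (simp add: Z_def)
  qed
  then have Z: "Z x a = R e a" using Z_chain[OF xe erun] by simp
  have run': "a < lc z" if "l \<le> z" "z < e" for z
    using run[of z] erun[of z] that lr by (cases "z < r") auto
  have mm: "m \<le> e" "a < length (ns ! m)" using m re by (auto simp: in_marks_at)
  obtain z where z: "m \<le> z" "z \<le> e" "a \<in> set (marks_at ns z)" "R e a = F z a"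
    using R_run[OF mm(1) xe(2) _ m(2)] run' m by auto
  have "take (Suc a) (ns ! z) = take (Suc a) (ns ! e)"
    using run_eq[OF z(2) xe(2), of a] run' z m by (auto simp: in_marks_at)
  moreover have "take (Suc a) (ns ! x) = take (Suc a) (ns ! e)"
    using run_eq[OF xe erun x(2)] by simp
  ultimately show ?thesis using z Z xe by (intro exI[of _ z]) auto
qed

end

text \<open>The assumption \<open>sep\<close> is weaker than injectivity of \<open>h\<close>: names
  must distinguish pieces only where all earlier pieces agree. Likewise \<open>\<rho>\<close> must
  be monotone only on marked pieces.\<close>

locale sorted_marked_table = marked_table +
  fixes ps :: "'a::linorder list list" and \<rho> h :: "'a \<Rightarrow> nat"
  assumes sorted: "sorted ns"
    and nps: "\<And>x. x < K \<Longrightarrow> ns ! x = map h (ps ! x)"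
    and sep: "\<And>x y a. x < K \<Longrightarrow> y < K \<Longrightarrow> a < length (ns ! x) \<Longrightarrow> a < length (ns ! y) \<Longrightarrow>
      take a (ps ! x) = take a (ps ! y) \<Longrightarrow> ns ! x ! a = ns ! y ! a \<Longrightarrow> ps ! x ! a = ps ! y ! a"
    and F\<rho>: "\<And>x a. x < K \<Longrightarrow> a \<in> set (marks_at ns x) \<Longrightarrow> F x a = \<rho> (ps ! x ! a)"
    and \<rho>: "\<And>x a y b. x < K \<Longrightarrow> y < K \<Longrightarrow> a \<in> set (marks_at ns x) \<Longrightarrow> b \<in> set (marks_at ns y) \<Longrightarrow>
      ps ! x ! a < ps ! y ! b \<Longrightarrow> \<rho> (ps ! x ! a) < \<rho> (ps ! y ! b)"
begin

lemma lps: "x < K \<Longrightarrow> length (ps ! x) = length (ns ! x)"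
  by (simp add: nps)

text \<open>The induction feeds the equality of the earlier pieces into \<open>sep\<close>, which
  requires it.\<close>

lemma names_pieces:
  assumes "x < K" "y < K" "a \<le> length (ns ! x)" "a \<le> length (ns ! y)" "take a (ns ! x) = take a (ns ! y)"
  shows "take a (ps ! x) = take a (ps ! y)"
  using assms(3-5)
proof (induction a)
  case (Suc a)
  have l: "a < length (ns ! x)" "a < length (ns ! y)" using Suc.prems by auto
  have "take a (ns ! x) = take a (ns ! y) \<and> ns ! x ! a = ns ! y ! a"
    using Suc.prems(3) l by (simp add: take_Suc_conv_app_nth)
  then show ?case using Suc.IH l sep[OF assms(1,2) l] lps assms(1,2) by (simp add: take_Suc_conv_app_nth)
qed simp

lemma Z_piece:
  assumes x: "x < K" "a < length (ns ! x)" and lr: "l \<le> x" "x \<le> r" "r < K"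
    and run: "\<And>z. l \<le> z \<Longrightarrow> z < r \<Longrightarrow> a < lc z" and m: "m \<in> {l..r}" "a \<in> set (marks_at ns m)"
  shows "Z x a = \<rho> (ps ! x ! a) \<and> (\<exists>z<K. a \<in> set (marks_at ns z) \<and> ps ! x ! a = ps ! z ! a)"
proof -
  obtain z where z: "z < K" "a \<in> set (marks_at ns z)" "Z x a = F z a" "take (Suc a) (ns ! z) = take (Suc a) (ns ! x)"
    using Z_run[OF x lr run m] by auto
  have "a < length (ns ! z)" using z by (simp add: in_marks_at)
  then have "take (Suc a) (ps ! z) = take (Suc a) (ps ! x)"
    using names_pieces[of z x "Suc a"] z x by simp
  then have "take (Suc a) (ps ! z) ! a = take (Suc a) (ps ! x) ! a" by simp
  then have "ps ! z ! a = ps ! x ! a" by simp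
  then show ?thesis using z F\<rho>[of z a] by auto
qed

lemma lcp_sym: "lcp u v = lcp v u"
  by (induction u v rule: lcp.induct) auto

text \<open>All columns between \<open>x\<close> and \<open>y\<close> share the first
  \<open>l\<close> names, so each adjacent prefix in between has length at least \<open>l\<close>.
  Where it is exactly \<open>l\<close>, the mismatch is adjacent and marked; the marks nearest to
  \<open>x\<close> and to \<open>y\<close> lie in their respective runs.\<close>

lemma columns_aux:
  assumes "x < y" "y < K"
  defines "l \<equiv> lcp (ns ! x) (ns ! y)"
  shows "a < l \<Longrightarrow> Z x a = Z y a"
    "l < length (ns ! x) \<Longrightarrow> Z x l = \<rho> (ps ! x ! l) \<and> (\<exists>z<K. l \<in> set (marks_at ns z) \<and> ps ! x ! l = ps ! z ! l)"
    "l < length (ns ! y) \<Longrightarrow> Z y l = \<rho> (ps ! y ! l) \<and> (\<exists>z<K. l \<in> set (marks_at ns z) \<and> ps ! y ! l = ps ! z ! l)"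
proof -
  have tl: "l \<le> length (ns ! x)" "l \<le> length (ns ! y)" "take l (ns ! x) = take l (ns ! y)"
    using le_lcp[of l "ns ! x" "ns ! y"] by (simp_all add: l_def)
  have mid: "take l (ns ! z) = take l (ns ! x) \<and> l \<le> length (ns ! z)" if "x \<le> z" "z \<le> y" for z
    using that assms K tl by (intro take_between[of _ _ "ns ! y"] sorted_nth_mono[OF sorted]) auto
  have ge: "l \<le> lc z" if "x \<le> z" "z < y" for z
    using mid[of z] mid[of "Suc z"] that by (simp add: lcps_def le_lcp)
  show "Z x a = Z y a" if "a < l"
    using Z_chain[of x y a] ge assms that by (meson less_le_trans order_less_imp_le)
  \<comment> \<open>If every adjacent pair agreed beyond \<open>l\<close>, equality would pass along
    the columns and \<open>x\<close> and \<open>y\<close> would share \<open>Suc l\<close>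
    names.\<close>
  have ex: "\<exists>z. x \<le> z \<and> z < y \<and> lc z = l"
  proof (rule ccontr)
    assume "\<not> ?thesis"
    then have gt: "l < lc z" if "x \<le> z" "z < y" for z using ge that by (metis le_neq_implies_less)
    have "lc x \<le> length (ns ! x)" by (simp add: lcps_def lcp_le)
    then have "l < length (ns ! x)" using gt[of x] assms by simp
    then have "take (Suc l) (ns ! x) = take (Suc l) (ns ! y) \<and> l < length (ns ! y)"
      using run_eq[of x y l] gt assms by simp
    then have "Suc l \<le> lcp (ns ! x) (ns ! y)" using \<open>l < length (ns ! x)\<close> by (simp add: le_lcp)
    then show False by (simp add: l_def)
  qed
  let ?P = "\<lambda>z. x \<le> z \<and> z < y \<and> lc z = l"
  \<comment> \<open>The run of \<open>x\<close> reaches to the first such pair: column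
    \<open>f\<close> is marked because of its right neighbour.\<close>
  define f where "f = (LEAST z. ?P z)"
  have f: "?P f" unfolding f_def using ex by (rule LeastI_ex)
  have bf: "l < lc z" if "x \<le> z" "z < f" for z
    using not_less_Least[of z ?P] that f ge[of z] unfolding f_def by fastforce
  \<comment> \<open>Symmetrically, the run of \<open>y\<close> starts right after the last such
    pair: column \<open>Suc g\<close> is marked because of its left neighbour.\<close>
  define g where "g = Max {z. ?P z}"
  have fin: "finite {z. ?P z}" by auto
  have g: "?P g" using Max_in[OF fin] ex unfolding g_def by blast
  have ag: "l < lc z" if "g < z" "z < y" for z
  proof -
    have "\<not> ?P z"
    proof
      assume "?P z"
      then have "z \<le> g" unfolding g_def by (intro Max_ge[OF fin]) simp
      then show False using that by simp
    qed
    then show ?thesis using that g ge[of z] by auto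
  qed
  show "Z x l = \<rho> (ps ! x ! l) \<and> (\<exists>z<K. l \<in> set (marks_at ns z) \<and> ps ! x ! l = ps ! z ! l)"
    if "l < length (ns ! x)"
  proof (rule Z_piece[where l = x and r = f and m = f])
    have "l < length (ns ! f)" using run_eq[of x f l] bf f assms that by simp
    then show "l \<in> set (marks_at ns f)" using f assms K by (auto simp: in_marks_at right_lcp_def)
  qed (use bf f assms that in auto)
  show "Z y l = \<rho> (ps ! y ! l) \<and> (\<exists>z<K. l \<in> set (marks_at ns z) \<and> ps ! y ! l = ps ! z ! l)"
    if ly: "l < length (ns ! y)"
  proof (rule Z_piece[where l = "Suc g" and r = y and m = "Suc g"])
    have "l < length (ns ! Suc g)"
    proof (cases "Suc g = y")
      case False
      then have "l < lc (Suc g)" using ag[of "Suc g"] g by simp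
      then show ?thesis using lcp_le(1)[of "ns ! Suc g"] by (metis lcps_def less_le_trans)
    qed (use ly in simp)
    then show "l \<in> set (marks_at ns (Suc g))" using g by (auto simp: in_marks_at left_lcp_def)
  qed (use ag g assms ly in auto)
qed

definition column :: "nat \<Rightarrow> nat list" where
  "column x = map (Z x) [0..<length (ns ! x)]"

text \<open>Columns agree up to the first name mismatch and there carry the ranks of the pieces. By
  \<open>sep\<close> this is also the first position where the pieces differ, so both comparisons
  are decided at the same place.\<close>

lemma column_less:
  assumes xy: "x < K" "y < K" "ps ! x < ps ! y"
  shows "column x < column y"
proof -
  define l where "l = lcp (ns ! x) (ns ! y)"
  have neq: "x \<noteq> y" using xy by auto
  have A: "a < l \<Longrightarrow> Z x a = Z y a" for a
    using columns_aux(1)[of x y a] columns_aux(1)[of y x a] neq xy by (cases "x < y") (auto simp: l_def lcp_sym)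
  have B: "l < length (ns ! x) \<Longrightarrow> Z x l = \<rho> (ps ! x ! l) \<and> (\<exists>z<K. l \<in> set (marks_at ns z) \<and> ps ! x ! l = ps ! z ! l)"
    using columns_aux(2)[of x y] columns_aux(3)[of y x] neq xy unfolding l_def lcp_sym[of "ns ! y"] by (cases "x < y") auto
  have C: "l < length (ns ! y) \<Longrightarrow> Z y l = \<rho> (ps ! y ! l) \<and> (\<exists>z<K. l \<in> set (marks_at ns z) \<and> ps ! y ! l = ps ! z ! l)"
    using columns_aux(3)[of x y] columns_aux(2)[of y x] neq xy unfolding l_def lcp_sym[of "ns ! y"] by (cases "x < y") auto
  have tl: "l \<le> length (ns ! x)" "l \<le> length (ns ! y)" "take l (ns ! x) = take l (ns ! y)"
    using le_lcp[of l "ns ! x" "ns ! y"] by (simp_all add: l_def)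
  have tp: "take l (ps ! x) = take l (ps ! y)" using names_pieces[OF xy(1,2) tl] .
  have tc: "take l (column x) = take l (column y)"
    by (rule nth_equalityI) (use tl A in \<open>auto simp: column_def\<close>)
  \<comment> \<open>If the names of \<open>y\<close> ended here, its pieces would be a prefix of
    those of \<open>x\<close>.\<close>
  have ly: "l < length (ns ! y)"
  proof (rule ccontr)
    assume "\<not> ?thesis"
    then have "ps ! y \<le> ps ! x" using tl lps xy tp by (intro prefix_le[of l]) auto
    then show False using xy by simp
  qed
  show ?thesis
  proof (cases "l < length (ns ! x)")
    case False
    then have "column x \<le> column y" using tl tc by (intro prefix_le[of l]) (auto simp: column_def)
    moreover have "length (column x) \<noteq> length (column y)" using False ly by (simp add: column_def)
    ultimately show ?thesis by (metis le_neq_trans)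
  next
    case True
    have "ns ! x ! l \<noteq> ns ! y ! l" using nth_lcp_neq[of "ns ! x" "ns ! y"] True ly by (simp add: l_def)
    then have "ps ! x ! l \<noteq> ps ! y ! l" using True ly xy by (auto simp: nps)
    then have "ps ! x ! l < ps ! y ! l"
      using list_less_at[OF tp] True ly lps xy by simp
    then have "Z x l < Z y l" using B[OF True] C[OF ly] \<rho> xy by metis
    then show ?thesis
      using list_less_at[OF tc] True ly by (simp add: column_def)
  qed
qed

end

section \<open>A run of the algorithm\<close>

declare One_nat_def [simp]

lemma length_below: "length (below l m) \<le> 1"
  by (cases m) (auto simp: below_def)

lemma length_marks_at: "length (marks_at ns x) \<le> (if 0 < x then 1 else 0) + (if Suc x < length ns then 1 else 0)"
  using length_below[of "length (ns ! x)" "left_lcp ns x"] length_below[of "length (ns ! x)" "right_lcp ns x"]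
  by (auto simp: marks_at_def left_lcp_def right_lcp_def below_def)

text \<open>One mark per neighbour: all but the first column have a left one and all but the last a
  right one. Losing two marks against \<open>2 * K\<close> is what lets ranks fit into names when
  \<open>K\<close> is 1 or 2.\<close>

lemma length_marks: "k \<le> length ns \<Longrightarrow> length (marks ns k) \<le> (k - 1) + min k (length ns - 1)"
proof (induction k)
  case (Suc k)
  then show ?case using length_marks_at[of ns k] by (auto simp: marks_Suc split: if_splits)
qed (simp add: marks_def)

lemma in_marks: "(x, a) \<in> set (marks ns k) \<longleftrightarrow> x < k \<and> a \<in> set (marks_at ns x)"
  by (auto simp: marks_def)

lemma distinct_marks: "distinct (marks ns k)"
proof (induction k)
  case (Suc k)
  have "distinct (below l m)" for l m by (cases m) (auto simp: below_def)
  then have "distinct (marks_at ns k)" by (auto simp: marks_at_def in_below)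
  then have "distinct (map (Pair k) (marks_at ns k))" by (simp add: distinct_map inj_on_def)
  then show ?case using Suc by (auto simp: marks_Suc in_marks)
qed (simp add: marks_def)

lemma length_concat_mset: "mset xss = mset yss \<Longrightarrow> length (concat xss) = length (concat yss)"
  by (simp only: length_concat sum_mset_sum_list[symmetric] mset_map)

text \<open>Each inequality sums up one phase: 14 to start, 6 per cursor page with multiplicity, and
  the sorts of that phase.\<close>

lemma budgets:
  fixes P :: nat
  assumes "a \<le> P" "b \<le> P" "c \<le> P"
  shows "t + 14 + 6 * (a + b + c) \<le> t + 14 + 18 * P"
    "t + 14 + 18 * P + 14 + 6 * (a + b + 2 * c) + 4 * c \<le> t + 28 + 46 * P"
    "t + 28 + 46 * P + 14 + 6 * (a + b + 2 * c) \<le> t + 42 + 70 * P"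
    "d \<le> P \<Longrightarrow> e \<le> P \<Longrightarrow> t + 14 + 6 * (2 * a + 2 * b + c + d + e) \<le> t + 14 + 42 * P"
    "d \<le> P \<Longrightarrow> e \<le> P \<Longrightarrow> x \<le> S \<Longrightarrow> t + 14 + 42 * P + x + 14 + 6 * (a + b + c + d + e) \<le> t + 28 + 72 * P + S"
    "d \<le> P \<Longrightarrow> x \<le> S \<Longrightarrow> y \<le> S \<Longrightarrow>
      t + 28 + 72 * P + S + x + 14 + 6 * (a + 2 * b + c + d) + y \<le> t + 42 + 102 * P + 3 * S"
  using assms by simp_all

lemma (in em) at_rest_mono: "at_rest C t s \<Longrightarrow> t \<le> t' \<Longrightarrow> at_rest C t' s"
  by (simp add: at_rest_def)

text \<open>The factor 2 in \<open>word\<close> makes the ranks of up to \<open>2 * K\<close> marks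
  fit into words; \<open>name\<close> makes them fit into names once they are written to the
  table.\<close>

locale run = em_words B nf W srt w nb for B nf W srt w nb +
  fixes xs :: "bool list list" and L :: nat and h :: "bool list \<Rightarrow> nat"
  assumes L: "1 \<le> L" and xs: "xs \<noteq> []"
    and h: "\<And>p. length p \<in> {1..L} \<Longrightarrow> h p < 2 ^ nb"
    and word: "2 * (length (concat xs) + length xs) + 1 \<le> 2 ^ w"
    and name: "length xs ^ 2 \<le> 2 ^ nb"
begin

abbreviation "K \<equiv> length xs"
abbreviation "bs \<equiv> concat xs"

definition js :: "nat list" where
  "js = sort_key (\<lambda>i. map h (pieces L (xs ! i))) [0..<K]"

definition ns :: "nat list list" where
  "ns = map (\<lambda>i. map h (pieces L (xs ! i))) js"

definition ms :: "(nat \<times> nat) list" where "ms = marks ns K"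

definition nn :: nat where "nn = length (concat ns)"

abbreviation "str x \<equiv> xs ! (js ! x)"
abbreviation "pos x \<equiv> offs xs (js ! x)"

definition triple :: "nat \<times> nat \<Rightarrow> nat \<times> nat \<times> nat" where
  "triple = (\<lambda>(x, a). (pos x + a * L, min L (length (str x) - a * L), offs ns x + a))"

lemma js: "mset js = mset [0..<K]" "set js = {..<K}" "length js = K" "distinct js"
  by (simp_all add: js_def atLeast0LessThan)

lemma js_less: "x < K \<Longrightarrow> js ! x < K"
  using js by (metis lessThan_iff nth_mem)

lemma length_ns [simp]: "length ns = K"
  by (simp add: ns_def js)

lemma nth_ns: "x < K \<Longrightarrow> ns ! x = map h (pieces L (str x))"
  by (simp add: ns_def js)

lemma length_nth_ns: "x < K \<Longrightarrow> length (ns ! x) = num_pieces L (length (str x))"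
  by (simp add: nth_ns)

lemma sorted_ns: "sorted ns"
  unfolding ns_def js_def by (rule sorted_sort_key)

lemma piece_pos: "x < K \<Longrightarrow> a < length (ns ! x) \<Longrightarrow> a * L < length (str x)"
  using num_pieces_less[OF L] by (simp add: length_nth_ns)

lemma str_le: "x < K \<Longrightarrow> pos x + length (str x) \<le> length bs"
  using js_less[of x] by (intro offs_Suc_le) simp

lemma nn_le: "nn \<le> length bs"
proof -
  have "nn = sum_list (map (\<lambda>i. num_pieces L (length (xs ! i))) js)"
    by (simp add: nn_def ns_def length_concat o_def)
  also have "\<dots> \<le> sum_list (map (\<lambda>i. length (xs ! i)) js)"
    by (intro sum_list_mono num_pieces_le L)
  also have "\<dots> = sum_list (map (\<lambda>i. length (xs ! i)) [0..<K])"
    by (simp only: sum_mset_sum_list[symmetric] mset_map js(1))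
  also have "map (\<lambda>i. length (xs ! i)) [0..<K] = map length xs" by (rule nth_equalityI) auto
  finally show ?thesis by (simp add: length_concat)
qed

lemma words: "length bs < 2 ^ w" "K < 2 ^ w" "(1::nat) < 2 ^ w" "nn < 2 ^ w" "2 * K < 2 ^ w" "length bs + K < 2 ^ w"
proof -
  obtain c where c: "c = (2::nat) ^ w" by simp
  have *: "2 * (length bs + K) + 1 \<le> c" "0 < K" using word xs by (auto simp: c)
  show "length bs + K < 2 ^ w" unfolding c[symmetric] using * by arith
  show "2 * K < 2 ^ w" unfolding c[symmetric] using * by arith
  show "length bs < 2 ^ w" unfolding c[symmetric] using * by arith
  show "K < 2 ^ w" unfolding c[symmetric] using * by arith
  show "(1::nat) < 2 ^ w" unfolding c[symmetric] using * by arith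
  show "nn < 2 ^ w" unfolding c[symmetric] using * nn_le by arith
qed

lemma word_le: "x \<le> length bs \<Longrightarrow> x < 2 ^ w"
  using words(1) by (rule le_less_trans[rotated])

lemma ms_iff: "(x, a) \<in> set ms \<longleftrightarrow> x < K \<and> a \<in> set (marks_at ns x)"
  by (simp add: ms_def in_marks)

lemma ms_valid: "(x, a) \<in> set ms \<Longrightarrow> x < K \<and> a < length (ns ! x)"
  by (simp add: ms_iff in_marks_at)

lemma length_ms: "length ms \<le> 2 * (K - 1)"
  using length_marks[of K ns] by (simp add: ms_def)

text \<open>Pieces of one string start at different multiples of \<open>L\<close>, and different
  strings occupy disjoint stretches of the disk.\<close>

lemma triple_disjoint:
  assumes "x < K" "a < length (ns ! x)" "y < K" "b < length (ns ! y)" "(x, a) \<noteq> (y, b)"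
  shows "pos x + a * L + min L (length (str x) - a * L) \<le> pos y + b * L \<or>
    pos y + b * L + min L (length (str y) - b * L) \<le> pos x + a * L"
proof -
  have A: "a * L < length (str x)" "b * L < length (str y)" using piece_pos assms by auto
  show ?thesis
  proof (cases "x = y")
    case True
    then have "a < b \<or> b < a" using assms by auto
    then have "Suc a * L \<le> b * L \<or> Suc b * L \<le> a * L" by (metis Suc_leI mult_le_mono1)
    then show ?thesis using True by auto
  next
    case False
    then have "js ! x \<noteq> js ! y" using js assms by (simp add: nth_eq_iff_index_eq)
    then have "pos x + length (str x) \<le> pos y \<or> pos y + length (str y) \<le> pos x"
      using offs_Suc_le'[of "js ! x" "js ! y" xs] offs_Suc_le'[of "js ! y" "js ! x" xs] js_less assms
      by (cases "js ! x < js ! y") auto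
    then show ?thesis using A by auto
  qed
qed

lemma triple_pos: "x < K \<Longrightarrow> a < length (ns ! x) \<Longrightarrow> 0 < min L (length (str x) - a * L)"
  using piece_pos[of x a] L by auto

lemma triple_piece:
  assumes "x < K" "a < length (ns ! x)"
  shows "take (min L (length (str x) - a * L)) (drop (pos x + a * L) bs) = pieces L (str x) ! a"
    "length (pieces L (str x) ! a) = min L (length (str x) - a * L)"
proof -
  have p: "pieces L (str x) ! a = take L (drop (a * L) (str x))"
    using assms length_nth_ns by (intro pieces_nth) simp
  show "length (pieces L (str x) ! a) = min L (length (str x) - a * L)" by (simp add: p min.commute)
  have "take (min L (length (str x) - a * L)) (drop (pos x + a * L) bs)
      = take (min L (length (str x) - a * L)) (drop (a * L) (str x))"
    using js_less[OF assms(1)] piece_pos[OF assms] by (intro take_drop_concat) auto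
  also have "\<dots> = take L (drop (a * L) (str x))" by (simp add: min_def)
  finally show "take (min L (length (str x) - a * L)) (drop (pos x + a * L) bs) = pieces L (str x) ! a"
    by (simp add: p)
qed

lemma distinct_triple: "distinct (map (fst \<circ> triple) ms)" "distinct (map (snd \<circ> snd \<circ> triple) ms)"
proof -
  have "inj_on (fst \<circ> triple) (set ms)"
  proof (rule inj_onI)
    fix m m' assume m: "m \<in> set ms" "m' \<in> set ms" and e: "(fst \<circ> triple) m = (fst \<circ> triple) m'"
    obtain x a y b where mm: "m = (x, a)" "m' = (y, b)" by (meson surj_pair)
    have v: "x < K" "a < length (ns ! x)" "y < K" "b < length (ns ! y)" using m ms_valid mm by auto
    show "m = m'"
    proof (rule ccontr)
      assume "m \<noteq> m'"
      then have "(x, a) \<noteq> (y, b)" using mm by simp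
      from triple_disjoint[OF v this] show False
        using triple_pos[OF v(1,2)] triple_pos[OF v(3,4)] e by (auto simp: mm triple_def min_def split: if_splits)
    qed
  qed
  then show "distinct (map (fst \<circ> triple) ms)" using distinct_marks by (simp add: distinct_map ms_def)
  have "inj_on (snd \<circ> snd \<circ> triple) (set ms)"
  proof (rule inj_onI)
    fix m m' assume m: "m \<in> set ms" "m' \<in> set ms" and e: "(snd \<circ> snd \<circ> triple) m = (snd \<circ> snd \<circ> triple) m'"
    obtain x a y b where mm: "m = (x, a)" "m' = (y, b)" by (meson surj_pair)
    have v: "x < K" "a < length (ns ! x)" "y < K" "b < length (ns ! y)" using m ms_valid mm by auto
    show "m = m'" using offs_inj[of x ns a y b] v e by (simp add: mm triple_def)
  qed
  then show "distinct (map (snd \<circ> snd \<circ> triple) ms)" using distinct_marks by (simp add: distinct_map ms_def)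
qed

definition marked_pieces :: "(nat list \<times> nat) set" where
  "marked_pieces = (\<lambda>(x, a). (map of_bool (pieces L (str x) ! a), offs ns x + a)) ` set ms"

definition entry :: "(nat list \<times> nat) list \<Rightarrow> nat \<Rightarrow> nat \<Rightarrow> nat" where
  "entry its x a = (if x < K \<and> a \<in> set (marks_at ns x) then piece_rank its (map of_bool (pieces L (str x) ! a)) else 0)"

definition final_entry :: "(nat list \<times> nat) list \<Rightarrow> nat \<Rightarrow> nat \<Rightarrow> nat" where
  "final_entry its z = left_pass (lcps ns) (right_pass (lcps ns) (entry its)) (K - 1) (K - 1 - z)"

definition out :: "(nat list \<times> nat) list \<Rightarrow> nat list" where
  "out its = map (\<lambda>x. js ! x) (sort_key (\<lambda>x. map (final_entry its x) [0..<length (ns ! x)]) [0..<K])"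

lemma entry_nonzero:
  assumes "set its = marked_pieces" "x < K" "a < length (ns ! x)"
  shows "entry its x a \<noteq> 0 \<longleftrightarrow> a \<in> set (marks_at ns x)"
proof
  assume a: "a \<in> set (marks_at ns x)"
  then have "map of_bool (pieces L (str x) ! a) \<in> fst ` set its"
    using assms by (force simp: marked_pieces_def ms_iff)
  then show "entry its x a \<noteq> 0" using piece_rank_pos a assms(2) by (simp add: entry_def)
qed (auto simp: entry_def split: if_splits)

lemma out_permutation: "distinct (out its)" "set (out its) = {..<K}"
proof -
  let ?ks = "sort_key (\<lambda>x. map (final_entry its x) [0..<length (ns ! x)]) [0..<K]"
  have "distinct ?ks" "set ?ks = {..<K}" by auto
  then show "distinct (out its)" unfolding out_def
    using js by (auto simp: distinct_map inj_on_def nth_eq_iff_index_eq)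
  have "set (out its) = (\<lambda>x. js ! x) ` {..<length js}" using js(3) by (auto simp: out_def)
  also have "\<dots> = set js" by (auto simp: set_conv_nth)
  finally show "set (out its) = {..<K}" using js by simp
qed

text \<open>The argument is by contraposition: strings in the wrong order would have columns
  strictly in the wrong order. Ties between columns are therefore harmless.\<close>

lemma out_sorted:
  assumes its: "set its = marked_pieces" and sep: "separates L (set xs) h"
  shows "is_sorting_permutation xs (out its)"
proof -
  let ?ps = "map (\<lambda>i. pieces L (xs ! i)) js" and ?\<rho> = "\<lambda>p. piece_rank its (map of_bool p)"
  have ps: "?ps ! x = pieces L (str x)" if "x < K" for x using that js by simp
  interpret T: sorted_marked_table ns K "entry its" ?ps ?\<rho> h
  proof
    show "K = length ns" by simp
    show "1 \<le> K" using xs by (metis One_nat_def Suc_leI length_greater_0_conv)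
    show "entry its x a \<noteq> 0 \<longleftrightarrow> a \<in> set (marks_at ns x)" if "x < K" "a < length (ns ! x)" for x a
      using entry_nonzero[OF its that] .
    show "sorted ns" by (rule sorted_ns)
    show "ns ! x = map h (?ps ! x)" if "x < K" for x using that by (simp only: ps nth_ns)
    show "?ps ! x ! a = ?ps ! y ! a" if "x < K" "y < K" "a < length (ns ! x)" "a < length (ns ! y)"
      "take a (?ps ! x) = take a (?ps ! y)" "ns ! x ! a = ns ! y ! a" for x y a
    proof (rule ccontr)
      assume neq: "?ps ! x ! a \<noteq> ?ps ! y ! a"
      have "str x \<in> set xs" "str y \<in> set xs" using js_less that by auto
      moreover have "a < length (pieces L (str x))" "a < length (pieces L (str y))"
        using that by (simp_all add: nth_ns)
      ultimately have "h (pieces L (str x) ! a) \<noteq> h (pieces L (str y) ! a)"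
        using sep that(5) neq unfolding separates_def ps[OF that(1)] ps[OF that(2)] by blast
      then show False using that by (simp add: nth_ns)
    qed
    show "entry its x a = ?\<rho> (?ps ! x ! a)" if "x < K" "a \<in> set (marks_at ns x)" for x a
      using that by (simp add: entry_def ps)
    show "?\<rho> (?ps ! x ! a) < ?\<rho> (?ps ! y ! b)"
      if "x < K" "y < K" "a \<in> set (marks_at ns x)" "b \<in> set (marks_at ns y)" "?ps ! x ! a < ?ps ! y ! b" for x a y b
    proof (rule piece_rank_less)
      show "map of_bool (?ps ! x ! a) < (map of_bool (?ps ! y ! b) :: nat list)" by (rule map_of_bool_less[OF that(5)])
      show "map of_bool (?ps ! y ! b) \<in> fst ` set its"
        using that unfolding its ps[OF that(2)] by (force simp: marked_pieces_def ms_iff)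
    qed
  qed
  have col: "map (final_entry its x) [0..<length (ns ! x)] = T.column x" for x
    by (simp add: T.column_def T.Z_def final_entry_def)
  let ?ks = "sort_key T.column [0..<K]"
  have "sorted (map T.column ?ks)" by (rule sorted_sort_key)
  then have "sorted_wrt (\<lambda>x y. T.column x \<le> T.column y) ?ks" by (simp add: sorted_wrt_map)
  moreover have "str x \<le> str y" if "x \<in> set ?ks" "y \<in> set ?ks" "T.column x \<le> T.column y" for x y
  proof (rule ccontr)
    assume "\<not> str x \<le> str y"
    then have "pieces L (str y) < pieces L (str x)" by (intro pieces_less[OF L]) simp
    then have "T.column y < T.column x" using that by (intro T.column_less) (simp_all add: ps del: nth_map)
    then show False using that(3) by simp
  qed
  ultimately have "sorted_wrt (\<lambda>x y. str x \<le> str y) ?ks" by (rule sorted_wrt_mono_rel[rotated]) auto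
  then have "sorted (map (\<lambda>i. xs ! i) (out its))" by (simp add: out_def col sorted_wrt_map)
  then show ?thesis using out_permutation[of its] by (simp add: is_sorting_permutation_def)
qed

section \<open>Page and bit budgets of a run\<close>

definition page_bound :: nat where
  "page_bound = 8 * (length bs + nn * nb + K * w + K * L) div B"

text \<open>The factor 8 comes from sorting the marks: up to \<open>2 * K\<close> of them, each with
  one key word and three descriptor words. The marked pieces, at most \<open>2 * K * L\<close> bits,
  also fit.\<close>

definition bit_bound :: nat where
  "bit_bound = 8 * (nn * nb + K * w + K * L)"

lemma pg_le: "n * W a \<le> 8 * (length bs + nn * nb + K * w + K * L) \<Longrightarrow> pg a n \<le> page_bound"
  unfolding pg_def page_bound_def by (rule div_le_mono)

lemma pg_words:
  assumes "n \<le> 8 * K" "W a = w"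
  shows "pg a n \<le> page_bound"
proof (rule pg_le)
  have "n * W a \<le> 8 * K * w" unfolding assms(2) by (intro mult_le_mono1 assms(1))
  also have "\<dots> \<le> 8 * (length bs + nn * nb + K * w + K * L)" by simp
  finally show "n * W a \<le> 8 * (length bs + nn * nb + K * w + K * L)" .
qed

lemma pg_arrays: "pg CName nn \<le> page_bound" "pg Tab nn \<le> page_bound" "pg Str (length bs) \<le> page_bound"
  by (auto intro!: pg_le)

lemma bits_le:
  assumes "x \<le> 2 * K * L" "n \<le> 8 * K"
  shows "x + n * w \<le> bit_bound"
proof -
  have "x + n * w \<le> 2 * K * L + 8 * K * w" by (intro add_mono mult_le_mono1 assms)
  also have "\<dots> \<le> bit_bound" by (simp add: bit_bound_def)
  finally show ?thesis .
qed

definition cdescs :: "nat list" where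
  "cdescs = concat (map (\<lambda>x. [length (ns ! x), js ! x, pos x, length (str x)]) [0..<K])"

lemma cdescs: "concat (map (cdesc L xs) js) = cdescs"
proof -
  have "map (cdesc L xs) js = map (\<lambda>x. [length (ns ! x), js ! x, pos x, length (str x)]) [0..<K]"
    by (rule nth_equalityI) (simp_all add: js(3) cdesc_def length_nth_ns)
  then show ?thesis by (simp add: cdescs_def)
qed

lemma length_cdescs: "length cdescs = 4 * K"
  unfolding cdescs_def by (subst length_concat_uniform[where k = 4]) auto

lemma length_names: "length (concat (map (map h \<circ> pieces L) xs)) = nn"
proof -
  have "mset (map (map h \<circ> pieces L) xs) = mset ns"
  proof -
    have "map (map h \<circ> pieces L) xs = map (\<lambda>i. map h (pieces L (xs ! i))) [0..<K]"
      by (rule nth_equalityI) auto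
    then show ?thesis by (simp only: ns_def mset_map js(1))
  qed
  then show ?thesis unfolding nn_def by (rule length_concat_mset)
qed

definition names_state :: "(arr \<Rightarrow> nat list) \<Rightarrow> bool" where
  "names_state C \<longleftrightarrow> C Str = map of_bool bs \<and> C CName = concat ns \<and> C CDesc = cdescs \<and>
     (\<forall>a\<in>{Lcp, MKey, MDesc, Pc, PDesc, RKey, RDesc, Tab, Out}. C a = [])"

lemma wp_sorted_names:
  assumes s: "at_rest C 0 s" and C: "C = (\<lambda>_. [])(Str := map of_bool bs, Len := map length xs)"
    and S: "\<forall>\<eta> \<mu>. \<mu> \<le> bit_bound \<longrightarrow> srt \<eta> \<mu> \<le> S"
  shows "wp (do { _ \<leftarrow> make_cstrings h K L; mergesort CName CDesc 4 })
    (\<lambda>_ s'. \<exists>C. names_state C \<and> at_rest C (14 + 24 * page_bound + S) s') s"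
proof -
  let ?names = "concat (map (map h \<circ> pieces L) xs)"
  let ?C1 = "C(CName := ?names, CDesc := concat (map (cdesc L xs) [0..<K]))"
  let ?t1 = "0 + 14 + 6 * (pg Len K + pg Str (length bs) + pg CName (length ?names) + pg CDesc (4 * K))"
  let ?it = "\<lambda>i. (map h (pieces L (xs ! i)), cdesc L xs i)"
  show ?thesis
    unfolding wp_bind
  proof (rule wp_mono[OF wp_make_cstrings[where xs = xs and K = K and L = L and h = h, OF s]], goal_cases)
    case (9 r s1)
    then have s1: "at_rest ?C1 ?t1 s1" .
    have nm: "map (map h \<circ> pieces L) xs = map (\<lambda>i. map h (pieces L (xs ! i))) [0..<K]"
      by (rule nth_equalityI) auto
    show ?case
    proof (rule wp_mergesort[where its = "map ?it [0..<K]", OF s1], goal_cases)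
      have "map fst (map ?it [0..<K]) = map (map h \<circ> pieces L) xs" by (rule nth_equalityI) auto
      then show "?C1 CName = concat (map fst (map ?it [0..<K]))" by (simp only:) simp
      show "?C1 CDesc = concat (map snd (map ?it [0..<K]))" by (simp add: o_def)
      show "length v = 4 \<and> hd v = length u" if "(u, v) \<in> set (map ?it [0..<K])" for u v
        using that by (auto simp: cdesc_def)
    next
      case (6 s')
      note s' = 6
      let ?C2 = "?C1(CName := concat ns, CDesc := cdescs)"
      have so: "sort_key fst (map ?it [0..<K]) = map ?it js" by (simp add: sort_key_map js_def)
      have cd4: "length (concat (map (cdesc L xs) [0..<K])) = 4 * K"
        by (subst length_concat_uniform[where k = 4]) (auto simp: cdesc_def)
      have "srt K (nn * nb + 4 * K * w) \<le> S" by (rule S[rule_format]) (simp add: bit_bound_def)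
      moreover have "pg Len K \<le> page_bound" "pg Str (length bs) \<le> page_bound" "pg CName nn \<le> page_bound" "pg CDesc (4 * K) \<le> page_bound"
        by (auto intro!: pg_le)
      ultimately have "at_rest ?C2 (14 + 24 * page_bound + S) s'"
        using s' by (simp add: so o_def cd4 cdescs flip: ns_def) (simp add: at_rest_def length_names[unfolded o_def])
      moreover have "names_state ?C2" by (simp add: names_state_def C)
      ultimately show ?case by blast
    qed auto
  qed (use C L h words in auto)
qed

definition ranks_state :: "(nat list \<times> nat) list \<Rightarrow> (arr \<Rightarrow> nat list) \<Rightarrow> bool" where
  "ranks_state its C \<longleftrightarrow> set its = marked_pieces \<and> length its = length ms \<and> distinct (map snd its) \<and>
     C CName = concat ns \<and> C CDesc = cdescs \<and> C Lcp = map (lcps ns) [0..<K - 1] \<and> C Tab = [] \<and> C Out = [] \<and>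
     (\<exists>its'. mset its' = mset its \<and> sorted (map snd its') \<and> C RKey = map snd its' \<and>
       C RDesc = concat (map (\<lambda>(u, g). [1, piece_rank its u]) its'))"

definition bits_of :: "nat \<times> nat \<times> nat \<Rightarrow> nat list" where
  "bits_of = (\<lambda>(p, l, g). map of_bool (take l (drop p bs)))"

lemma triple_in_bounds:
  assumes "(p, l, g) \<in> set (map triple ms)"
  shows "p + l \<le> length bs" "l \<le> L" "g < nn" "length (bits_of (p, l, g)) = l"
proof -
  obtain x a where m: "(x, a) \<in> set ms" "triple (x, a) = (p, l, g)" using assms by auto
  then have v: "x < K" "a < length (ns ! x)" using ms_valid by auto
  show pl: "p + l \<le> length bs" using m piece_pos[OF v] str_le[OF v(1)] by (auto simp: triple_def)
  show "l \<le> L" using m by (auto simp: triple_def)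
  show "g < nn" using m offs_Suc_le[of x ns] v by (auto simp: triple_def nn_def)
  show "length (bits_of (p, l, g)) = l" using pl by (simp add: bits_of_def)
qed

lemma bits_of_marked: "(\<lambda>t. (bits_of t, snd (snd t))) ` set (map triple ms) = marked_pieces"
proof -
  have "(bits_of (triple m), snd (snd (triple m))) = (case m of (x, a) \<Rightarrow> (map of_bool (pieces L (str x) ! a), offs ns x + a))"
    if "m \<in> set ms" for m
  proof -
    obtain x a where m: "m = (x, a)" by fastforce
    then have v: "x < K" "a < length (ns ! x)" using that ms_valid by auto
    show ?thesis using triple_piece(1)[OF v] by (simp add: m triple_def bits_of_def)
  qed
  then show ?thesis unfolding marked_pieces_def set_map image_image by (rule image_cong[OF refl])
qed

lemma length_bits: "length (concat (map bits_of (map triple ms))) \<le> 2 * K * L"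
proof -
  have "length (concat (map bits_of (map triple ms))) = sum_list (map (\<lambda>m. length (bits_of (triple m))) ms)"
    by (simp add: length_concat o_def)
  also have "\<dots> \<le> sum_list (map (\<lambda>m. L) ms)"
  proof (rule sum_list_mono)
    fix m assume "m \<in> set ms"
    then have t: "triple m \<in> set (map triple ms)" by simp
    obtain p l g where m: "triple m = (p, l, g)" using prod_cases3 by blast
    show "length (bits_of (triple m)) \<le> L" using triple_in_bounds[OF t[unfolded m]] unfolding m by simp
  qed
  also have "\<dots> = length ms * L" by (simp add: sum_list_triv)
  also have "\<dots> \<le> 2 * K * L" using length_ms by (intro mult_le_mono1) simp
  finally show ?thesis .
qed

lemma wp_ranked_marks:
  assumes s: "at_rest C t s" and C: "names_state C" and S: "\<forall>\<eta> \<mu>. \<mu> \<le> bit_bound \<longrightarrow> srt \<eta> \<mu> \<le> S"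
  shows "wp (do { _ \<leftarrow> mark_mismatches K L; collect_pieces; rank_pieces })
    (\<lambda>_ s'. \<exists>its C. ranks_state its C \<and> at_rest C (t + 42 + 102 * page_bound + 3 * S) s') s"
proof -
  let ?P = page_bound and ?r = "length ms"
  have r: "?r \<le> 2 * K" using length_ms by simp
  let ?m1 = "map (\<lambda>(x, a). pos x + a * L) ms"
  let ?m2 = "concat (map (\<lambda>(x, a). [1, min L (length (str x) - a * L), offs ns x + a]) ms)"
  let ?C1 = "C(Lcp := map (lcps ns) [0..<K - 1], MKey := ?m1, MDesc := ?m2)"
  have m1: "?m1 = map fst (map triple ms)" by (auto simp: triple_def)
  have m2: "?m2 = concat (map (\<lambda>(p, l, g). [1, l, g]) (map triple ms))"
    by (intro arg_cong[where f = concat]) (auto simp: triple_def)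
  have b1: "pos x + a * L < 2 ^ w" "length (str x) < 2 ^ w" if "x < K" "a < length (ns ! x)" for x a
    using piece_pos[OF that] str_le[OF that(1)] by (auto intro!: word_le)
  have b2: "length (str x) < 2 ^ w" if "x < K" for x using str_le[OF that] by (auto intro!: word_le)
  have "5 * K + 1 \<le> 8 * K" using xs by (cases xs) auto
  then have P1: "pg CDesc (5 * K + 1) \<le> ?P" by (rule pg_words) simp
  have P2: "pg CName nn \<le> ?P" "pg Lcp K \<le> ?P" "pg MKey ?r \<le> ?P" "pg MDesc (3 * ?r) \<le> ?P"
    "pg Str (length bs) \<le> ?P" "pg PDesc (2 * ?r) \<le> ?P" "pg RKey ?r \<le> ?P" "pg RDesc (2 * ?r) \<le> ?P"
    using r by (simp_all add: pg_words pg_arrays)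
  have P3: "pg Pc (length (concat (map bits_of (map triple ms)))) \<le> ?P"
    using length_bits by (intro pg_le) simp
  show ?thesis
    unfolding wp_bind
  proof (rule wp_mono[OF wp_mark_mismatches[where K = K and L = L and ns = ns and idx = "\<lambda>x. js ! x" and p = "\<lambda>x. pos x" and sl = "\<lambda>x. length (str x)", OF s]], goal_cases)
    case (11 r1 s1)
    note s1' = 11[folded ms_def nn_def]
    have s1: "at_rest ?C1 (t + 14 + 42 * ?P) s1"
      by (intro at_rest_mono[OF s1'] budgets P1 P2)
    show ?case
    proof (rule wp_mono[OF wp_collect_pieces[where ms = "map triple ms" and bs = bs, OF s1]], goal_cases)
      case (9 r2 s2)
      from 9[folded bits_of_def, unfolded length_map]
      obtain ms' where ms': "mset ms' = mset (map triple ms)" and s2: "at_rest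
       (?C1(MKey := map fst ms', MDesc := concat (map (\<lambda>(p, l, g). [1, l, g]) ms'),
          Pc := concat (map bits_of ms'), PDesc := concat (map (\<lambda>(p, l, g). [l, g]) ms')))
       (t + 14 + 42 * ?P + srt ?r (?r * w + 3 * ?r * w) + 14
        + 6 * (pg MKey ?r + pg MDesc (3 * ?r) + pg Str (length bs)
           + pg Pc (length (concat (map bits_of (map triple ms)))) + pg PDesc (2 * ?r))) s2"
        by (elim exE conjE)
      define its where "its = map (\<lambda>t. (bits_of t, snd (snd t))) ms'"
      have set': "set ms' = set (map triple ms)" using ms' by (rule mset_eq_setD)
      have len': "length ms' = ?r" using mset_eq_length[OF ms'] by simp
      have set_its: "set its = marked_pieces" using bits_of_marked set' by (simp add: its_def)
      have len_its: "length its = ?r" by (simp add: its_def len')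
      have "mset (map snd its) = mset (map (snd \<circ> snd \<circ> triple) ms)"
        using arg_cong[OF ms', of "image_mset (\<lambda>t. snd (snd t))"] by (simp add: its_def o_def flip: mset_map)
      then have dist_its: "distinct (map snd its)" using distinct_triple(2) mset_eq_imp_distinct_iff by blast
      have PD: "concat (map (\<lambda>(p, l, g). [l, g]) ms') = concat (map (\<lambda>(u, g). [length u, g]) its)"
      proof -
        have "map (\<lambda>(p, l, g). [l, g]) ms' = map (\<lambda>(u, g). [length u, g]) its"
          unfolding its_def map_map
        proof (rule map_cong[OF refl])
          fix m assume m: "m \<in> set ms'"
          obtain p l g where plg: "m = (p, l, g)" using prod_cases3 by blast
          then have "length (bits_of (p, l, g)) = l" using triple_in_bounds(4)[of p l g] m set' by simp
          then show "(case m of (p, l, g) \<Rightarrow> [l, g]) = ((\<lambda>(u, g). [length u, g]) \<circ> (\<lambda>t. (bits_of t, snd (snd t)))) m"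
            by (simp add: plg)
        qed
        then show ?thesis by simp
      qed
      let ?C2 = "?C1(MKey := map fst ms', MDesc := concat (map (\<lambda>(p, l, g). [1, l, g]) ms'),
          Pc := concat (map bits_of ms'), PDesc := concat (map (\<lambda>(p, l, g). [l, g]) ms'))"
      have C2Pc: "?C2 Pc = concat (map bits_of ms')" by simp
      have lPc: "length (concat (map bits_of ms')) = length (concat (map bits_of (map triple ms)))"
        using arg_cong[OF ms', of "image_mset bits_of"] by (intro length_concat_mset) (simp only: mset_map)
      \<comment> \<open>Four words per mark and at most \<open>2 * K\<close> marks: exactly the
        \<open>8 * K\<close> words allowed by \<open>bits_le\<close>.\<close>
      have "srt ?r (?r * w + 3 * ?r * w) \<le> S" using bits_le[of 0 "4 * ?r"] r by (intro S[rule_format]) (simp add: algebra_simps)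
      note srt2 = this
      have s2': "at_rest ?C2 (t + 28 + 72 * ?P + S) s2"
        by (intro at_rest_mono[OF s2] budgets P2 P3 srt2)
      show ?case
      proof (rule wp_mono[OF wp_rank_pieces[where its = its, OF s2']], goal_cases)
        case (8 r3 s3)
        from 8[unfolded len_its C2Pc] obtain its1 its2 where its2: "mset its2 = mset its" "sorted (map snd its2)" and s3: "at_rest
         (?C2(Pc := concat (map fst its1), PDesc := concat (map (\<lambda>(u, g). [length u, g]) its1),
            RKey := map snd its2, RDesc := concat (map (\<lambda>(u, g). [1, piece_rank its u]) its2)))
         (t + 28 + 72 * ?P + S + srt ?r (length (concat (map bits_of ms')) + 2 * ?r * w) + 14
          + 6 * (pg PDesc (2 * ?r) + 2 * pg Pc (length (concat (map bits_of ms'))) + pg RKey ?r + pg RDesc (2 * ?r))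
          + srt ?r (?r * w + 2 * ?r * w)) s3" by (elim exE conjE)
        let ?C3 = "?C2(Pc := concat (map fst its1), PDesc := concat (map (\<lambda>(u, g). [length u, g]) its1),
            RKey := map snd its2, RDesc := concat (map (\<lambda>(u, g). [1, piece_rank its u]) its2))"
        have srt3: "srt ?r (length (concat (map bits_of ms')) + 2 * ?r * w) \<le> S"
          unfolding lPc using length_bits r by (intro S[rule_format] bits_le) auto
        have srt4: "srt ?r (?r * w + 2 * ?r * w) \<le> S" using bits_le[of 0 "3 * ?r"] r by (intro S[rule_format]) (simp add: algebra_simps)
        have "at_rest ?C3 (t + 42 + 102 * ?P + 3 * S) s3"
          by (intro at_rest_mono[OF s3] budgets P2 P3[folded lPc] srt3 srt4)
        moreover have "ranks_state its ?C3"
          unfolding ranks_state_def using C its2 set_its len_its dist_its by (auto simp: names_state_def)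
        ultimately show ?case by blast
      next
        show "?C2 Pc = concat (map fst its)" by (simp add: its_def o_def)
        show "?C2 PDesc = concat (map (\<lambda>(u, g). [length u, g]) its)" by (simp add: PD)
        show "?C2 RKey = []" "?C2 RDesc = []" using C by (simp_all add: names_state_def)
        show "g < 2 ^ w" if ug: "(u, g) \<in> set its" for u g
        proof -
          obtain t' where "t' \<in> set (map triple ms)" "g = snd (snd t')" using ug set' by (auto simp: its_def)
          then have "g < nn" using triple_in_bounds(3)[of "fst t'" "fst (snd t')" "snd (snd t')"] by simp
          then show ?thesis using words(4) by simp
        qed
        show "length its < 2 ^ w" using words(5) r len_its by simp
        show "(1::nat) < 2 ^ w" by (rule words)
      qed
    next
      show "?C1 MKey = map fst (map triple ms)" by (simp add: m1)
      show "?C1 MDesc = concat (map (\<lambda>(p, l, g). [1, l, g]) (map triple ms))" by (simp only: m2 fun_upd_same)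
      show "?C1 Pc = []" "?C1 PDesc = []" "?C1 Str = map of_bool bs" using C by (simp_all add: names_state_def)
      show "p + l \<le> length bs \<and> l < 2 ^ w \<and> g < 2 ^ w" if "(p, l, g) \<in> set (map triple ms)" for p l g
        using triple_in_bounds[OF that] words(4) word_le[of l] by simp
      show "distinct (map fst (map triple ms))" using distinct_triple(1) by simp
      show "p + l \<le> p'" if pl: "(p, l, g) \<in> set (map triple ms)" "(p', l', g') \<in> set (map triple ms)" "p < p'" for p l g p' l' g'
      proof -
        obtain x a y b where m: "(x, a) \<in> set ms" "triple (x, a) = (p, l, g)" "(y, b) \<in> set ms" "triple (y, b) = (p', l', g')"
          using pl unfolding set_map by (elim imageE) (metis prod.collapse)
        then have "(x, a) \<noteq> (y, b)" using pl(3) by auto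
        then show ?thesis
          using triple_disjoint[of x a y b] ms_valid[OF m(1)] ms_valid[OF m(3)] m pl(3) by (simp add: triple_def)
      qed
    qed
  next
    show "C CName = concat ns" "C CDesc = concat (map (\<lambda>x. [length (ns ! x), js ! x, pos x, length (str x)]) [0..<K])"
      "C Lcp = []" "C MKey = []" "C MDesc = []"
      using C by (simp_all add: names_state_def cdescs_def)
    show "length (concat ns) < 2 ^ w" using words(4) by (simp add: nn_def)
    show "(1::nat) < 2 ^ w" by (rule words)
  qed (use b1 b2 in auto)
qed

text \<open>Each marked name has its own position, so looking up a position in the association list
  finds its only rank; unmarked positions are missing and give 0.\<close>

lemma entry_table:
  fixes its' :: "(nat list \<times> nat) list"
  assumes its: "set its = marked_pieces" "set its' = marked_pieces" and dist: "distinct (map snd its')"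
  defines "rs \<equiv> map (\<lambda>(u, g). (g, piece_rank its u)) its'"
  shows "map (\<lambda>q. case map_of rs q of Some \<rho> \<Rightarrow> \<rho> | None \<Rightarrow> 0) [0..<nn] = table ns (entry its)"
proof (rule nth_equalityI)
  fix q assume "q < length (map (\<lambda>q. case map_of rs q of Some \<rho> \<Rightarrow> \<rho> | None \<Rightarrow> 0) [0..<nn])"
  then have q: "q < nn" by simp
  then obtain x a where xa: "x < K" "a < length (ns ! x)" "q = offs ns x + a"
    using ex_offs[of q ns] by (auto simp: nn_def)
  have fst: "map fst rs = map snd its'" by (auto simp: rs_def)
  have "(case map_of rs q of Some \<rho> \<Rightarrow> \<rho> | None \<Rightarrow> 0) = entry its x a"
  proof (cases "a \<in> set (marks_at ns x)")
    case True
    then have "(map of_bool (pieces L (str x) ! a), q) \<in> set its'"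
      unfolding its marked_pieces_def using xa by (force simp: ms_iff)
    then have "(q, piece_rank its (map of_bool (pieces L (str x) ! a))) \<in> set rs"
      by (force simp: rs_def)
    then have "map_of rs q = Some (piece_rank its (map of_bool (pieces L (str x) ! a)))"
      using dist fst by (intro map_of_is_SomeI) simp_all
    then show ?thesis using True xa by (simp add: entry_def)
  next
    case False
    have "q \<notin> snd ` set its'"
    proof
      assume "q \<in> snd ` set its'"
      then obtain y b where y: "(y, b) \<in> set ms" "q = offs ns y + b"
        unfolding its marked_pieces_def by auto
      then have "x = y \<and> a = b" using offs_inj[of x ns a y b] ms_valid[OF y(1)] xa by simp
      then show False using False y by (simp add: ms_iff)
    qed
    then have "q \<notin> set (map fst rs)" by (simp only: fst set_map not_False_eq_True)
    then have "map_of rs q = None" by (simp add: map_of_eq_None_iff)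
    then show ?thesis using False by (simp add: entry_def)
  qed
  then show "map (\<lambda>q. case map_of rs q of Some \<rho> \<Rightarrow> \<rho> | None \<Rightarrow> 0) [0..<nn] ! q = table ns (entry its) ! q"
    using q nth_table[of x ns a "entry its"] xa by simp
qed (simp add: nn_def)

text \<open>The reason is \<open>2 * (K - 1) < K ^ 2\<close>, that is
  \<open>(K - 1) ^ 2 + 1 > 0\<close>. It holds even for \<open>K = 1\<close>, where names have no
  bits and every rank is 0.\<close>

lemma rank_bound:
  assumes "length its = length ms"
  shows "piece_rank its u < 2 ^ nb"
proof -
  have "piece_rank its u \<le> 2 * (K - 1)" using piece_rank_le[of its u] length_ms assms by simp
  also have "\<dots> < K ^ 2"
  proof -
    obtain d where "K = Suc d" using xs by (cases xs) auto
    then show ?thesis by (simp add: power2_eq_square algebra_simps One_nat_def)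
  qed
  finally show ?thesis using name by simp
qed

lemma wp_columns:
  assumes s: "at_rest C t s" and C: "ranks_state its C" and S: "\<forall>\<eta> \<mu>. \<mu> \<le> bit_bound \<longrightarrow> srt \<eta> \<mu> \<le> S"
  shows "wp (do { _ \<leftarrow> make_table; off_last \<leftarrow> propagate_right K; _ \<leftarrow> propagate_left K off_last; output_permutation K })
    (\<lambda>_ s'. ok s' \<and> cells s' Out = out its \<and> ios s' \<le> t + 56 + 82 * page_bound + S) s"
proof -
  let ?P = page_bound
  from C have its: "set its = marked_pieces" "length its = length ms" "distinct (map snd its)"
    and CC: "C CName = concat ns" "C CDesc = cdescs" "C Lcp = map (lcps ns) [0..<K - 1]" "C Tab = []" "C Out = []"
    unfolding ranks_state_def by auto
  from C obtain its' where its': "mset its' = mset its" "sorted (map snd its')" and RK: "C RKey = map snd its'"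
    and RD: "C RDesc = concat (map (\<lambda>(u, g). [1, piece_rank its u]) its')"
    unfolding ranks_state_def by auto
  have set': "set its' = marked_pieces" using its its' mset_eq_setD by blast
  have len': "length its' = length ms" using mset_eq_length[OF its'(1)] its by simp
  have "mset (map snd its') = mset (map snd its)" using its'(1) by simp
  then have dist': "distinct (map snd its')" using its(3) mset_eq_imp_distinct_iff by blast
  define rs where "rs = map (\<lambda>(u, g). (g, piece_rank its u)) its'"
  have fst: "map fst rs = map snd its'" by (auto simp: rs_def)
  have lrs: "length rs = length ms" by (simp add: rs_def len')
  have r: "length ms \<le> 2 * K" using length_ms by simp
  have K1: "1 \<le> K" using xs by (cases xs) (auto simp: One_nat_def)
  have lc: "lcps ns x \<le> length (ns ! x) \<and> lcps ns x \<le> length (ns ! Suc x)" for x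
    by (simp add: lcps_def lcp_le)
  have CD4: "cdescs ! (4 * x) = length (ns ! x)" if "x < K" for x
  proof -
    have "cdescs ! (4 * x + 0) = [length (ns ! x), js ! x, pos x, length (str x)] ! 0"
      unfolding cdescs_def using that by (subst nth_concat_uniform[where k = 4]) auto
    then show ?thesis by simp
  qed
  let ?E = "entry its" and ?R = "right_pass (lcps ns) (entry its)"
  let ?Z = "final_entry its"
  have bE: "?E x a < 2 ^ nb" for x a using rank_bound[OF its(2)] by (simp add: entry_def)
  have bR: "?R x a < 2 ^ nb" for x a by (induction x arbitrary: a) (auto simp: bE)
  have P: "pg RKey (length ms) \<le> ?P" "pg RDesc (2 * length ms) \<le> ?P" "pg CDesc (4 * K) \<le> ?P" "pg Lcp K \<le> ?P" "pg Out K \<le> ?P"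
    using r by (simp_all add: pg_words)
  let ?C1 = "C(Tab := table ns ?E)" and ?C2 = "C(Tab := table ns ?R)" and ?C3 = "C(Tab := table ns ?Z)"
  show ?thesis
    unfolding wp_bind
  proof (rule wp_mono[OF wp_make_table[where n = nn and rs = rs, OF s]], goal_cases)
    case (7 r1 s1)
    note s1' = 7[unfolded entry_table[OF its(1) set' dist', folded rs_def] lrs]
    have s1: "at_rest ?C1 (t + 14 + 18 * ?P) s1"
      by (intro at_rest_mono[OF s1'] budgets P pg_arrays)
    show ?case
    proof (rule wp_mono[OF wp_propagate_right[where K = K and ns = ns and lc = "lcps ns" and F = ?E, OF s1]], goal_cases)
      case (9 off s2)
      note s2' = 9[folded nn_def, unfolded fun_upd_upd]
      have off: "off = offs ns (K - 1)" using s2' by (rule conjunct1)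
      have s2: "at_rest ?C2 (t + 28 + 46 * ?P) s2"
        by (intro at_rest_mono[OF conjunct2[OF s2']] budgets P pg_arrays)
      show ?case
        unfolding off
      proof (rule wp_mono[OF wp_propagate_left[where K = K and ns = ns and lc = "lcps ns" and G = ?R, OF s2]], goal_cases)
        case (9 r3 s3)
        note s3' = 9[folded nn_def final_entry_def, unfolded fun_upd_upd]
        have s3: "at_rest ?C3 (t + 42 + 70 * ?P) s3"
          by (intro at_rest_mono[OF s3'] budgets P pg_arrays)
        let ?it = "\<lambda>x. (map (?Z x) [0..<length (ns ! x)], [length (ns ! x), js ! x, pos x, length (str x)])"
        show ?case
        proof (rule wp_mono[OF wp_output_permutation[where K = K and its = "map ?it [0..<K]", OF s3]], goal_cases)
          case (6 r4 s4)
          note s4 = this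
          have "srt K (length (?C3 Tab) * nb + 4 * K * w) \<le> S"
            by (rule S[rule_format]) (simp add: bit_bound_def flip: nn_def)
          moreover have "map (\<lambda>(u, v). v ! 1) (sort_key fst (map ?it [0..<K])) = out its"
            unfolding sort_key_map by (simp add: out_def)
          ultimately show ?case
            using s4 P by simp
        next
          show "?C3 Tab = concat (map fst (map ?it [0..<K]))" by (simp add: table_def o_def)
          show "?C3 CDesc = concat (map snd (map ?it [0..<K]))" by (simp add: CC cdescs_def o_def)
          show "?C3 Out = []" by (simp add: CC)
          show "K = length (map ?it [0..<K])" by simp
          show "length v = 4 \<and> hd v = length u \<and> v ! 1 < 2 ^ w" if uv: "(u, v) \<in> set (map ?it [0..<K])" for u v
          proof -
            obtain x where x: "x \<in> {0..<K}" "(u, v) = ?it x" using uv unfolding set_map set_upt by blast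
            have "js ! x < 2 ^ w" using js_less[of x] x(1) words(2) by simp
            then show ?thesis using x by simp
          qed
        qed
      qed (simp_all add: CC CD4 length_cdescs lc bR K1 del: One_nat_def)
    qed (simp_all add: CC CD4 length_cdescs lc bE K1 del: One_nat_def)
  next
    show "length (C CName) = nn" by (simp add: CC nn_def)
    show "C RKey = map fst rs" by (simp only: RK fst)
    show "C RDesc = concat (map (\<lambda>(g, \<rho>). [1, \<rho>]) rs)" unfolding RD rs_def by (simp add: o_def case_prod_unfold)
    show "C Tab = []" by (rule CC)
    show "sorted_wrt (<) (map fst rs)" unfolding fst using its'(2) dist' by (simp add: strict_sorted_iff)
    show "g < nn \<and> \<rho> < 2 ^ nb" if gr: "(g, \<rho>) \<in> set rs" for g \<rho>
    proof -
      obtain u where u: "(u, g) \<in> marked_pieces" "\<rho> = piece_rank its u" using gr set' by (auto simp: rs_def)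
      obtain x a where "(x, a) \<in> set ms" "g = offs ns x + a" using u by (auto simp: marked_pieces_def)
      then have "g < nn" using ms_valid[of x a] offs_Suc_le[of x ns] by (auto simp: nn_def)
      then show ?thesis using u rank_bound[OF its(2)] by simp
    qed
  qed
qed

text \<open>Eight scanning phases at 14 each make 112, and there are five sorts. The cursor pages of
  the phases contribute 24, 42, 30, 30, 18, 28, 24 and 12, in total 208; the 28 includes the
  surcharge of the right pass.\<close>

theorem wp_string_sort:
  assumes s: "at_rest ((\<lambda>_. [])(Str := map of_bool bs, Len := map length xs)) 0 s"
    and S: "\<forall>\<eta> \<mu>. \<mu> \<le> bit_bound \<longrightarrow> srt \<eta> \<mu> \<le> S"
  shows "wp (string_sort h K L) (\<lambda>_ s'. ok s' \<and>
    (separates L (set xs) h \<longrightarrow> is_sorting_permutation xs (cells s' Out)) \<and>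
    ios s' \<le> 112 + 208 * page_bound + 5 * S) s"
proof -
  let ?Q = "\<lambda>_ s'. ok s' \<and>
    (separates L (set xs) h \<longrightarrow> is_sorting_permutation xs (cells s' Out)) \<and>
    ios s' \<le> 112 + 208 * page_bound + 5 * S"
  let ?T = "wp make_table (\<lambda>_. wp (propagate_right K) (\<lambda>off_last. wp (propagate_left K off_last)
      (\<lambda>_. wp (output_permutation K) ?Q)))"
  have 3: "?T s3"
    if "ranks_state its C \<and> at_rest C (14 + 24 * page_bound + S + 42 + 102 * page_bound + 3 * S) s3" for its C s3
    using wp_columns[OF conjunct2[OF that] conjunct1[OF that] S, unfolded wp_bind]
    by (elim wp_mono) (use out_sorted that in \<open>auto simp: ranks_state_def\<close>)
  have 2: "wp (mark_mismatches K L) (\<lambda>_. wp collect_pieces (\<lambda>_. wp rank_pieces (\<lambda>_. ?T))) s2"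
    if "names_state C \<and> at_rest C (14 + 24 * page_bound + S) s2" for C s2
    using wp_ranked_marks[OF conjunct2[OF that] conjunct1[OF that] S, unfolded wp_bind]
    by (elim wp_mono exE) (rule 3)
  show ?thesis
    using wp_sorted_names[OF s refl S, unfolded wp_bind]
    unfolding string_sort_def wp_bind by (elim wp_mono exE) (rule 2)
qed

end

section \<open>Random names\<close>

lemma length_piece:
  assumes "1 \<le> L" "a < length (pieces L s)"
  shows "length (pieces L s ! a) \<in> {1..L}"
  using assms num_pieces_less[of L a "length s"] by (simp add: pieces_nth)

definition collide :: "nat \<Rightarrow> bool list \<Rightarrow> bool list \<Rightarrow> (bool list \<Rightarrow> nat) \<Rightarrow> bool" where
  "collide L s t h \<longleftrightarrow> (\<exists>a. a < length (pieces L s) \<and> a < length (pieces L t) \<and>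
     take a (pieces L s) = take a (pieces L t) \<and> pieces L s ! a \<noteq> pieces L t ! a \<and>
     h (pieces L s ! a) = h (pieces L t ! a))"

text \<open>Two strings have at most one position at which they differ after an equal beginning.
  Hence a pair of strings contributes a single collision of two fixed pieces and not one event per
  piece.\<close>

lemma prob_collide:
  assumes H: "hash_family L b H" and L: "1 \<le> L"
  shows "measure_pmf.prob H {h. collide L s t h} \<le> 1 / 2 ^ b"
proof -
  let ?D = "\<lambda>a. a < length (pieces L s) \<and> a < length (pieces L t) \<and>
     take a (pieces L s) = take a (pieces L t) \<and> pieces L s ! a \<noteq> pieces L t ! a"
  show ?thesis
  proof (cases "\<exists>a. ?D a")
    case False
    then have "{h. collide L s t h} = {}" by (auto simp: collide_def)
    then show ?thesis by simp
  next
    case True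
    then obtain a where a: "?D a" by blast
    have unique: "a' = a" if "?D a'" for a'
    proof (rule ccontr)
      assume "a' \<noteq> a"
      then consider "a < a'" | "a' < a" by linarith
      then show False
      proof cases
        case 1
        then have "take a' (pieces L s) ! a = take a' (pieces L t) ! a" using that by simp
        then show False using 1 a by simp
      next
        case 2
        then have "take a (pieces L s) ! a' = take a (pieces L t) ! a'" using a by simp
        then show False using 2 that by simp
      qed
    qed
    have "{h. collide L s t h} = {h. h (pieces L s ! a) = h (pieces L t ! a)}"
      using a unique unfolding collide_def by blast
    also have "measure_pmf.prob H \<dots> \<le> 1 / 2 ^ b"
      using H length_piece[OF L, of a s] length_piece[OF L, of a t] a unfolding hash_family_def by blast
    finally show ?thesis .
  qed
qed

lemma collide_sym: "collide L s t h = collide L t s h"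
  unfolding collide_def by metis

text \<open>A union bound over unordered pairs. With \<open>2 ^ b\<close> at least
  \<open>K ^ 2\<close> the failure probability stays below one half, independently of the number of
  pieces.\<close>

lemma prob_separates:
  assumes H: "hash_family L b H" and L: "1 \<le> L" and S: "finite S" "card S = K" and K: "K ^ 2 \<le> 2 ^ b" "1 \<le> K"
  shows "measure_pmf.prob H {h. \<not> separates L S h} \<le> real (K choose 2) / real K ^ 2"
proof -
  let ?P = "{A. A \<subseteq> S \<and> card A = 2}"
  let ?E = "\<lambda>A. {h. \<exists>s\<in>A. \<exists>t\<in>A. collide L s t h}"
  have fin: "finite ?P" using S by simp
  have E: "measure_pmf.prob H (?E A) \<le> 1 / 2 ^ b" if AP: "A \<in> ?P" for A
  proof -
    obtain s t where A: "A = {s, t}" using AP by (auto simp: card_2_iff)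
    have "\<not> collide L s s h" for s h by (auto simp: collide_def)
    \<comment> \<open>A string cannot collide with itself and collision is symmetric, so the four
      ordered choices from the pair describe one event.\<close>
    then have "?E A = {h. collide L s t h}" using collide_sym by (auto simp: A)
    then show ?thesis using prob_collide[OF H L] by simp
  qed
  have "{h. \<not> separates L S h} \<subseteq> (\<Union>A\<in>?P. ?E A)"
  proof
    fix h assume "h \<in> {h. \<not> separates L S h}"
    then obtain s t where st: "s \<in> S" "t \<in> S" "collide L s t h"
      unfolding separates_def collide_def by blast
    then have "s \<noteq> t" by (auto simp: collide_def)
    then have "{s, t} \<in> ?P" using st by simp
    then show "h \<in> (\<Union>A\<in>?P. ?E A)" using st by blast
  qed
  then have "measure_pmf.prob H {h. \<not> separates L S h} \<le> measure_pmf.prob H (\<Union>A\<in>?P. ?E A)"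
    by (intro measure_pmf.finite_measure_mono) auto
  also have "\<dots> \<le> (\<Sum>A\<in>?P. measure_pmf.prob H (?E A))"
    by (intro measure_pmf.finite_measure_subadditive_finite fin) auto
  also have "\<dots> \<le> (\<Sum>A\<in>?P. 1 / 2 ^ b)" by (intro sum_mono E)
  also have "\<dots> = real (K choose 2) * (1 / 2 ^ b)" using n_subsets[OF S(1), of 2] S by simp
  also have "\<dots> \<le> real (K choose 2) * (1 / real K ^ 2)"
  proof (intro mult_left_mono divide_left_mono)
    have "real (K ^ 2) \<le> real (2 ^ b)" using K by (simp only: of_nat_le_iff)
    then show "real K ^ 2 \<le> 2 ^ b" by simp
  qed (use K in auto)
  finally show ?thesis by simp
qed

section \<open>The number of I/Os\<close>

lemma sort_bound_mono:
  assumes "1 \<le> B" "7 * B \<le> M" "0 \<le> x" "x \<le> y"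
  shows "sort_bound M B k x \<le> sort_bound M B k' y"
proof -
  have m: "1 < real M / real B"
  proof -
    have "real B < real M" using assms by (simp add: of_nat_less_iff[symmetric] del: of_nat_less_iff)
    then show ?thesis using assms by simp
  qed
  have "max 1 (log (real M / real B) (x / B)) \<le> max 1 (log (real M / real B) (y / B))"
  proof (cases "x = 0")
    \<comment> \<open>The logarithm of 0 is 0 by convention and is absorbed by the maximum with
      1.\<close>
    case True
    then show ?thesis by (simp add: log_def)
  next
    case False
    then have "log (real M / real B) (x / B) \<le> log (real M / real B) (y / B)"
      using m assms by (intro log_mono divide_right_mono) auto
    then show ?thesis by simp
  qed
  moreover have "max 1 (x / B) \<le> max 1 (y / B)" using assms by (intro max.mono divide_right_mono) auto
  ultimately show ?thesis unfolding sort_bound_def by (intro mult_mono) auto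
qed

lemma sort_bound_ge: "1 \<le> sort_bound M B k x" "x / B \<le> sort_bound M B k x"
proof -
  have *: "max 1 (x / B) * 1 \<le> sort_bound M B k x" unfolding sort_bound_def by (intro mult_left_mono) auto
  show "1 \<le> sort_bound M B k x" using * by linarith
  show "x / B \<le> sort_bound M B k x" using * by linarith
qed

lemma log_le_log2:
  assumes "1 \<le> B" "7 * B \<le> M" "1 \<le> (a::real)"
  shows "log (real M / real B) a \<le> log 2 a"
proof -
  have "7 * real B \<le> real M" using assms by (metis of_nat_le_iff of_nat_mult of_nat_numeral)
  then have m: "2 \<le> real M / real B" using assms by (simp add: field_simps)
  have "ln 2 \<le> ln (real M / real B)" using m by simp
  then show ?thesis unfolding log_def using assms by (intro divide_left_mono) (use m in auto)
qed

text \<open>Scaling the input by \<open>a\<close> multiplies the pages by at most \<open>a\<close>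
  and adds \<open>log a\<close> to the logarithm. As \<open>M / B\<close> is at least 2, the base-2
  logarithm dominates this, and since the old factor is at least 1 the addend becomes a
  factor.\<close>

lemma sort_bound_scale:
  assumes B: "1 \<le> B" "7 * B \<le> M" and a: "1 \<le> a" and x: "0 \<le> x"
  shows "sort_bound M B k (a * x) \<le> a * (1 + log 2 a) * sort_bound M B k x"
proof -
  let ?m = "real M / real B"
  have l2: "0 \<le> log 2 a" using a by simp
  have 1: "max 1 (a * x / B) \<le> a * max 1 (x / B)"
  proof -
    have "1 * 1 \<le> a * max 1 (x / B)" using a by (intro mult_mono) auto
    moreover have "a * (x / B) \<le> a * max 1 (x / B)" using a by (intro mult_left_mono) auto
    ultimately show ?thesis by simp
  qed
  have 2: "max 1 (log ?m (a * x / B)) \<le> (1 + log 2 a) * max 1 (log ?m (x / B))"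
  proof -
    have "1 * 1 \<le> (1 + log 2 a) * max 1 (log ?m (x / B))" using l2 by (intro mult_mono) auto
    moreover have "log ?m (a * x / B) \<le> (1 + log 2 a) * max 1 (log ?m (x / B))"
    proof (cases "x = 0")
      case True
      have "0 \<le> (1 + log 2 a) * max 1 (log ?m (x / B))" using l2 by (intro mult_nonneg_nonneg) auto
      then show ?thesis using True by (simp add: log_def)
    next
      case False
      have "log ?m (a * (x / B)) = log ?m a + log ?m (x / B)"
        using a x False B by (intro log_mult_pos) auto
      also have "\<dots> \<le> log 2 a * 1 + max 1 (log ?m (x / B))" using log_le_log2[OF B a] by simp
      also have "\<dots> \<le> log 2 a * max 1 (log ?m (x / B)) + max 1 (log ?m (x / B))"
        using l2 by (intro add_mono mult_left_mono) auto
      finally show ?thesis by (simp add: algebra_simps)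
    qed
    ultimately show ?thesis by simp
  qed
  have "sort_bound M B k (a * x) \<le> (a * max 1 (x / B)) * ((1 + log 2 a) * max 1 (log ?m (x / B)))"
    unfolding sort_bound_def using a by (intro mult_mono 1 2) auto
  then show ?thesis by (simp add: sort_bound_def mult_ac)
qed

section \<open>Lengths of names and words\<close>

lemma le_two_power_ceiling_log: "1 \<le> x \<Longrightarrow> x \<le> 2 ^ nat \<lceil>log 2 x\<rceil>"
proof -
  assume x: "1 \<le> x"
  have "x = 2 powr log 2 x" using x by simp
  also have "\<dots> \<le> 2 powr real (nat \<lceil>log 2 x\<rceil>)" by (intro powr_mono) linarith+
  also have "\<dots> = 2 ^ nat \<lceil>log 2 x\<rceil>" by (simp add: powr_realpow)
  finally show ?thesis .
qed

lemma word_bits_ge: "2 * (N + K) + 1 \<le> 2 ^ word_bits N K"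
proof -
  have "real (2 * (N + K) + 1) \<le> 2 ^ word_bits N K"
    unfolding word_bits_def by (rule le_two_power_ceiling_log) simp
  then have "real (2 * (N + K) + 1) \<le> real (2 ^ word_bits N K)" by simp
  then show ?thesis by (simp only: of_nat_le_iff)
qed

lemma name_bits_ge:
  assumes "1 \<le> K"
  shows "K ^ 2 \<le> 2 ^ name_bits K"
proof -
  have "2 * log 2 (real K) = log 2 (real K ^ 2)" using assms by (simp add: log_nat_power)
  moreover have "1 \<le> real K ^ 2" using assms by simp
  ultimately have "real K ^ 2 \<le> 2 ^ name_bits K"
    unfolding name_bits_def using le_two_power_ceiling_log[of "real K ^ 2"] by simp
  then have "real (K ^ 2) \<le> real (2 ^ name_bits K)" by simp
  then show ?thesis by (simp only: of_nat_le_iff)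
qed

text \<open>Rounding up adds less than 1, which is at most \<open>2 log K\<close> from
  \<open>K = 2\<close> on; for \<open>K = 1\<close> both sides vanish.\<close>

lemma name_bits_le:
  assumes "1 \<le> K"
  shows "real (name_bits K) \<le> 2 * (2 * log 2 K)"
proof (cases "K = 1")
  case True
  then show ?thesis by (simp add: name_bits_def)
next
  case False
  then have "log 2 2 \<le> log 2 (real K)" using assms by (subst log_le_cancel_iff) auto
  then have "1 \<le> log 2 K" by simp
  moreover have "real (name_bits K) \<le> 2 * log 2 K + 1"
    unfolding name_bits_def using calculation by linarith
  ultimately show ?thesis by linarith
qed

text \<open>Rounding the exponent up at most doubles the power of two.\<close>

lemma two_power_word_bits:
  assumes "1 \<le> K"
  shows "2 ^ word_bits N K < 4 * N + 4 * K + 2"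
proof -
  let ?x = "real (2 * (N + K) + 1)"
  have x: "1 < ?x" using assms by simp
  then have l: "0 < log 2 ?x" by (subst zero_less_log_cancel_iff) auto
  then have "real (word_bits N K) < log 2 ?x + 1" unfolding word_bits_def by linarith
  then have "2 powr real (word_bits N K) < 2 powr (log 2 ?x + 1)" by simp
  also have "\<dots> = 2 * ?x" using x by (simp add: powr_add)
  finally have "real (2 ^ word_bits N K) < real (4 * N + 4 * K + 2)" by (simp add: powr_realpow)
  then show ?thesis by (simp only: of_nat_less_iff)
qed

text \<open>The extra factor 2 absorbs \<open>u = 3\<close>, where 9 exceeds 8. From 4 on, a step
  multiplies the square by at most 2.\<close>

lemma square_le_two_power: "u ^ 2 \<le> 2 * 2 ^ (u::nat)"
proof (induction u rule: less_induct)
  case (less u)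
  show ?case
  proof (cases "u < 4")
    case True
    then consider "u = 0" | "u = 1" | "u = 2" | "u = 3" by linarith
    then show ?thesis by cases auto
  next
    case False
    then obtain v where v: "u = Suc v" "3 \<le> v" by (cases u) auto
    have "u ^ 2 = v ^ 2 + 2 * v + 1" by (simp add: v power2_eq_square)
    also have "\<dots> \<le> 2 * v ^ 2"
    proof -
      have "3 * v \<le> v ^ 2" using v by (simp add: power2_eq_square)
      then show ?thesis using v by linarith
    qed
    also have "\<dots> \<le> 2 * (2 * 2 ^ v)" using less[of v] v by simp
    finally show ?thesis by (simp add: v)
  qed
qed

text \<open>If the words are long compared to \<^term>\<open>L\<close>, then there are so few strings that sorting
  \<^term>\<open>K\<close> words is cheaper than scanning the input.\<close>

lemma long_words:
  assumes K: "1 \<le> K" "K ^ 2 \<le> 2 ^ L" and L: "1 \<le> L" and w: "8 * L < word_bits N K"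
  shows "K * word_bits N K ^ 2 \<le> 64 * N"
proof -
  define w where "w = word_bits N K"
  define u where "u = w - L"
  \<comment> \<open>Since \<open>w\<close> exceeds \<open>8 * L\<close>, more than half of the word
    length lies above \<open>L\<close>, so \<open>w\<close> may be replaced by
    \<open>2 * u\<close>.\<close>
  have wu: "w = L + u" "w \<le> 2 * u" "L + 4 \<le> w" using w L by (auto simp: u_def w_def)
  have "K \<le> K ^ 2" by (simp add: power2_eq_square)
  then have KL: "K \<le> 2 ^ L" using K(2) by linarith
  have "(2::nat) ^ (L + 4) \<le> 2 ^ w" using wu by (intro power_increasing) auto
  then have "16 * K \<le> 2 ^ w" using KL by (simp add: power_add)
  moreover have "8 * K + 4 \<le> 16 * K" using K by simp
  ultimately have "8 * K + 4 \<le> 2 ^ w" by (rule order_trans[rotated])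
  moreover have "2 ^ w < 4 * N + 4 * K + 2" using two_power_word_bits[OF K(1)] by (simp add: w_def)
  \<comment> \<open>\<open>4 * K + 2\<close> is at most half of \<open>2 ^ w\<close>, so the other
    half is below \<open>4 * N\<close>: the input is exponentially long in \<open>w\<close>.\<close>
  ultimately have N: "2 ^ w \<le> 8 * N" by linarith
  have "w ^ 2 \<le> (2 * u) ^ 2" using wu by (intro power_mono) auto
  also have "\<dots> = 4 * u ^ 2" by (simp add: power2_eq_square)
  also have "\<dots> \<le> 8 * 2 ^ u" using square_le_two_power[of u] by simp
  finally have "K * w ^ 2 \<le> 2 ^ L * (8 * 2 ^ u)" using KL by (intro mult_mono) auto
  also have "\<dots> = 8 * 2 ^ w" by (simp add: wu power_add)
  also have "\<dots> \<le> 64 * N" using N by simp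
  finally show ?thesis by (simp add: w_def)
qed

text \<open>If words have at most \<open>8 * L\<close> bits, the words to sort are at most 64 times
  \<open>mu\<close>, and scaling gives \<open>64 * (1 + log 64) = 448\<close>. Otherwise even a
  logarithmic factor of order \<open>w\<close> is paid by the scan of the input, through
  \<open>long_words\<close>.\<close>

lemma sort_words:
  assumes B: "1 \<le> B" "7 * B \<le> M" and K: "1 \<le> K" "K ^ 2 \<le> 2 ^ L" and L: "1 \<le> L" and mu: "2 * real K * L \<le> mu"
  shows "sort_bound M B k (16 * (real K * word_bits N K)) \<le> 448 * sort_bound M B K mu + 6144 * (N / B)"
proof -
  define w where "w = word_bits N K"
  let ?s = "sort_bound M B K mu"
  have mu0: "0 \<le> mu" using mu by (rule order_trans[rotated]) simp
  have NB: "0 \<le> real N / real B" by simp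
  show ?thesis
  proof (cases "8 * L < w")
    case False
    then have "K * w \<le> K * (8 * L)" by simp
    then have "real (K * w) \<le> real (K * (8 * L))" by (simp only: of_nat_le_iff)
    then have "16 * (real K * w) \<le> 64 * mu" using mu by simp
    then have "sort_bound M B k (16 * (real K * w)) \<le> sort_bound M B K (64 * mu)"
      by (intro sort_bound_mono B) auto
    also have "\<dots> \<le> 64 * (1 + log 2 64) * ?s" by (intro sort_bound_scale B mu0) simp
    also have "log 2 (64::real) = 6" using log_pow_cancel[of 2 6] by simp
    also have "64 * (1 + 6) * ?s = 448 * ?s" by simp
    finally show ?thesis using NB unfolding w_def by linarith
  next
    case True
    have long: "real K * real w ^ 2 \<le> 64 * real N"
    proof -
      have "real (K * w ^ 2) \<le> real (64 * N)"
        using long_words[OF K L True[unfolded w_def]] unfolding w_def[symmetric] by (simp only: of_nat_le_iff)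
      then show ?thesis by simp
    qed
    let ?z = "16 * (real K * w) / B"
    have w9: "9 \<le> w" using True L by simp
    have s1: "1 \<le> ?s" by (rule sort_bound_ge)
    \<comment> \<open>Up to one page the bound is 1; only beyond it can the quotient be used without
      the maximum.\<close>
    show ?thesis
    proof (cases "?z \<le> 1")
      case True
      have z0: "0 < ?z" using K(1) B(1) w9 by simp
      have "real B < real M" using B by simp
      then have "log (real M / real B) ?z \<le> log (real M / real B) 1"
        using B(1) z0 True by (intro log_mono) simp_all
      then have "log (real M / real B) ?z \<le> 1" by simp
      then have "sort_bound M B k (16 * (real K * w)) = 1"
        unfolding sort_bound_def max_absorb1[OF True] by (simp only: max_absorb1 mult_1)
      then show ?thesis using s1 NB unfolding w_def[symmetric] by linarith
    next
      case False
      have lw: "log 2 (real w) \<le> w"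
      proof -
        have "real w \<le> 2 ^ w" using of_nat_less_two_power[of w] by simp
        then have "log 2 (real w) \<le> log 2 (2 ^ w)" using w9 by (intro log_mono) auto
        then show ?thesis by simp
      qed
      have lK: "log 2 (real K) \<le> w"
      proof -
        have "K \<le> K ^ 2" by (simp add: power2_eq_square)
        also have "\<dots> \<le> 2 ^ L" by (rule K)
        also have "\<dots> \<le> 2 ^ w" using \<open>8 * L < w\<close> by (intro power_increasing) auto
        finally have "real K \<le> real (2 ^ w)" by (simp only: of_nat_le_iff)
        then have "log 2 (real K) \<le> log 2 (2 ^ w)" using K by (intro log_mono) auto
        then show ?thesis by simp
      qed
      \<comment> \<open>Both \<open>K\<close> and \<open>w\<close> are at most \<open>2 ^ w\<close>,
        so this logarithm is at most \<open>4 + 2 * w\<close>, hence at most \<open>6 * w\<close>.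
        This gives \<open>96 * K * w ^ 2\<close>, and \<open>96 * 64 = 6144\<close>.\<close>
      have "log (real M / real B) ?z \<le> log 2 ?z" using False by (intro log_le_log2 B) simp
      also have "\<dots> \<le> log 2 (16 * (real K * w))"
        using False B K w9 by (intro log_mono) (auto simp: divide_le_eq mult_le_cancel_left1)
      also have "\<dots> = log 2 16 + (log 2 K + log 2 w)" using K w9 by (simp add: log_mult_pos)
      also have "log 2 (16::real) = 4" using log_pow_cancel[of 2 4] by simp
      also have "4 + (log 2 K + log 2 w) \<le> 6 * real w" using lw lK w9 by simp
      finally have "max 1 (log (real M / real B) ?z) \<le> 6 * real w" using w9 by simp
      then have "sort_bound M B k (16 * (real K * w)) \<le> ?z * (6 * real w)"
        using False unfolding sort_bound_def by (intro mult_mono) auto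
      also have "\<dots> = 96 * (real K * real w ^ 2) / B" by (simp add: power2_eq_square)
      also have "\<dots> \<le> 96 * (64 * real N) / B" using long by (intro divide_right_mono mult_left_mono) auto
      finally have "sort_bound M B k (16 * (real K * w)) \<le> 6144 * (N / B)" by simp
      moreover have "0 \<le> 448 * ?s" using s1 by simp
      ultimately show ?thesis unfolding w_def[symmetric] by linarith
    qed
  qed
qed

section \<open>The constant of the I/O bound\<close>

definition sort_scale :: "real \<Rightarrow> real" where "sort_scale a = a * (1 + log 2 a)"

lemma sort_scale_nonneg: "1 \<le> a \<Longrightarrow> 0 \<le> sort_scale a"
  unfolding sort_scale_def by (intro mult_nonneg_nonneg add_nonneg_nonneg) auto

text \<open>Here \<open>2 / c1 + 2\<close> relates the bits of names and pieces to
  \<open>N' + 2 * K * L\<close>; \<open>1664 = 8 * 208\<close> comes from the pages, 448 and 6144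
  from sorting words, and \<open>6145 = 6144 + 1\<close> includes the scan of the input
  itself.\<close>

definition io_const :: "real \<Rightarrow> real \<Rightarrow> real" where
  "io_const c c1 = 112 + 1664 * (6145 + (2 / c1 + 2) + 448) + 5 * c * (sort_scale (16 * (2 / c1 + 2)) + 448 + 6144)"

lemma weighted_sum:
  fixes a b q s n :: real
  assumes "0 \<le> q" "0 \<le> n" "0 \<le> s" "0 \<le> a" "0 \<le> b"
  shows "q * s + (a * s + b * n) \<le> (q + a + b) * (s + n)"
  using mult_nonneg_nonneg[OF assms(1,2)] mult_nonneg_nonneg[OF assms(4,2)] mult_nonneg_nonneg[OF assms(5,3)]
  by (simp add: algebra_simps)

lemma io_bound:
  fixes c c1 N' :: real and M B L K N :: nat
  assumes c: "0 < c" "0 < c1" and B: "1 \<le> B" "7 * B \<le> M" and K: "1 \<le> K" "2 * log 2 K \<le> L" and L: "1 \<le> L"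
    and N': "c1 * (N * (2 * log 2 K) / L + K) \<le> N'"
    and nn: "real nn \<le> N / L + K"
  defines "X \<equiv> nn * name_bits K + K * L" and "T \<equiv> K * word_bits N K"
  shows "112 + 208 * (8 * real (N + X + T) / B) + 5 * (c * sort_bound M B k (8 * real (X + T)))
    \<le> io_const c c1 * (sort_bound M B K (N' + 2 * K * L) + N / B)"
proof -
  let ?mu = "N' + 2 * K * L" and ?A = "2 / c1 + 2"
  let ?s = "sort_bound M B K ?mu" and ?n = "real N / real B"
  have lK: "0 \<le> log 2 (real K)" using K by simp
  have N'0: "0 \<le> N'"
  proof -
    have "0 \<le> c1 * (N * (2 * log 2 K) / L + K)" using c lK by simp
    then show ?thesis using N' by linarith
  qed
  have K2: "K ^ 2 \<le> 2 ^ L"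
  proof -
    have "2 * log 2 (real K) = log 2 (real K ^ 2)" using K by (simp add: log_nat_power)
    then have "real K ^ 2 = 2 powr (2 * log 2 (real K))" using K by simp
    also have "\<dots> \<le> 2 powr real L" using K by (intro powr_mono) auto
    finally have "real (K ^ 2) \<le> real (2 ^ L)" by (simp add: powr_realpow)
    then show ?thesis by (simp only: of_nat_le_iff)
  qed
  have mu: "2 * real K * L \<le> ?mu" "0 \<le> ?mu" using N'0 by simp_all
  \<comment> \<open>The number of names exceeds \<open>N / L\<close> by up to \<open>K\<close>
    because of short last pieces. Their \<open>2 log K\<close> bits each are not covered by
    \<open>N'\<close>, but by \<open>2 * K * L\<close>, since \<open>2 log K\<close> is at most
    \<open>L\<close>.\<close>
  have X: "real X \<le> ?A * ?mu"
  proof -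
    have "real (nn * name_bits K) \<le> (N / L + K) * (2 * (2 * log 2 K))"
      using nn name_bits_le[OF K(1)] by (simp only: of_nat_mult) (intro mult_mono, auto)
    also have "\<dots> = 2 * (N * (2 * log 2 K) / L + K) + 2 * real K * (2 * log 2 K - 1)" by (simp add: algebra_simps)
    also have "\<dots> \<le> 2 * (N' / c1) + 2 * real K * real L"
    proof -
      have "N * (2 * log 2 K) / L + K \<le> N' / c1" using N' c by (simp add: pos_le_divide_eq mult.commute)
      then have "2 * (N * (2 * log 2 K) / L + K) \<le> 2 * (N' / c1)" by (rule mult_left_mono) simp
      moreover have "2 * real K * (2 * log 2 K - 1) \<le> 2 * real K * real L"
        using K by (intro mult_left_mono) auto
      ultimately show ?thesis by (rule add_mono)
    qed
    finally have "real X \<le> 2 * (N' / c1) + 3 * (real K * L)" by (simp add: X_def)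
    also have "\<dots> \<le> (2 / c1) * ?mu + 2 * ?mu"
    proof -
      have "0 \<le> (2 / c1) * (2 * K * L)" using c by simp
      then have "2 * (N' / c1) \<le> (2 / c1) * ?mu" by (simp add: algebra_simps)
      moreover have "3 * (real K * L) \<le> 2 * ?mu" using N'0 by simp
      ultimately show ?thesis by (rule add_mono)
    qed
    finally show ?thesis by (simp add: algebra_simps)
  qed
  have A1: "1 \<le> 16 * ?A" using c by (simp add: add_nonneg_pos)
  have s1: "1 \<le> ?s" "?mu / B \<le> ?s" by (rule sort_bound_ge)+
  have n0: "0 \<le> ?n" by simp
  have T: "sort_bound M B k (16 * real T) \<le> 448 * ?s + 6144 * ?n"
    using sort_words[OF B K(1) K2 L mu(1), of k N] by (simp add: T_def)
  have X16: "sort_bound M B k (16 * real X) \<le> sort_scale (16 * ?A) * ?s"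
  proof -
    have "16 * real X \<le> 16 * (?A * ?mu)" using X by (rule mult_left_mono) simp
    then have "sort_bound M B k (16 * real X) \<le> sort_bound M B K ((16 * ?A) * ?mu)"
      unfolding mult.assoc[symmetric] by (intro sort_bound_mono B) simp_all
    also have "\<dots> \<le> sort_scale (16 * ?A) * ?s" unfolding sort_scale_def by (intro sort_bound_scale B A1 mu)
    finally show ?thesis .
  qed
  have sc: "0 \<le> sort_scale (16 * ?A)"
    by (rule sort_scale_nonneg[OF A1])
  have sb: "sort_bound M B k (8 * real (X + T)) \<le> (sort_scale (16 * ?A) + 448 + 6144) * (?s + ?n)"
  proof -
    \<comment> \<open>The sum is at most twice its larger summand, so monotonicity applies to that
      one alone and the other bound is added because it is nonnegative.\<close>
    have "sort_bound M B k (8 * real (X + T)) \<le> sort_bound M B k (16 * real X) + sort_bound M B k (16 * real T)"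
    proof (cases "X \<le> T")
      case True
      then have "sort_bound M B k (8 * real (X + T)) \<le> sort_bound M B k (16 * real T)"
        by (intro sort_bound_mono B) auto
      then show ?thesis using sort_bound_ge(1)[of M B k "16 * real X"] by linarith
    next
      case False
      then have "sort_bound M B k (8 * real (X + T)) \<le> sort_bound M B k (16 * real X)"
        by (intro sort_bound_mono B) auto
      then show ?thesis using sort_bound_ge(1)[of M B k "16 * real T"] by linarith
    qed
    also have "\<dots> \<le> sort_scale (16 * ?A) * ?s + (448 * ?s + 6144 * ?n)" by (intro add_mono X16 T)
    also have "\<dots> \<le> (sort_scale (16 * ?A) + 448 + 6144) * (?s + ?n)"
      using s1 by (intro weighted_sum sc n0) simp_all
    finally show ?thesis .
  qed
  have XB: "X / B \<le> ?A * ?s"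
  proof -
    have "X / B \<le> (?A * ?mu) / B" using X by (intro divide_right_mono) auto
    also have "\<dots> = ?A * (?mu / B)" by simp
    also have "\<dots> \<le> ?A * ?s" using s1 c by (intro mult_left_mono) (auto simp: add_nonneg_nonneg)
    finally show ?thesis .
  qed
  have TB: "T / B \<le> 448 * ?s + 6144 * ?n"
    using sort_bound_ge(2)[of "16 * real T" B M k] T divide_right_mono[of "real T" "16 * real T" "real B"] by simp
  have pages: "208 * (8 * real (N + X + T) / B) \<le> 1664 * (6145 + ?A + 448) * (?s + ?n)"
  proof -
    have "real (N + X + T) / B = ?n + X / B + T / B" by (simp add: add_divide_distrib)
    also have "\<dots> \<le> ?n + ?A * ?s + (448 * ?s + 6144 * ?n)" by (intro add_mono XB TB order_refl)
    also have "\<dots> = ?A * ?s + (448 * ?s + 6145 * ?n)" by simp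
    also have "\<dots> \<le> (?A + 448 + 6145) * (?s + ?n)"
      using s1 c by (intro weighted_sum n0) (simp_all add: add_nonneg_nonneg)
    also have "?A + 448 + 6145 = 6145 + ?A + 448" by simp
    finally have le: "real (N + X + T) / B \<le> (6145 + ?A + 448) * (?s + ?n)" .
    have "208 * (8 * real (N + X + T) / B) = 1664 * (real (N + X + T) / B)" by simp
    also have "\<dots> \<le> 1664 * ((6145 + ?A + 448) * (?s + ?n))" by (rule mult_left_mono[OF le]) simp
    finally show ?thesis by (simp only: mult.assoc)
  qed
  have "1 \<le> ?s + ?n" using s1(1) n0 by linarith
  then have "112 * 1 \<le> 112 * (?s + ?n)" by (rule mult_left_mono) simp
  then have "112 \<le> 112 * (?s + ?n)" by simp
  moreover have "5 * (c * sort_bound M B k (8 * real (X + T))) \<le> 5 * c * (sort_scale (16 * ?A) + 448 + 6144) * (?s + ?n)"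
    using mult_left_mono[OF sb, of "5 * c"] c by (simp add: mult.assoc)
  ultimately show ?thesis
    using pages unfolding io_const_def unfolding distrib_right[of _ _ "?s + ?n"] by linarith
qed

lemma num_pieces_le_divide:
  assumes "1 \<le> L"
  shows "real (num_pieces L l) \<le> real l / L + 1"
proof -
  have "num_pieces L l * L \<le> l + L - 1" unfolding num_pieces_def by (rule div_times_less_eq_dividend)
  then have "num_pieces L l * L \<le> l + L" by linarith
  then have "real (num_pieces L l * L) \<le> real (l + L)" by (simp only: of_nat_le_iff)
  then show ?thesis using assms by (simp add: field_simps)
qed

lemma (in run) nn_le_divide: "real nn \<le> real (length bs) / L + K"
proof -
  have "real nn = (\<Sum>s\<leftarrow>xs. real (num_pieces L (length s)))"
    unfolding length_names[symmetric] length_concat by (simp add: o_def flip: sum_list_of_nat)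
  also have "\<dots> \<le> (\<Sum>s\<leftarrow>xs. real (length s) / L + 1)"
    by (intro sum_list_mono num_pieces_le_divide L)
  also have "\<dots> = (\<Sum>s\<leftarrow>xs. real (length s)) / L + K"
    by (induction xs) (auto simp: add_divide_distrib)
  also have "(\<Sum>s\<leftarrow>xs. real (length s)) = real (length bs)"
    by (simp add: length_concat flip: sum_list_of_nat) (simp add: o_def)
  finally show ?thesis .
qed

section \<open>From a single run to the expectation\<close>

lemma final_run:
  fixes c c1 N' :: real and M B L K N :: nat
  assumes c: "0 < c" "0 < c1" and BM: "1 \<le> B" "7 * B \<le> M" and xs: "xs \<noteq> []"
    and K: "K = length xs" "2 * log 2 K \<le> L" and N: "N = total_length xs" and L: "1 \<le> L"
    and N': "c1 * (N * (2 * log 2 K) / L + K) \<le> N'"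
    and srt: "\<forall>\<eta> \<mu>. srt \<eta> \<mu> \<le> c * sort_bound M B \<eta> \<mu>"
    and h: "\<And>p. length p \<in> {1..L} \<Longrightarrow> h p < 2 ^ name_bits K"
  defines "s \<equiv> final M B srt xs L h"
  shows "ok s" "separates L (set xs) h \<Longrightarrow> is_sorting_permutation xs (cells s Out)"
    "ios s \<le> io_const c c1 * (sort_bound M B K (N' + 2 * K * L) + N / B)"
proof -
  define W where "W = (\<lambda>a. if a \<in> {Str, Pc} then 1 else if a \<in> {CName, Tab} then name_bits K else word_bits N K)"
  have Nc: "N = length (concat xs)" by (simp add: N total_length_def length_concat)
  have K1: "1 \<le> K" using xs K by (cases xs) auto
  interpret run B "M div B" W srt "word_bits N K" "name_bits K" xs L h
  proof
    show "1 \<le> B" by (rule BM(1))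
    show "7 \<le> M div B" using BM div_le_mono[of "7 * B" M B] by simp
    show "W = (\<lambda>a. if a \<in> {Str, Pc} then 1 else if a \<in> {CName, Tab} then name_bits K else word_bits N K)"
      by (rule W_def)
    show "1 \<le> L" by (rule L)
    show "xs \<noteq> []" by (rule xs)
    show "h p < 2 ^ name_bits K" if "length p \<in> {1..L}" for p using h[OF that] .
    show "2 * (length (concat xs) + length xs) + 1 \<le> 2 ^ word_bits N K"
      using word_bits_ge[of N K] by (simp add: Nc K)
    show "length xs ^ 2 \<le> 2 ^ name_bits K" using name_bits_ge[OF K1] by (simp add: K)
  qed
  let ?b = "real bit_bound"
  \<comment> \<open>\<open>srt\<close> itself need not be monotone, but its majorant is, so the
    value of the majorant at \<open>bit_bound\<close> covers all five sorts. The floor loses nothing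
    because costs are integers.\<close>
  define S where "S = nat \<lfloor>c * sort_bound M B 0 ?b\<rfloor>"
  have "0 \<le> c * sort_bound M B 0 ?b" using c sort_bound_ge(1)[of M B 0 ?b] by simp
  then have S: "real S \<le> c * sort_bound M B 0 ?b" unfolding S_def by linarith
  have sS: "\<forall>\<eta> \<mu>. \<mu> \<le> bit_bound \<longrightarrow> srt \<eta> \<mu> \<le> S"
  proof (intro allI impI)
    fix \<eta> \<mu> assume "\<mu> \<le> bit_bound"
    then have "c * sort_bound M B \<eta> \<mu> \<le> c * sort_bound M B 0 ?b"
      using c by (intro mult_left_mono sort_bound_mono BM) auto
    then have "real (srt \<eta> \<mu>) \<le> c * sort_bound M B 0 ?b" using srt order_trans by blast
    then show "srt \<eta> \<mu> \<le> S" unfolding S_def by linarith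
  qed
  have "at_rest ((\<lambda>_. [])(Str := map of_bool (concat xs), Len := map length xs)) 0 (initial M B srt xs)"
  proof -
    have W: "(\<lambda>a. if a \<in> {Str, Pc} then 1 else if a \<in> {CName, Tab} then name_bits (length xs)
        else word_bits (total_length xs) (length xs)) = W" by (simp only: W_def K N)
    show ?thesis unfolding at_rest_def state_def initial_def W by simp
  qed
  from wp_string_sort[OF this sS]
  have r: "ok s" "separates L (set xs) h \<longrightarrow> is_sorting_permutation xs (cells s Out)"
    "ios s \<le> 112 + 208 * page_bound + 5 * S"
    by (simp_all add: wp_def s_def final_def split: prod.splits)
  show "ok s" by (rule r)
  show "separates L (set xs) h \<Longrightarrow> is_sorting_permutation xs (cells s Out)" using r by simp
  let ?X = "nn * name_bits K + K * L" and ?T = "K * word_bits N K"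
  have "real page_bound \<le> 8 * real (N + ?X + ?T) / B"
  proof -
    have p: "page_bound = 8 * (N + ?X + ?T) div B" unfolding page_bound_def by (simp add: Nc K algebra_simps)
    have "real (8 * (N + ?X + ?T) div B) \<le> real (8 * (N + ?X + ?T)) / B" by (rule of_nat_div_le_of_nat)
    then show ?thesis unfolding p by simp
  qed
  moreover have "bit_bound = 8 * (?X + ?T)" unfolding bit_bound_def by (simp add: K algebra_simps)
  then have "real S \<le> c * sort_bound M B 0 (8 * real (?X + ?T))" using S by simp
  moreover have "real (ios s) \<le> 112 + 208 * real page_bound + 5 * real S"
    using of_nat_mono[OF r(3), where ?'a = real] by simp
  ultimately have "real (ios s) \<le> 112 + 208 * (8 * real (N + ?X + ?T) / B) + 5 * (c * sort_bound M B 0 (8 * real (?X + ?T)))"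
    by linarith
  also have "\<dots> \<le> io_const c c1 * (sort_bound M B K (N' + 2 * K * L) + N / B)"
    using nn_le_divide by (intro io_bound c BM K1 K L N') (simp add: Nc K)
  finally show "ios s \<le> io_const c c1 * (sort_bound M B K (N' + 2 * K * L) + N / B)" .
qed

lemma io_const_pos: "0 < c \<Longrightarrow> 0 < c1 \<Longrightarrow> 0 < io_const c c1"
proof -
  assume c: "0 < c" "0 < c1"
  have "1 \<le> 16 * (2 / c1 + 2)" using c by (simp add: add_nonneg_pos)
  then have "0 \<le> sort_scale (16 * (2 / c1 + 2))" by (rule sort_scale_nonneg)
  then have "0 \<le> 5 * c * (sort_scale (16 * (2 / c1 + 2)) + 448 + 6144)" using c by simp
  moreover have "0 < 1664 * (6145 + (2 / c1 + 2) + 448)" using c by (simp add: add_pos_pos)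
  ultimately show ?thesis unfolding io_const_def by linarith
qed

lemma expectation_le:
  fixes f :: "'a \<Rightarrow> real"
  assumes "\<And>x. x \<in> set_pmf p \<Longrightarrow> 0 \<le> f x \<and> f x \<le> c"
  shows "measure_pmf.expectation p f \<le> c"
proof (rule measure_pmf.integral_le_const)
  show "integrable (measure_pmf p) f"
    using assms by (intro measure_pmf.integrable_const_bound[where B = c]) (auto simp: AE_measure_pmf_iff)
  show "AE x in measure_pmf p. f x \<le> c" using assms by (auto simp: AE_measure_pmf_iff)
qed

text \<open>The bound on the I/Os holds for every \<open>h\<close> in the support, so it passes to
  the expectation at once. Likewise no run is faulty; a collision of names can only spoil the order
  of the output, which remains a permutation.\<close>

theorem theorem2:
  fixes c c1 c2 :: real
  assumes "0 < c" "0 < c1" "c1 \<le> c2"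
  shows "\<exists>C>0. \<forall>(M::nat) (B::nat) (L::nat) (K::nat) (N::nat) (N'::real)
      (S :: bool list set) (xs :: bool list list) (srt :: nat \<Rightarrow> nat \<Rightarrow> nat)
      (H :: (bool list \<Rightarrow> nat) pmf).
    1 \<le> B \<longrightarrow> 7 * B \<le> M \<longrightarrow>
    1 \<le> K \<longrightarrow> card S = K \<longrightarrow> set xs = S \<longrightarrow> distinct xs \<longrightarrow> total_length xs = N \<longrightarrow>
    1 \<le> L \<longrightarrow> 2 * log 2 K \<le> L \<longrightarrow>
    c1 * (N * (2 * log 2 K) / L + K) \<le> N' \<longrightarrow> N' \<le> c2 * (N * (2 * log 2 K) / L + K) \<longrightarrow>
    (\<forall>\<eta> \<mu>. srt \<eta> \<mu> \<le> c * sort_bound M B \<eta> \<mu>) \<longrightarrow>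
    hash_family L (name_bits K) H \<longrightarrow>
      (\<forall>h \<in> set_pmf H. ok (final M B srt xs L h) \<and>
         (separates L S h \<longrightarrow> is_sorting_permutation xs (cells (final M B srt xs L h) Out))) \<and>
      measure_pmf.prob H {h. is_sorting_permutation xs (cells (final M B srt xs L h) Out)}
        \<ge> 1 - real (K choose 2) / real K ^ 2 \<and>
      measure_pmf.expectation H (\<lambda>h. real (ios (final M B srt xs L h)))
        \<le> C * (sort_bound M B K (N' + 2 * K * L) + N / B)"
proof (intro exI[of _ "io_const c c1"] conjI allI impI)
  show "0 < io_const c c1" using assms by (intro io_const_pos)
next
  fix M B L K N :: nat and N' :: real and S :: "bool list set" and xs :: "bool list list"
    and srt :: "nat \<Rightarrow> nat \<Rightarrow> nat" and H :: "(bool list \<Rightarrow> nat) pmf"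
  assume B: "1 \<le> B" "7 * B \<le> M" and K: "1 \<le> K" "card S = K" and S: "set xs = S" and dist: "distinct xs"
    and N: "total_length xs = N" and L: "1 \<le> L" "2 * log 2 K \<le> L"
    and N': "c1 * (N * (2 * log 2 K) / L + K) \<le> N'" "N' \<le> c2 * (N * (2 * log 2 K) / L + K)"
    and srt: "\<forall>\<eta> \<mu>. srt \<eta> \<mu> \<le> c * sort_bound M B \<eta> \<mu>" and H: "hash_family L (name_bits K) H"
  have lxs: "K = length xs" using K S dist distinct_card by fastforce
  have xs: "xs \<noteq> []" using lxs K by auto
  have h: "h p < 2 ^ name_bits K" if "h \<in> set_pmf H" "length p \<in> {1..L}" for h p
    using H that unfolding hash_family_def by blast
  have run: "ok (final M B srt xs L h)"
    "separates L (set xs) h \<Longrightarrow> is_sorting_permutation xs (cells (final M B srt xs L h) Out)"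
    "ios (final M B srt xs L h) \<le> io_const c c1 * (sort_bound M B K (N' + 2 * K * L) + N / B)"
    if "h \<in> set_pmf H" for h
    using final_run[OF assms(1,2) B xs lxs L(2) N[symmetric] L(1) N'(1) srt, of h] h[OF that] by blast+
  show "\<forall>h \<in> set_pmf H. ok (final M B srt xs L h) \<and>
         (separates L S h \<longrightarrow> is_sorting_permutation xs (cells (final M B srt xs L h) Out))"
    using run(1,2) S by blast
  show "measure_pmf.prob H {h. is_sorting_permutation xs (cells (final M B srt xs L h) Out)}
        \<ge> 1 - real (K choose 2) / real K ^ 2"
  proof -
    have "measure_pmf.prob H {h. \<not> separates L S h} \<le> real (K choose 2) / real K ^ 2"
      using S K by (intro prob_separates[OF H L(1)] name_bits_ge) auto
    moreover have "measure_pmf.prob H {h. separates L S h} = 1 - measure_pmf.prob H {h. \<not> separates L S h}"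
      by (subst measure_pmf.prob_compl[symmetric]) (auto intro!: arg_cong[where f = "measure_pmf.prob H"])
    moreover have "measure_pmf.prob H {h. separates L S h}
        \<le> measure_pmf.prob H {h. is_sorting_permutation xs (cells (final M B srt xs L h) Out)}"
      using run(2) S by (intro measure_pmf.finite_measure_mono_AE) (auto simp: AE_measure_pmf_iff)
    ultimately show ?thesis by linarith
  qed
  show "measure_pmf.expectation H (\<lambda>h. real (ios (final M B srt xs L h)))
        \<le> io_const c c1 * (sort_bound M B K (N' + 2 * K * L) + N / B)"
    using run(3) by (intro expectation_le) simp
qed

end
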